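(* Let $\mathcal{E}: \mathbf{1} \to \mathcal{K} \to \mathcal{H} \xrightarrow{(\pi_1,\pi_2)} \mathcal{A} \to \mathbf{1}$ be an abelian extension of a relative Rota--Baxter group $\mathcal{A}=(A,B,\beta,T)$ by a trivial relative Rota--Baxter group $\mathcal{K}=(K,L,\alpha,S)$, where $\mathcal{H}=(H,G,\phi,R)$, such that $[\mathcal{E}] \in \mathrm{Ext}_{(\nu,\mu,\sigma,f)}(\mathcal{A},\mathcal{K})$. Then there is an exact sequence $$1 \to \mathrm{Z}^1_{RRB}(\mathcal{A},\mathcal{K}) \to \mathrm{Aut}_{\mathcal{K}}(\mathcal{H}) \xrightarrow{\rho(\mathcal{E})} \mathrm{C}_{(\nu,\mu,\sigma,f)} \xrightarrow{\omega(\mathcal{E})} \mathrm{H}^2_{RRB}(\mathcal{A},\mathcal{K}),$$ in which the first two nontrivial maps are group homomorphisms and $\omega(\mathcal{E})$ is, in general, only a derivation, i.e. $\omega(\mathcal{E})(c_1c_2)=\big(\omega(\mathcal{E})(c_1)\big)^{c_2}\,\omega(\mathcal{E})(c_2)$ for all $c_1,c_2\in \mathrm{C}_{(\nu,\mu,\sigma,f)}$; exactness at $\mathrm{C}_{(\nu,\mu,\sigma,f)}$ means that the image of $\rho(\mathcal{E})$ equals the set $\{c : \omega(\mathcal{E})(c)=1\}$.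
   Context: **Relative Rota--Baxter groups.** A relative Rota--Baxter group is a quadruple $(H,G,\phi,R)$ where $H,G$ are groups, $\phi:G\to\mathrm{Aut}(H)$, $g\mapsto\phi_g$, is a homomorphism and $R:H\to G$ is a map with $R(h_1)R(h_2)=R(h_1\phi_{R(h_1)}(h_2))$ for all $h_1,h_2\in H$. It is trivial if $\phi$ is the trivial homomorphism (then $R$ is a homomorphism). A homomorphism $(H,G,\phi,R)\to(K,L,\varphi,S)$ is a pair $(\psi,\eta)$ of group homomorphisms $\psi:H\to K$, $\eta:G\to L$ with $\eta R=S\psi$ and $\psi\phi_g=\varphi_{\eta(g)}\psi$ for all $g\in G$; it is an isomorphism if both are group isomorphisms. $\mathrm{Aut}(\cdot)$ denotes the automorphism group. **Abelian extensions.** An extension of $\mathcal{A}=(A,B,\beta,T)$ by $\mathcal{K}=(K,L,\alpha,S)$ is a sequence $\mathbf 1\to\mathcal{K}\xrightarrow{(i_1,i_2)}\mathcal{H}=(H,G,\phi,R)\xrightarrow{(\pi_1,\pi_2)}\mathcal{A}\to\mathbf 1$ of homomorphisms of relative Rota--Baxter groups with $i_1,i_2$ injective, $\pi_1,\pi_2$ surjective, $\mathrm{im}(i_1)=\ker\pi_1$ and $\mathrm{im}(i_2)=\ker\pi_2$. It is abelian if $K,L$ are abelian and $\mathcal{K}$ is trivial. $K,L$ are identified with their images under $i_1,i_2$. Two extensions of $\mathcal{A}$ by $\mathcal{K}$ are equivalent if there is an isomorphism between the middle terms compatible with the identity maps of $\mathcal{K}$ and $\mathcal{A}$; $[\mathcal{E}]$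 is the class of $\mathcal{E}$. All groups are written multiplicatively. **Associated action.** Let $s_H:A\to H$, $s_G:B\to G$ be set-theoretic sections of $\pi_1,\pi_2$ with $s_H(1)=1$, $s_G(1)=1$. The action associated with $\mathcal{E}$ is the quadruple $(\nu,\mu,\sigma,f)$ with $\nu:B\to\mathrm{Aut}(K)$, $\mu:A\to\mathrm{Aut}(K)$, $\sigma:B\to\mathrm{Aut}(L)$, $f:L\times A\to K$: $\nu_b(k)=\phi_{s_G(b)}(k)$, $\mu_a(k)=s_H(a)^{-1}ks_H(a)$, $\sigma_b(l)=s_G(b)^{-1}l\,s_G(b)$, $f(l,a)=s_H(a)^{-1}\phi_l(s_H(a))$; these do not depend on the sections. $\mathrm{Ext}_{(\nu,\mu,\sigma,f)}(\mathcal{A},\mathcal{K})$ is the set of equivalence classes of abelian extensions of $\mathcal{A}$ by $\mathcal{K}$ with associated action $(\nu,\mu,\sigma,f)$. **$\mathrm Z^1_{RRB}(\mathcal{A},\mathcal{K})$** is the group (pointwise multiplication) of pairs of maps $\kappa_1:A\to K$, $\kappa_2:B\to L$ with $\kappa_1(1)=1$, $\kappa_2(1)=1$ such that for all $a,a_1,a_2\in A$, $b,b_1,b_2\in B$: $\kappa_1(a_1a_2)=\kappa_1(a_2)\mu_{a_2}(\kappa_1(a_1))$; $\kappa_2(b_1b_2)=\kappa_2(b_2)\sigma_{b_2}(\kappa_2(b_1))$; $\nu_b(f(\kappa_2(b),a)\kappa_1(a))=\kappa_1(\beta_b(a))$; $S(\nu^{-1}_{T(a)}(\kappa_1(a)))=\kappa_2(T(a))$.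 **Second cohomology.** Let $\mathrm C^2_{RRB}$ be the group (pointwise multiplication) of quadruples of maps $(\tau_1,\tau_2,\rho,\chi)$, $\tau_1:A\times A\to K$, $\tau_2:B\times B\to L$, $\rho:A\times B\to K$, $\chi:A\to L$, each taking value $1$ whenever some argument is the identity. Write $a_1\circ_Ta_2=a_1\beta_{T(a_1)}(a_2)$. $\mathrm Z^2_{RRB}(\mathcal{A},\mathcal{K})$ is the subgroup of quadruples satisfying for all $a_i\in A$, $b_i\in B$: (i) $\tau_1(a_2,a_3)\tau_1(a_1,a_2a_3)=\tau_1(a_1a_2,a_3)\mu_{a_3}(\tau_1(a_1,a_2))$; (ii) $\tau_2(b_2,b_3)\tau_2(b_1,b_2b_3)=\tau_2(b_1b_2,b_3)\sigma_{b_3}(\tau_2(b_1,b_2))$; (iii) $\rho(\beta_{b_2}(a_1),b_1)\nu_{b_1}(\rho(a_1,b_2))=\rho(a_1,b_1b_2)\nu_{b_1b_2}(f(\tau_2(b_1,b_2),a_1))$; (iv) $\rho(a_1a_2,b_1)\nu_{b_1}(\tau_1(a_1,a_2))=\mu_{\beta_{b_1}(a_2)}(\rho(a_1,b_1))\rho(a_2,b_1)\tau_1(\beta_{b_1}(a_1),\beta_{b_1}(a_2))$; (v) $\tau_2(T(a_1),T(a_2))\,\chi(a_2)\chi(a_1\circ_Ta_2)^{-1}\sigma_{T(a_2)}(\chi(a_1))=S\big(\nu^{-1}_{T(a_1\circ_Ta_2)}\big(\rho(a_2,T(a_1))\,\tau_1(a_1,\beta_{T(a_1)}(a_2))\,\nu_{T(a_1)}(f(\chi(a_1),a_2))\big)\big)$.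 $\mathrm B^2_{RRB}(\mathcal{A},\mathcal{K})$ is the subgroup of those $(\tau_1,\tau_2,\rho,\chi)\in\mathrm Z^2_{RRB}$ for which there are maps $\kappa_1:A\to K$, $\kappa_2:B\to L$ with $\kappa_i(1)=1$ and $\tau_1(a_1,a_2)=\kappa_1(a_1a_2)^{-1}\kappa_1(a_2)\mu_{a_2}(\kappa_1(a_1))$, $\tau_2(b_1,b_2)=\kappa_2(b_1b_2)^{-1}\kappa_2(b_2)\sigma_{b_2}(\kappa_2(b_1))$, $\rho(a,b)=\nu_b(f(\kappa_2(b),a)\kappa_1(a))\kappa_1(\beta_b(a))^{-1}$, $\chi(a)=S(\nu^{-1}_{T(a)}(\kappa_1(a)))\kappa_2(T(a))^{-1}$. $\mathrm H^2_{RRB}(\mathcal{A},\mathcal{K})=\mathrm Z^2_{RRB}/\mathrm B^2_{RRB}$. **Extensions and cohomology.** It is known that sending $[\mathcal{E}]$ to the class of $(\tau_1,\tau_2,\rho,\chi)$, where $\tau_1(a_1,a_2)=s_H(a_1a_2)^{-1}s_H(a_1)s_H(a_2)$, $\tau_2(b_1,b_2)=s_G(b_1b_2)^{-1}s_G(b_1)s_G(b_2)$, $\rho(a,b)=s_H(\beta_b(a))^{-1}\phi_{s_G(b)}(s_H(a))$, $\chi(a)=s_G(T(a))^{-1}R(s_H(a))$, is a well-defined bijection $\mathrm{Ext}_{(\nu,\mu,\sigma,f)}(\mathcal{A},\mathcal{K})\to\mathrm H^2_{RRB}(\mathcal{A},\mathcal{K})$. Through it, right translation gives a right action of $\mathrm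 H^2_{RRB}$ on $\mathrm{Ext}_{(\nu,\mu,\sigma,f)}$, written $[\mathcal{E}]^h$: if $[\mathcal{E}]$ corresponds to $x$, then $[\mathcal{E}]^h$ corresponds to $xh$. **The group $\mathrm C_{(\nu,\mu,\sigma,f)}$ and its actions.** $\mathrm C_{(\nu,\mu,\sigma,f)}$ is the subgroup of $\mathrm{Aut}(\mathcal{A})\times\mathrm{Aut}(\mathcal{K})$ of pairs $(\psi,\theta)$, $\psi=(\psi_1,\psi_2)$, $\theta=(\theta_1,\theta_2)$, with $\nu_b=\theta_1^{-1}\nu_{\psi_2(b)}\theta_1$, $\mu_a=\theta_1^{-1}\mu_{\psi_1(a)}\theta_1$, $\sigma_b=\theta_2^{-1}\sigma_{\psi_2(b)}\theta_2$, $\theta_1(f(l,a))=f(\theta_2(l),\psi_1(a))$ for all $a\in A,b\in B,l\in L$. It acts on the right on $\mathrm{Ext}_{(\nu,\mu,\sigma,f)}(\mathcal{A},\mathcal{K})$ by $[\mathcal{E}]^{(\psi,\theta)}=[\mathcal{E}^{(\psi,\theta)}]$, where $\mathcal{E}^{(\psi,\theta)}$ is $\mathbf 1\to\mathcal{K}\xrightarrow{(i_1\theta_1,i_2\theta_2)}\mathcal{H}\xrightarrow{(\psi_1^{-1}\pi_1,\psi_2^{-1}\pi_2)}\mathcal{A}\to\mathbf 1$. It acts on the right on $\mathrm H^2_{RRB}(\mathcal{A},\mathcal{K})$ by automorphisms via $[(\tau_1,\tau_2,\rho,\chi)]^{(\psi,\theta)}=[(\tau_1^{(\psi,\theta)},\tau_2^{(\psi,\theta)},\rho^{(\psi,\theta)},\chi^{(\psi,\theta)})]$,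 where $\tau_1^{(\psi,\theta)}(a_1,a_2)=\theta_1^{-1}(\tau_1(\psi_1(a_1),\psi_1(a_2)))$, $\tau_2^{(\psi,\theta)}(b_1,b_2)=\theta_2^{-1}(\tau_2(\psi_2(b_1),\psi_2(b_2)))$, $\rho^{(\psi,\theta)}(a,b)=\theta_1^{-1}(\rho(\psi_1(a),\psi_2(b)))$, $\chi^{(\psi,\theta)}(a)=\theta_2^{-1}(\chi(\psi_1(a)))$. **The map $\omega(\mathcal{E})$.** For $c\in\mathrm C_{(\nu,\mu,\sigma,f)}$, $\omega(\mathcal{E})(c)$ is the unique $h_c\in\mathrm H^2_{RRB}(\mathcal{A},\mathcal{K})$ with $[\mathcal{E}]^c=[\mathcal{E}]^{h_c}$. **The map $\rho(\mathcal{E})$.** $\mathrm{Aut}_{\mathcal{K}}(\mathcal{H})$ is the subgroup of $\gamma=(\gamma_1,\gamma_2)\in\mathrm{Aut}(\mathcal{H})$ normalizing $\mathcal{K}$, i.e. $\gamma_1(K)=K$ and $\gamma_2(L)=L$. For such $\gamma$ let $\gamma_{\mathcal{K}}=(\gamma_1|_K,\gamma_2|_L)$ and let $\gamma_{\mathcal{A}}$ be the induced automorphism of $\mathcal{A}$, with components $a\mapsto\pi_1(\gamma_1(s_H(a)))$ and $b\mapsto\pi_2(\gamma_2(s_G(b)))$. Put $\rho(\mathcal{E})(\gamma)=(\gamma_{\mathcal{A}},\gamma_{\mathcal{K}})$ (this map is unrelated to the cocycle component $\rho$). *)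

theory Defs
  imports "HOL-Algebra.Algebra"
begin

section \<open>Relative Rota--Baxter groups\<close>

record ('h, 'g) rrb =
  grpH :: "'h monoid"
  grpG :: "'g monoid"
  act :: "'g \<Rightarrow> 'h \<Rightarrow> 'h"
  rbop :: "'h \<Rightarrow> 'g"

definition rrb_group :: "('h, 'g) rrb \<Rightarrow> bool" where
  "rrb_group M \<longleftrightarrow>
     group (grpH M) \<and> group (grpG M) \<and>
     act M \<in> hom (grpG M) (AutoGroup (grpH M)) \<and>
     rbop M \<in> carrier (grpH M) \<rightarrow> carrier (grpG M) \<and>
     (\<forall>h1 \<in> carrier (grpH M). \<forall>h2 \<in> carrier (grpH M).
        rbop M h1 \<otimes>\<^bsub>grpG M\<^esub> rbop M h2 = rbop M (h1 \<otimes>\<^bsub>grpH M\<^esub> act M (rbop M h1) h2))"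

definition rrb_trivial :: "('h, 'g) rrb \<Rightarrow> bool" where
  "rrb_trivial M \<longleftrightarrow> (\<forall>g \<in> carrier (grpG M). \<forall>h \<in> carrier (grpH M). act M g h = h)"

definition rrb_hom :: "('h, 'g) rrb \<Rightarrow> ('k, 'l) rrb \<Rightarrow> ('h \<Rightarrow> 'k) \<times> ('g \<Rightarrow> 'l) \<Rightarrow> bool" where
  "rrb_hom M Y = (\<lambda>(\<psi>, \<eta>).
     \<psi> \<in> hom (grpH M) (grpH Y) \<and> \<eta> \<in> hom (grpG M) (grpG Y) \<and>
     (\<forall>h \<in> carrier (grpH M). \<eta> (rbop M h) = rbop Y (\<psi> h)) \<and>
     (\<forall>g \<in> carrier (grpG M). \<forall>h \<in> carrier (grpH M). \<psi> (act M g h) = act Y (\<eta> g) (\<psi> h)))"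

definition rrb_iso :: "('h, 'g) rrb \<Rightarrow> ('k, 'l) rrb \<Rightarrow> ('h \<Rightarrow> 'k) \<times> ('g \<Rightarrow> 'l) \<Rightarrow> bool" where
  "rrb_iso M Y = (\<lambda>(\<psi>, \<eta>).
     rrb_hom M Y (\<psi>, \<eta>) \<and> \<psi> \<in> iso (grpH M) (grpH Y) \<and> \<eta> \<in> iso (grpG M) (grpG Y))"

definition rrb_Aut :: "('h, 'g) rrb \<Rightarrow> (('h \<Rightarrow> 'h) \<times> ('g \<Rightarrow> 'g)) monoid" where
  "rrb_Aut M = (AutoGroup (grpH M) \<times>\<times> AutoGroup (grpG M))
     \<lparr>carrier := {\<gamma> \<in> auto (grpH M) \<times> auto (grpG M). rrb_hom M M \<gamma>}\<rparr>"


section \<open>Abelian extensions\<close>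

record ('a, 'b, 'k, 'l, 'h, 'g) rrb_extn =
  middle :: "('h, 'g) rrb"
  inc1 :: "'k \<Rightarrow> 'h"
  inc2 :: "'l \<Rightarrow> 'g"
  proj1 :: "'h \<Rightarrow> 'a"
  proj2 :: "'g \<Rightarrow> 'b"

definition rrb_extension ::
    "('a, 'b) rrb \<Rightarrow> ('k, 'l) rrb \<Rightarrow> ('a, 'b, 'k, 'l, 'h, 'g) rrb_extn \<Rightarrow> bool" where
  "rrb_extension A K E \<longleftrightarrow>
     rrb_group A \<and> rrb_group K \<and> rrb_group (middle E) \<and>
     rrb_hom K (middle E) (inc1 E, inc2 E) \<and>
     rrb_hom (middle E) A (proj1 E, proj2 E) \<and>
     inj_on (inc1 E) (carrier (grpH K)) \<and>
     inj_on (inc2 E) (carrier (grpG K)) \<and>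
     proj1 E ` carrier (grpH (middle E)) = carrier (grpH A) \<and>
     proj2 E ` carrier (grpG (middle E)) = carrier (grpG A) \<and>
     inc1 E ` carrier (grpH K) = kernel (grpH (middle E)) (grpH A) (proj1 E) \<and>
     inc2 E ` carrier (grpG K) = kernel (grpG (middle E)) (grpG A) (proj2 E)"

definition abelian_extension ::
    "('a, 'b) rrb \<Rightarrow> ('k, 'l) rrb \<Rightarrow> ('a, 'b, 'k, 'l, 'h, 'g) rrb_extn \<Rightarrow> bool" where
  "abelian_extension A K E \<longleftrightarrow>
     rrb_extension A K E \<and> comm_group (grpH K) \<and> comm_group (grpG K) \<and> rrb_trivial K"

definition ext_equiv ::
    "('a, 'b) rrb \<Rightarrow> ('k, 'l) rrb \<Rightarrow> ('a, 'b, 'k, 'l, 'h, 'g) rrb_extn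
      \<Rightarrow> ('a, 'b, 'k, 'l, 'h2, 'g2) rrb_extn \<Rightarrow> bool" where
  "ext_equiv A K E F \<longleftrightarrow> (\<exists>\<psi> \<eta>. rrb_iso (middle E) (middle F) (\<psi>, \<eta>) \<and>
     (\<forall>k \<in> carrier (grpH K). \<psi> (inc1 E k) = inc1 F k) \<and>
     (\<forall>l \<in> carrier (grpG K). \<eta> (inc2 E l) = inc2 F l) \<and>
     (\<forall>h \<in> carrier (grpH (middle E)). proj1 F (\<psi> h) = proj1 E h) \<and>
     (\<forall>g \<in> carrier (grpG (middle E)). proj2 F (\<eta> g) = proj2 E g))"

definition sections ::
    "('a, 'b) rrb \<Rightarrow> ('a, 'b, 'k, 'l, 'h, 'g) rrb_extn \<Rightarrow> ('a \<Rightarrow> 'h) \<Rightarrow> ('b \<Rightarrow> 'g) \<Rightarrow> bool" where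
  "sections A E sH sG \<longleftrightarrow>
     sH \<in> carrier (grpH A) \<rightarrow> carrier (grpH (middle E)) \<and>
     sG \<in> carrier (grpG A) \<rightarrow> carrier (grpG (middle E)) \<and>
     (\<forall>a \<in> carrier (grpH A). proj1 E (sH a) = a) \<and>
     (\<forall>b \<in> carrier (grpG A). proj2 E (sG b) = b) \<and>
     sH \<one>\<^bsub>grpH A\<^esub> = \<one>\<^bsub>grpH (middle E)\<^esub> \<and> sG \<one>\<^bsub>grpG A\<^esub> = \<one>\<^bsub>grpG (middle E)\<^esub>"

text \<open>Elements of the groups of \<open>K\<close> are read off from elements of the middle term lying in the
  image of the inclusions.\<close>

definition backK :: "('k, 'l) rrb \<Rightarrow> ('a, 'b, 'k, 'l, 'h, 'g) rrb_extn \<Rightarrow> 'h \<Rightarrow> 'k" where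
  "backK K E = inv_into (carrier (grpH K)) (inc1 E)"

definition backL :: "('k, 'l) rrb \<Rightarrow> ('a, 'b, 'k, 'l, 'h, 'g) rrb_extn \<Rightarrow> 'g \<Rightarrow> 'l" where
  "backL K E = inv_into (carrier (grpG K)) (inc2 E)"

record ('a, 'b, 'k, 'l) rrb_action =
  nu :: "'b \<Rightarrow> 'k \<Rightarrow> 'k"
  mu :: "'a \<Rightarrow> 'k \<Rightarrow> 'k"
  sigma :: "'b \<Rightarrow> 'l \<Rightarrow> 'l"
  ff :: "'l \<Rightarrow> 'a \<Rightarrow> 'k"

text \<open>The associated action does not depend on the sections (and normalised sections exist), so
  quantifying over all of them is harmless.\<close>

definition associated_action ::
    "('a, 'b) rrb \<Rightarrow> ('k, 'l) rrb \<Rightarrow> ('a, 'b, 'k, 'l, 'h, 'g) rrb_extn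
      \<Rightarrow> ('a, 'b, 'k, 'l) rrb_action \<Rightarrow> bool" where
  "associated_action A K E D \<longleftrightarrow>
     nu D \<in> carrier (grpG A) \<rightarrow> auto (grpH K) \<and>
     mu D \<in> carrier (grpH A) \<rightarrow> auto (grpH K) \<and>
     sigma D \<in> carrier (grpG A) \<rightarrow> auto (grpG K) \<and>
     ff D \<in> carrier (grpG K) \<rightarrow> carrier (grpH A) \<rightarrow> carrier (grpH K) \<and>
     (\<forall>sH sG. sections A E sH sG \<longrightarrow>
        (\<forall>b \<in> carrier (grpG A). \<forall>k \<in> carrier (grpH K).
           nu D b k = backK K E (act (middle E) (sG b) (inc1 E k))) \<and>
        (\<forall>a \<in> carrier (grpH A). \<forall>k \<in> carrier (grpH K).
           mu D a k = backK K E
             (inv\<^bsub>grpH (middle E)\<^esub> (sH a) \<otimes>\<^bsub>grpH (middle E)\<^esub> inc1 E k \<otimes>\<^bsub>grpH (middle E)\<^esub> sH a)) \<and>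
        (\<forall>b \<in> carrier (grpG A). \<forall>l \<in> carrier (grpG K).
           sigma D b l = backL K E
             (inv\<^bsub>grpG (middle E)\<^esub> (sG b) \<otimes>\<^bsub>grpG (middle E)\<^esub> inc2 E l \<otimes>\<^bsub>grpG (middle E)\<^esub> sG b)) \<and>
        (\<forall>l \<in> carrier (grpG K). \<forall>a \<in> carrier (grpH A).
           ff D l a = backK K E
             (inv\<^bsub>grpH (middle E)\<^esub> (sH a) \<otimes>\<^bsub>grpH (middle E)\<^esub> act (middle E) (inc2 E l) (sH a))))"

text \<open>Equivalence classes are taken among extensions whose middle groups live on fixed types
  \<open>'h\<close>, \<open>'g\<close>.  As soon as one such extension exists, nothing is lost: the middle groups of any
  other extension are equipotent with \<open>K \<times> A\<close> and \<open>L \<times> B\<close>, hence can be transported to these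
  types, so every equivalence class of extensions has a representative here.\<close>

definition ext_rel ::
    "('a, 'b) rrb \<Rightarrow> ('k, 'l) rrb \<Rightarrow> ('a, 'b, 'k, 'l) rrb_action
      \<Rightarrow> (('a, 'b, 'k, 'l, 'h, 'g) rrb_extn \<times> ('a, 'b, 'k, 'l, 'h, 'g) rrb_extn) set" where
  "ext_rel A K D = {(E, F).
     abelian_extension A K E \<and> associated_action A K E D \<and>
     abelian_extension A K F \<and> associated_action A K F D \<and> ext_equiv A K E F}"

definition ext_class ::
    "('a, 'b) rrb \<Rightarrow> ('k, 'l) rrb \<Rightarrow> ('a, 'b, 'k, 'l) rrb_action
      \<Rightarrow> ('a, 'b, 'k, 'l, 'h, 'g) rrb_extn \<Rightarrow> ('a, 'b, 'k, 'l, 'h, 'g) rrb_extn set" where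
  "ext_class A K D E = ext_rel A K D `` {E}"

definition Ext ::
    "('a, 'b) rrb \<Rightarrow> ('k, 'l) rrb \<Rightarrow> ('a, 'b, 'k, 'l) rrb_action
      \<Rightarrow> ('a, 'b, 'k, 'l, 'h, 'g) rrb_extn set set" where
  "Ext A K D = {E. abelian_extension A K E \<and> associated_action A K E D} // ext_rel A K D"


section \<open>Cohomology\<close>

definition nu_inv ::
    "('k, 'l) rrb \<Rightarrow> ('a, 'b, 'k, 'l) rrb_action \<Rightarrow> 'b \<Rightarrow> 'k \<Rightarrow> 'k" where
  "nu_inv K D b = inv_into (carrier (grpH K)) (nu D b)"

definition Z1_RRB ::
    "('a, 'b) rrb \<Rightarrow> ('k, 'l) rrb \<Rightarrow> ('a, 'b, 'k, 'l) rrb_action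
      \<Rightarrow> (('a \<Rightarrow> 'k) \<times> ('b \<Rightarrow> 'l)) monoid" where
  "Z1_RRB A K D =
     (product_group (carrier (grpH A)) (\<lambda>_. grpH K) \<times>\<times> product_group (carrier (grpG A)) (\<lambda>_. grpG K))
     \<lparr>carrier := {(\<kappa>1, \<kappa>2).
        \<kappa>1 \<in> carrier (grpH A) \<rightarrow>\<^sub>E carrier (grpH K) \<and>
        \<kappa>2 \<in> carrier (grpG A) \<rightarrow>\<^sub>E carrier (grpG K) \<and>
        \<kappa>1 \<one>\<^bsub>grpH A\<^esub> = \<one>\<^bsub>grpH K\<^esub> \<and> \<kappa>2 \<one>\<^bsub>grpG A\<^esub> = \<one>\<^bsub>grpG K\<^esub> \<and>
        (\<forall>a1 \<in> carrier (grpH A). \<forall>a2 \<in> carrier (grpH A).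
           \<kappa>1 (a1 \<otimes>\<^bsub>grpH A\<^esub> a2) = \<kappa>1 a2 \<otimes>\<^bsub>grpH K\<^esub> mu D a2 (\<kappa>1 a1)) \<and>
        (\<forall>b1 \<in> carrier (grpG A). \<forall>b2 \<in> carrier (grpG A).
           \<kappa>2 (b1 \<otimes>\<^bsub>grpG A\<^esub> b2) = \<kappa>2 b2 \<otimes>\<^bsub>grpG K\<^esub> sigma D b2 (\<kappa>2 b1)) \<and>
        (\<forall>a \<in> carrier (grpH A). \<forall>b \<in> carrier (grpG A).
           nu D b (ff D (\<kappa>2 b) a \<otimes>\<^bsub>grpH K\<^esub> \<kappa>1 a) = \<kappa>1 (act A b a)) \<and>
        (\<forall>a \<in> carrier (grpH A).
           rbop K (nu_inv K D (rbop A a) (\<kappa>1 a)) = \<kappa>2 (rbop A a))}\<rparr>"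

type_synonym ('a, 'b, 'k, 'l) cochain2 =
  "('a \<times> 'a \<Rightarrow> 'k) \<times> ('b \<times> 'b \<Rightarrow> 'l) \<times> ('a \<times> 'b \<Rightarrow> 'k) \<times> ('a \<Rightarrow> 'l)"

definition C2_RRB :: "('a, 'b) rrb \<Rightarrow> ('k, 'l) rrb \<Rightarrow> ('a, 'b, 'k, 'l) cochain2 monoid" where
  "C2_RRB A K =
     (product_group (carrier (grpH A) \<times> carrier (grpH A)) (\<lambda>_. grpH K)
      \<times>\<times> product_group (carrier (grpG A) \<times> carrier (grpG A)) (\<lambda>_. grpG K)
      \<times>\<times> product_group (carrier (grpH A) \<times> carrier (grpG A)) (\<lambda>_. grpH K)
      \<times>\<times> product_group (carrier (grpH A)) (\<lambda>_. grpG K))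
     \<lparr>carrier := {(\<tau>1, \<tau>2, \<rho>, \<chi>).
        \<tau>1 \<in> carrier (grpH A) \<times> carrier (grpH A) \<rightarrow>\<^sub>E carrier (grpH K) \<and>
        \<tau>2 \<in> carrier (grpG A) \<times> carrier (grpG A) \<rightarrow>\<^sub>E carrier (grpG K) \<and>
        \<rho> \<in> carrier (grpH A) \<times> carrier (grpG A) \<rightarrow>\<^sub>E carrier (grpH K) \<and>
        \<chi> \<in> carrier (grpH A) \<rightarrow>\<^sub>E carrier (grpG K) \<and>
        (\<forall>a \<in> carrier (grpH A). \<tau>1 (\<one>\<^bsub>grpH A\<^esub>, a) = \<one>\<^bsub>grpH K\<^esub> \<and> \<tau>1 (a, \<one>\<^bsub>grpH A\<^esub>) = \<one>\<^bsub>grpH K\<^esub>) \<and>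
        (\<forall>b \<in> carrier (grpG A). \<tau>2 (\<one>\<^bsub>grpG A\<^esub>, b) = \<one>\<^bsub>grpG K\<^esub> \<and> \<tau>2 (b, \<one>\<^bsub>grpG A\<^esub>) = \<one>\<^bsub>grpG K\<^esub>) \<and>
        (\<forall>b \<in> carrier (grpG A). \<rho> (\<one>\<^bsub>grpH A\<^esub>, b) = \<one>\<^bsub>grpH K\<^esub>) \<and>
        (\<forall>a \<in> carrier (grpH A). \<rho> (a, \<one>\<^bsub>grpG A\<^esub>) = \<one>\<^bsub>grpH K\<^esub>) \<and>
        \<chi> \<one>\<^bsub>grpH A\<^esub> = \<one>\<^bsub>grpG K\<^esub>}\<rparr>"

definition circ_T :: "('a, 'b) rrb \<Rightarrow> 'a \<Rightarrow> 'a \<Rightarrow> 'a" where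
  "circ_T A a1 a2 = a1 \<otimes>\<^bsub>grpH A\<^esub> act A (rbop A a1) a2"

definition Z2_RRB ::
    "('a, 'b) rrb \<Rightarrow> ('k, 'l) rrb \<Rightarrow> ('a, 'b, 'k, 'l) rrb_action
      \<Rightarrow> ('a, 'b, 'k, 'l) cochain2 monoid" where
  "Z2_RRB A K D = (C2_RRB A K)
     \<lparr>carrier := {(\<tau>1, \<tau>2, \<rho>, \<chi>). (\<tau>1, \<tau>2, \<rho>, \<chi>) \<in> carrier (C2_RRB A K) \<and>
        (\<forall>a1 \<in> carrier (grpH A). \<forall>a2 \<in> carrier (grpH A). \<forall>a3 \<in> carrier (grpH A).
           \<tau>1 (a2, a3) \<otimes>\<^bsub>grpH K\<^esub> \<tau>1 (a1, a2 \<otimes>\<^bsub>grpH A\<^esub> a3)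
           = \<tau>1 (a1 \<otimes>\<^bsub>grpH A\<^esub> a2, a3) \<otimes>\<^bsub>grpH K\<^esub> mu D a3 (\<tau>1 (a1, a2))) \<and>
        (\<forall>b1 \<in> carrier (grpG A). \<forall>b2 \<in> carrier (grpG A). \<forall>b3 \<in> carrier (grpG A).
           \<tau>2 (b2, b3) \<otimes>\<^bsub>grpG K\<^esub> \<tau>2 (b1, b2 \<otimes>\<^bsub>grpG A\<^esub> b3)
           = \<tau>2 (b1 \<otimes>\<^bsub>grpG A\<^esub> b2, b3) \<otimes>\<^bsub>grpG K\<^esub> sigma D b3 (\<tau>2 (b1, b2))) \<and>
        (\<forall>a1 \<in> carrier (grpH A). \<forall>b1 \<in> carrier (grpG A). \<forall>b2 \<in> carrier (grpG A).
           \<rho> (act A b2 a1, b1) \<otimes>\<^bsub>grpH K\<^esub> nu D b1 (\<rho> (a1, b2))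
           = \<rho> (a1, b1 \<otimes>\<^bsub>grpG A\<^esub> b2)
             \<otimes>\<^bsub>grpH K\<^esub> nu D (b1 \<otimes>\<^bsub>grpG A\<^esub> b2) (ff D (\<tau>2 (b1, b2)) a1)) \<and>
        (\<forall>a1 \<in> carrier (grpH A). \<forall>a2 \<in> carrier (grpH A). \<forall>b1 \<in> carrier (grpG A).
           \<rho> (a1 \<otimes>\<^bsub>grpH A\<^esub> a2, b1) \<otimes>\<^bsub>grpH K\<^esub> nu D b1 (\<tau>1 (a1, a2))
           = mu D (act A b1 a2) (\<rho> (a1, b1)) \<otimes>\<^bsub>grpH K\<^esub> \<rho> (a2, b1)
             \<otimes>\<^bsub>grpH K\<^esub> \<tau>1 (act A b1 a1, act A b1 a2)) \<and>
        (\<forall>a1 \<in> carrier (grpH A). \<forall>a2 \<in> carrier (grpH A).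
           \<tau>2 (rbop A a1, rbop A a2) \<otimes>\<^bsub>grpG K\<^esub> \<chi> a2 \<otimes>\<^bsub>grpG K\<^esub> inv\<^bsub>grpG K\<^esub> (\<chi> (circ_T A a1 a2))
             \<otimes>\<^bsub>grpG K\<^esub> sigma D (rbop A a2) (\<chi> a1)
           = rbop K (nu_inv K D (rbop A (circ_T A a1 a2))
               (\<rho> (a2, rbop A a1) \<otimes>\<^bsub>grpH K\<^esub> \<tau>1 (a1, act A (rbop A a1) a2)
                \<otimes>\<^bsub>grpH K\<^esub> nu D (rbop A a1) (ff D (\<chi> a1) a2))))}\<rparr>"

definition B2_RRB ::
    "('a, 'b) rrb \<Rightarrow> ('k, 'l) rrb \<Rightarrow> ('a, 'b, 'k, 'l) rrb_action
      \<Rightarrow> ('a, 'b, 'k, 'l) cochain2 set" where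
  "B2_RRB A K D = {(\<tau>1, \<tau>2, \<rho>, \<chi>). (\<tau>1, \<tau>2, \<rho>, \<chi>) \<in> carrier (Z2_RRB A K D) \<and>
     (\<exists>\<kappa>1 \<in> carrier (grpH A) \<rightarrow> carrier (grpH K). \<exists>\<kappa>2 \<in> carrier (grpG A) \<rightarrow> carrier (grpG K).
        \<kappa>1 \<one>\<^bsub>grpH A\<^esub> = \<one>\<^bsub>grpH K\<^esub> \<and> \<kappa>2 \<one>\<^bsub>grpG A\<^esub> = \<one>\<^bsub>grpG K\<^esub> \<and>
        (\<forall>a1 \<in> carrier (grpH A). \<forall>a2 \<in> carrier (grpH A).
           \<tau>1 (a1, a2) = inv\<^bsub>grpH K\<^esub> (\<kappa>1 (a1 \<otimes>\<^bsub>grpH A\<^esub> a2)) \<otimes>\<^bsub>grpH K\<^esub> \<kappa>1 a2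
             \<otimes>\<^bsub>grpH K\<^esub> mu D a2 (\<kappa>1 a1)) \<and>
        (\<forall>b1 \<in> carrier (grpG A). \<forall>b2 \<in> carrier (grpG A).
           \<tau>2 (b1, b2) = inv\<^bsub>grpG K\<^esub> (\<kappa>2 (b1 \<otimes>\<^bsub>grpG A\<^esub> b2)) \<otimes>\<^bsub>grpG K\<^esub> \<kappa>2 b2
             \<otimes>\<^bsub>grpG K\<^esub> sigma D b2 (\<kappa>2 b1)) \<and>
        (\<forall>a \<in> carrier (grpH A). \<forall>b \<in> carrier (grpG A).
           \<rho> (a, b) = nu D b (ff D (\<kappa>2 b) a \<otimes>\<^bsub>grpH K\<^esub> \<kappa>1 a)
             \<otimes>\<^bsub>grpH K\<^esub> inv\<^bsub>grpH K\<^esub> (\<kappa>1 (act A b a))) \<and>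
        (\<forall>a \<in> carrier (grpH A).
           \<chi> a = rbop K (nu_inv K D (rbop A a) (\<kappa>1 a)) \<otimes>\<^bsub>grpG K\<^esub> inv\<^bsub>grpG K\<^esub> (\<kappa>2 (rbop A a))))}"

definition H2_RRB ::
    "('a, 'b) rrb \<Rightarrow> ('k, 'l) rrb \<Rightarrow> ('a, 'b, 'k, 'l) rrb_action
      \<Rightarrow> ('a, 'b, 'k, 'l) cochain2 set monoid" where
  "H2_RRB A K D = Z2_RRB A K D Mod B2_RRB A K D"


section \<open>Extensions and cohomology\<close>

definition ext_cocycle ::
    "('a, 'b) rrb \<Rightarrow> ('k, 'l) rrb \<Rightarrow> ('a, 'b, 'k, 'l, 'h, 'g) rrb_extn
      \<Rightarrow> ('a \<Rightarrow> 'h) \<Rightarrow> ('b \<Rightarrow> 'g) \<Rightarrow> ('a, 'b, 'k, 'l) cochain2" where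
  "ext_cocycle A K E sH sG =
     (\<lambda>(a1, a2) \<in> carrier (grpH A) \<times> carrier (grpH A). backK K E
        (inv\<^bsub>grpH (middle E)\<^esub> (sH (a1 \<otimes>\<^bsub>grpH A\<^esub> a2))
          \<otimes>\<^bsub>grpH (middle E)\<^esub> sH a1 \<otimes>\<^bsub>grpH (middle E)\<^esub> sH a2),
      \<lambda>(b1, b2) \<in> carrier (grpG A) \<times> carrier (grpG A). backL K E
        (inv\<^bsub>grpG (middle E)\<^esub> (sG (b1 \<otimes>\<^bsub>grpG A\<^esub> b2))
          \<otimes>\<^bsub>grpG (middle E)\<^esub> sG b1 \<otimes>\<^bsub>grpG (middle E)\<^esub> sG b2),
      \<lambda>(a, b) \<in> carrier (grpH A) \<times> carrier (grpG A). backK K E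
        (inv\<^bsub>grpH (middle E)\<^esub> (sH (act A b a))
          \<otimes>\<^bsub>grpH (middle E)\<^esub> act (middle E) (sG b) (sH a)),
      \<lambda>a \<in> carrier (grpH A). backL K E
        (inv\<^bsub>grpG (middle E)\<^esub> (sG (rbop A a)) \<otimes>\<^bsub>grpG (middle E)\<^esub> rbop (middle E) (sH a)))"

definition class_to_H2 ::
    "('a, 'b) rrb \<Rightarrow> ('k, 'l) rrb \<Rightarrow> ('a, 'b, 'k, 'l) rrb_action
      \<Rightarrow> ('a, 'b, 'k, 'l, 'h, 'g) rrb_extn set \<Rightarrow> ('a, 'b, 'k, 'l) cochain2 set" where
  "class_to_H2 A K D M = (THE x. \<exists>E \<in> M. \<exists>sH sG. sections A E sH sG \<and>
     x = B2_RRB A K D #>\<^bsub>Z2_RRB A K D\<^esub> ext_cocycle A K E sH sG)"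

definition ext_translate ::
    "('a, 'b) rrb \<Rightarrow> ('k, 'l) rrb \<Rightarrow> ('a, 'b, 'k, 'l) rrb_action
      \<Rightarrow> ('a, 'b, 'k, 'l, 'h, 'g) rrb_extn set \<Rightarrow> ('a, 'b, 'k, 'l) cochain2 set
      \<Rightarrow> ('a, 'b, 'k, 'l, 'h, 'g) rrb_extn set" where
  "ext_translate A K D M h = (THE Y. Y \<in> Ext A K D \<and>
     class_to_H2 A K D Y = class_to_H2 A K D M \<otimes>\<^bsub>H2_RRB A K D\<^esub> h)"


section \<open>Compatible pairs and their actions\<close>

definition C_group ::
    "('a, 'b) rrb \<Rightarrow> ('k, 'l) rrb \<Rightarrow> ('a, 'b, 'k, 'l) rrb_action
      \<Rightarrow> ((('a \<Rightarrow> 'a) \<times> ('b \<Rightarrow> 'b)) \<times> (('k \<Rightarrow> 'k) \<times> ('l \<Rightarrow> 'l))) monoid" where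
  "C_group A K D = (rrb_Aut A \<times>\<times> rrb_Aut K)
     \<lparr>carrier := {((\<psi>1, \<psi>2), (\<theta>1, \<theta>2)).
        (\<psi>1, \<psi>2) \<in> carrier (rrb_Aut A) \<and> (\<theta>1, \<theta>2) \<in> carrier (rrb_Aut K) \<and>
        (\<forall>b \<in> carrier (grpG A). \<forall>k \<in> carrier (grpH K).
           nu D b k = inv_into (carrier (grpH K)) \<theta>1 (nu D (\<psi>2 b) (\<theta>1 k))) \<and>
        (\<forall>a \<in> carrier (grpH A). \<forall>k \<in> carrier (grpH K).
           mu D a k = inv_into (carrier (grpH K)) \<theta>1 (mu D (\<psi>1 a) (\<theta>1 k))) \<and>
        (\<forall>b \<in> carrier (grpG A). \<forall>l \<in> carrier (grpG K).
           sigma D b l = inv_into (carrier (grpG K)) \<theta>2 (sigma D (\<psi>2 b) (\<theta>2 l))) \<and>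
        (\<forall>l \<in> carrier (grpG K). \<forall>a \<in> carrier (grpH A).
           \<theta>1 (ff D l a) = ff D (\<theta>2 l) (\<psi>1 a))}\<rparr>"

definition ext_twist ::
    "('a, 'b) rrb \<Rightarrow> ('a, 'b, 'k, 'l, 'h, 'g) rrb_extn
      \<Rightarrow> (('a \<Rightarrow> 'a) \<times> ('b \<Rightarrow> 'b)) \<times> (('k \<Rightarrow> 'k) \<times> ('l \<Rightarrow> 'l))
      \<Rightarrow> ('a, 'b, 'k, 'l, 'h, 'g) rrb_extn" where
  "ext_twist A E = (\<lambda>((\<psi>1, \<psi>2), (\<theta>1, \<theta>2)). E
     \<lparr>inc1 := inc1 E \<circ> \<theta>1, inc2 := inc2 E \<circ> \<theta>2,
      proj1 := inv_into (carrier (grpH A)) \<psi>1 \<circ> proj1 E,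
      proj2 := inv_into (carrier (grpG A)) \<psi>2 \<circ> proj2 E\<rparr>)"

definition cochain_twist ::
    "('a, 'b) rrb \<Rightarrow> ('k, 'l) rrb
      \<Rightarrow> (('a \<Rightarrow> 'a) \<times> ('b \<Rightarrow> 'b)) \<times> (('k \<Rightarrow> 'k) \<times> ('l \<Rightarrow> 'l))
      \<Rightarrow> ('a, 'b, 'k, 'l) cochain2 \<Rightarrow> ('a, 'b, 'k, 'l) cochain2" where
  "cochain_twist A K = (\<lambda>((\<psi>1, \<psi>2), (\<theta>1, \<theta>2)) (\<tau>1, \<tau>2, \<rho>, \<chi>).
     (\<lambda>(a1, a2) \<in> carrier (grpH A) \<times> carrier (grpH A).
        inv_into (carrier (grpH K)) \<theta>1 (\<tau>1 (\<psi>1 a1, \<psi>1 a2)),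
      \<lambda>(b1, b2) \<in> carrier (grpG A) \<times> carrier (grpG A).
        inv_into (carrier (grpG K)) \<theta>2 (\<tau>2 (\<psi>2 b1, \<psi>2 b2)),
      \<lambda>(a, b) \<in> carrier (grpH A) \<times> carrier (grpG A).
        inv_into (carrier (grpH K)) \<theta>1 (\<rho> (\<psi>1 a, \<psi>2 b)),
      \<lambda>a \<in> carrier (grpH A). inv_into (carrier (grpG K)) \<theta>2 (\<chi> (\<psi>1 a))))"

text \<open>The twist by an element of \<open>C_group\<close> is an automorphism of \<open>Z2_RRB\<close> preserving \<open>B2_RRB\<close>,
  so the class of the twisted cocycle is the image of the coset.\<close>

definition H2_twist ::
    "('a, 'b) rrb \<Rightarrow> ('k, 'l) rrb \<Rightarrow> ('a, 'b, 'k, 'l) cochain2 set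
      \<Rightarrow> (('a \<Rightarrow> 'a) \<times> ('b \<Rightarrow> 'b)) \<times> (('k \<Rightarrow> 'k) \<times> ('l \<Rightarrow> 'l))
      \<Rightarrow> ('a, 'b, 'k, 'l) cochain2 set" where
  "H2_twist A K x c = cochain_twist A K c ` x"

definition omega_map ::
    "('a, 'b) rrb \<Rightarrow> ('k, 'l) rrb \<Rightarrow> ('a, 'b, 'k, 'l) rrb_action
      \<Rightarrow> ('a, 'b, 'k, 'l, 'h, 'g) rrb_extn
      \<Rightarrow> (('a \<Rightarrow> 'a) \<times> ('b \<Rightarrow> 'b)) \<times> (('k \<Rightarrow> 'k) \<times> ('l \<Rightarrow> 'l))
      \<Rightarrow> ('a, 'b, 'k, 'l) cochain2 set" where
  "omega_map A K D E c = (THE h. h \<in> carrier (H2_RRB A K D) \<and>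
     ext_class A K D (ext_twist A E c) = ext_translate A K D (ext_class A K D E) h)"


section \<open>Automorphisms normalizing the kernel\<close>

definition Aut_normalizing ::
    "('k, 'l) rrb \<Rightarrow> ('a, 'b, 'k, 'l, 'h, 'g) rrb_extn \<Rightarrow> (('h \<Rightarrow> 'h) \<times> ('g \<Rightarrow> 'g)) monoid" where
  "Aut_normalizing K E = (rrb_Aut (middle E))
     \<lparr>carrier := {(\<gamma>1, \<gamma>2). (\<gamma>1, \<gamma>2) \<in> carrier (rrb_Aut (middle E)) \<and>
        \<gamma>1 ` inc1 E ` carrier (grpH K) = inc1 E ` carrier (grpH K) \<and>
        \<gamma>2 ` inc2 E ` carrier (grpG K) = inc2 E ` carrier (grpG K)}\<rparr>"

definition rho_map ::
    "('a, 'b) rrb \<Rightarrow> ('k, 'l) rrb \<Rightarrow> ('a, 'b, 'k, 'l, 'h, 'g) rrb_extn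
      \<Rightarrow> ('a \<Rightarrow> 'h) \<Rightarrow> ('b \<Rightarrow> 'g) \<Rightarrow> ('h \<Rightarrow> 'h) \<times> ('g \<Rightarrow> 'g)
      \<Rightarrow> (('a \<Rightarrow> 'a) \<times> ('b \<Rightarrow> 'b)) \<times> (('k \<Rightarrow> 'k) \<times> ('l \<Rightarrow> 'l))" where
  "rho_map A K E sH sG = (\<lambda>(\<gamma>1, \<gamma>2).
     ((\<lambda>a \<in> carrier (grpH A). proj1 E (\<gamma>1 (sH a)),
       \<lambda>b \<in> carrier (grpG A). proj2 E (\<gamma>2 (sG b))),
      (\<lambda>k \<in> carrier (grpH K). backK K E (\<gamma>1 (inc1 E k)),
       \<lambda>l \<in> carrier (grpG K). backL K E (\<gamma>2 (inc2 E l)))))"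

end

theory Submission
  imports Defs
begin

text \<open>
  The groups \<open>K\<close> and \<open>L\<close> act simply transitively on the fibres of the projections by right
  multiplication. Hence an automorphism inducing the identity on \<open>A\<close> and \<open>K\<close> is a fibrewise shift
  \<open>h \<mapsto> h \<kappa>(\<pi>(h))\<close>, and it is an automorphism exactly if \<open>\<kappa>\<close> is a 1-cocycle. A pair \<open>c\<close> lifts to
  an automorphism of the middle term iff \<open>E\<close> and \<open>E\<^sup>c\<close> are equivalent. If \<open>z\<close> is the cocycle of \<open>E\<close>
  for some sections, composing these with \<open>\<psi>\<close> yields sections of \<open>E\<^sup>c\<close> whose cocycle is the twist
  \<open>z\<^sup>c\<close>, so \<open>\<omega>(c)\<close> is the class of \<open>z\<^sup>-\<^sup>1 z\<^sup>c\<close>; the derivation law and exactness at \<open>C\<close> follow.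
  That \<open>\<omega>\<close> is well defined needs the bijection between extensions and cohomology classes.
\<close>

section \<open>Automorphism groups\<close>

text \<open>A kernel element can be carried to the right end of any product, through
  \<open>\<phi>\<close> and through \<open>R\<close>, so every element has the normal form section
  value times kernel element. Each of the five cocycle identities is one law of the middle term read
  in this form: associativity in H and in G, compatibility of \<open>\<phi>\<close> with products in
  G, multiplicativity of each automorphism in its image, and the Rota--Baxter identity. The
  dictionary is used in both directions: it shows that E has a cocycle, and that a cocycle turns E
  into another extension. The inverse of \<nu> enters because the Rota--Baxter identity only
  evaluates \<open>R\<close> at products of h with an image under the action of R(h), so a kernel
  factor must first be written as such an image. The main obstacle is that classes, translation and
  \<omega> are definite descriptions: existence and uniqueness must be supplied, and existence
  within the types of the middle groups of E. The derivation law arises since twisting z^-1 z^c by d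
  gives (z^d)^-1 z^(cd), and the inverse of z^d then cancels against the factor z^-1 z^d.\<close>

lemma auto_iff:
  "f \<in> auto G \<longleftrightarrow> f \<in> hom G G \<and> f \<in> extensional (carrier G) \<and> bij_betw f (carrier G) (carrier G)"
  by (auto simp: auto_def Bij_def)

lemma auto_closed: "f \<in> auto G \<Longrightarrow> x \<in> carrier G \<Longrightarrow> f x \<in> carrier G"
  by (auto simp: auto_iff hom_def)

lemma auto_mult:
  "f \<in> auto G \<Longrightarrow> x \<in> carrier G \<Longrightarrow> y \<in> carrier G \<Longrightarrow> f (x \<otimes>\<^bsub>G\<^esub> y) = f x \<otimes>\<^bsub>G\<^esub> f y"
  by (auto simp: auto_iff hom_def)

lemma auto_inj:
  "f \<in> auto G \<Longrightarrow> x \<in> carrier G \<Longrightarrow> y \<in> carrier G \<Longrightarrow> f x = f y \<longleftrightarrow> x = y"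
  by (auto simp: auto_iff bij_betw_def dest: inj_onD)

lemma auto_ext:
  assumes "f \<in> auto G" "g \<in> auto G" "\<And>x. x \<in> carrier G \<Longrightarrow> f x = g x" shows "f = g"
  using assms by (auto simp: auto_iff intro: extensionalityI)

lemma carrier_AutoGroup [simp]: "carrier (AutoGroup G) = auto G"
  by (simp add: AutoGroup_def)

lemma mult_AutoGroup_apply:
  "f \<in> auto G \<Longrightarrow> g \<in> auto G \<Longrightarrow> x \<in> carrier G \<Longrightarrow> (f \<otimes>\<^bsub>AutoGroup G\<^esub> g) x = f (g x)"
  by (simp add: AutoGroup_def BijGroup_def auto_def compose_def)

lemma one_AutoGroup_apply: "x \<in> carrier G \<Longrightarrow> \<one>\<^bsub>AutoGroup G\<^esub> x = x"
  by (simp add: AutoGroup_def BijGroup_def)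

lemma auto_inv_into_closed:
  "f \<in> auto G \<Longrightarrow> x \<in> carrier G \<Longrightarrow> inv_into (carrier G) f x \<in> carrier G"
  by (simp add: auto_def Bij_inv_into_mem)

lemma auto_inv_into_f:
  "f \<in> auto G \<Longrightarrow> x \<in> carrier G \<Longrightarrow> inv_into (carrier G) f (f x) = x"
  by (auto simp: auto_iff bij_betw_def)

lemma f_auto_inv_into:
  "f \<in> auto G \<Longrightarrow> x \<in> carrier G \<Longrightarrow> f (inv_into (carrier G) f x) = x"
  by (auto simp: auto_iff bij_betw_def f_inv_into_f)

text \<open>If \<open>f\<close> maps \<open>W\<close> onto itself, this says that its inverse does
  so too. It is applied to the images of K and L in the middle groups.\<close>

lemma auto_inv_into_image:
  assumes "f \<in> auto G" "W \<subseteq> carrier G"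
  shows "(\<lambda>x\<in>carrier G. inv_into (carrier G) f x) ` f ` W = W"
proof -
  have "(\<lambda>x\<in>carrier G. inv_into (carrier G) f x) ` f ` W = (\<lambda>x. x) ` W"
    unfolding image_image using assms auto_inv_into_f[OF assms(1)] auto_closed[OF assms(1)]
    by (intro image_cong) auto
  then show ?thesis by simp
qed

text \<open>Trades an inverse for the map itself: identities for inverses of automorphisms are
  checked after applying the automorphism.\<close>

lemma auto_inv_into_eq:
  "f \<in> auto G \<Longrightarrow> x \<in> carrier G \<Longrightarrow> y \<in> carrier G \<Longrightarrow>
    x = inv_into (carrier G) f y \<longleftrightarrow> f x = y"
  by (metis auto_inv_into_f f_auto_inv_into)

lemma (in group) auto_inv_into_mult:
  assumes "f \<in> auto G" "x \<in> carrier G" "y \<in> carrier G"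
  shows "inv_into (carrier G) f (x \<otimes> y) = inv_into (carrier G) f x \<otimes> inv_into (carrier G) f y"
  using auto_inv_into_eq[of f G "inv_into (carrier G) f x \<otimes> inv_into (carrier G) f y" "x \<otimes> y"] assms
  by (simp add: auto_mult auto_inv_into_closed f_auto_inv_into)

lemma (in group) auto_one: "f \<in> auto G \<Longrightarrow> f \<one> = \<one>"
  using hom_one[of f G G] by (simp add: auto_iff is_group)

lemma (in group) auto_m_inv: "f \<in> auto G \<Longrightarrow> x \<in> carrier G \<Longrightarrow> f (inv x) = inv (f x)"
  by (metis auto_closed auto_mult auto_one inv_equality inv_closed l_inv)

lemma (in group) auto_inv_into_one: "f \<in> auto G \<Longrightarrow> inv_into (carrier G) f \<one> = \<one>"
  by (metis auto_one auto_inv_into_f one_closed)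

text \<open>The automorphisms form a subgroup of the group of bijections of the carrier, and
  inverses in a subgroup are those of the whole group.\<close>

lemma (in group) inv_AutoGroup:
  "f \<in> auto G \<Longrightarrow> inv\<^bsub>AutoGroup G\<^esub> f = (\<lambda>x\<in>carrier G. inv_into (carrier G) f x)"
  unfolding AutoGroup_def
  using group.m_inv_consistent[OF group_BijGroup subgroup_auto] inv_BijGroup[of f "carrier G"]
  by (auto simp: auto_def)

lemma (in group) auto_restrict_inv_into:
  "f \<in> auto G \<Longrightarrow> (\<lambda>x\<in>carrier G. inv_into (carrier G) f x) \<in> auto G"
  using restrict_inv_into_hom[of f] restrict_inv_into_Bij[of f] by (auto simp: auto_def)

lemma (in group) one_AutoGroup_in: "\<one>\<^bsub>AutoGroup G\<^esub> \<in> auto G"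
  using group.is_monoid[OF AutoGroup] monoid.one_closed by fastforce

lemma (in group) mult_AutoGroup_in:
  "f \<in> auto G \<Longrightarrow> g \<in> auto G \<Longrightarrow> f \<otimes>\<^bsub>AutoGroup G\<^esub> g \<in> auto G"
  using monoid.m_closed[OF group.is_monoid[OF AutoGroup]] by simp

lemma autoI:
  assumes "f \<in> hom G G" "f \<in> extensional (carrier G)" "inj_on f (carrier G)" "f ` carrier G = carrier G"
  shows "f \<in> auto G"
  using assms by (simp add: auto_iff bij_betw_def)

section \<open>Relative Rota--Baxter groups and their automorphisms\<close>

locale rel_rb =
  fixes M :: "('h, 'g) rrb"
  assumes rrb: "rrb_group M"

sublocale rel_rb \<subseteq> H: group "grpH M" + G: group "grpG M"
  using rrb by (auto simp: rrb_group_def)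

context rel_rb
begin

abbreviation "hM \<equiv> carrier (grpH M)"
abbreviation "gM \<equiv> carrier (grpG M)"
abbreviation "AA \<equiv> AutoGroup (grpH M) \<times>\<times> AutoGroup (grpG M)"

lemma act_auto: "g \<in> gM \<Longrightarrow> act M g \<in> auto (grpH M)"
  using rrb by (auto simp: rrb_group_def hom_def)

lemma act_closed [simp]:
  "g \<in> gM \<Longrightarrow> h \<in> hM \<Longrightarrow> act M g h \<in> hM"
  by (simp add: act_auto auto_closed)

lemma act_mult [simp]:
  "g \<in> gM \<Longrightarrow> h \<in> hM \<Longrightarrow> h' \<in> hM \<Longrightarrow>
    act M g (h \<otimes>\<^bsub>grpH M\<^esub> h') = act M g h \<otimes>\<^bsub>grpH M\<^esub> act M g h'"
  by (simp add: act_auto auto_mult)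

lemma act_one [simp]: "g \<in> gM \<Longrightarrow> act M g \<one>\<^bsub>grpH M\<^esub> = \<one>\<^bsub>grpH M\<^esub>"
  by (simp add: act_auto H.auto_one)

lemma act_act [simp]:
  assumes "g \<in> gM" "g' \<in> gM" "h \<in> hM"
  shows "act M (g \<otimes>\<^bsub>grpG M\<^esub> g') h = act M g (act M g' h)"
proof -
  have "act M (g \<otimes>\<^bsub>grpG M\<^esub> g') = act M g \<otimes>\<^bsub>AutoGroup (grpH M)\<^esub> act M g'"
    using rrb assms by (auto simp: rrb_group_def hom_def)
  then show ?thesis using assms by (simp add: act_auto mult_AutoGroup_apply)
qed

text \<open>The action of the identity is idempotent and injective, hence the identity map.\<close>

lemma one_act [simp]: "h \<in> hM \<Longrightarrow> act M \<one>\<^bsub>grpG M\<^esub> h = h"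
  by (metis G.one_closed G.l_one act_act act_auto act_closed auto_inj)

lemma rb_closed [simp]: "h \<in> hM \<Longrightarrow> rbop M h \<in> gM"
  using rrb by (auto simp: rrb_group_def)

lemma rb_mult:
  "h \<in> hM \<Longrightarrow> h' \<in> hM \<Longrightarrow>
    rbop M (h \<otimes>\<^bsub>grpH M\<^esub> act M (rbop M h) h') = rbop M h \<otimes>\<^bsub>grpG M\<^esub> rbop M h'"
  using rrb by (auto simp: rrb_group_def)

text \<open>With both arguments the identity, the Rota--Baxter identity makes this value
  idempotent.\<close>

lemma rb_one [simp]: "rbop M \<one>\<^bsub>grpH M\<^esub> = \<one>\<^bsub>grpG M\<^esub>"
  using rb_mult[of "\<one>\<^bsub>grpH M\<^esub>" "\<one>\<^bsub>grpH M\<^esub>"] by simp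

lemma mem_rrb_Aut:
  "(\<gamma>1, \<gamma>2) \<in> carrier (rrb_Aut M) \<longleftrightarrow>
    \<gamma>1 \<in> auto (grpH M) \<and> \<gamma>2 \<in> auto (grpG M) \<and>
    (\<forall>h \<in> hM. \<gamma>2 (rbop M h) = rbop M (\<gamma>1 h)) \<and>
    (\<forall>g \<in> gM. \<forall>h \<in> hM. \<gamma>1 (act M g h) = act M (\<gamma>2 g) (\<gamma>1 h))"
  by (auto simp: rrb_Aut_def rrb_hom_def auto_iff)

lemma group_auto_prod: "group AA"
  by (simp add: DirProd_group H.AutoGroup G.AutoGroup)

lemma subgroup_rrb_Aut:
  "subgroup (carrier (rrb_Aut M)) AA"
proof (rule group.subgroupI[OF group_auto_prod])
  show "carrier (rrb_Aut M) \<subseteq> carrier AA"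
    by (auto simp: rrb_Aut_def)
  have "(\<one>\<^bsub>AutoGroup (grpH M)\<^esub>, \<one>\<^bsub>AutoGroup (grpG M)\<^esub>) \<in> carrier (rrb_Aut M)"
    by (simp add: mem_rrb_Aut one_AutoGroup_apply H.one_AutoGroup_in G.one_AutoGroup_in)
  then show "carrier (rrb_Aut M) \<noteq> {}" by blast
next
  fix a assume a: "a \<in> carrier (rrb_Aut M)"
  obtain f g where [simp]: "a = (f, g)" by fastforce
  have fg: "f \<in> auto (grpH M)" "g \<in> auto (grpG M)"
    and r: "\<And>h. h \<in> hM \<Longrightarrow> g (rbop M h) = rbop M (f h)"
    and m: "\<And>g' h. g' \<in> gM \<Longrightarrow> h \<in> hM \<Longrightarrow>
      f (act M g' h) = act M (g g') (f h)"
    using a by (auto simp: mem_rrb_Aut)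
  note s = fg[THEN auto_inv_into_closed] fg[THEN f_auto_inv_into]
  \<comment> \<open>Both compatibilities pass to the inverse pair: apply \<open>g\<close>,
    respectively \<open>f\<close>, and use the compatibility of the pair itself.\<close>
  have "inv_into (gM) g (rbop M h) = rbop M (inv_into (hM) f h)"
    if "h \<in> hM" for h
    using auto_inv_into_eq[OF fg(2), of "rbop M (inv_into (hM) f h)" "rbop M h"] that
    by (simp add: r s)
  moreover have "inv_into (hM) f (act M g' h) =
      act M (inv_into (gM) g g') (inv_into (hM) f h)"
    if "h \<in> hM" "g' \<in> gM" for h g'
    using auto_inv_into_eq[OF fg(1), of "act M (inv_into (gM) g g')
      (inv_into (hM) f h)" "act M g' h"] that
    by (simp add: m s)
  ultimately show "inv\<^bsub>AA\<^esub> a \<in> carrier (rrb_Aut M)"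
    using fg by (simp add: inv_DirProd[OF H.AutoGroup G.AutoGroup] mem_rrb_Aut
        H.inv_AutoGroup G.inv_AutoGroup H.auto_restrict_inv_into G.auto_restrict_inv_into
        auto_inv_into_closed)
next
  fix a b assume "a \<in> carrier (rrb_Aut M)" "b \<in> carrier (rrb_Aut M)"
  then show "a \<otimes>\<^bsub>AA\<^esub> b \<in> carrier (rrb_Aut M)"
    by (cases a; cases b) (simp add: mem_rrb_Aut mult_AutoGroup_apply auto_closed
        H.mult_AutoGroup_in G.mult_AutoGroup_in)
qed

lemma group_rrb_Aut: "group (rrb_Aut M)"
  using group.subgroup_imp_group[OF group_auto_prod subgroup_rrb_Aut] by (simp add: rrb_Aut_def)

lemma mult_rrb_Aut:
  "(f, g) \<otimes>\<^bsub>rrb_Aut M\<^esub> (f', g') = (f \<otimes>\<^bsub>AutoGroup (grpH M)\<^esub> f', g \<otimes>\<^bsub>AutoGroup (grpG M)\<^esub> g')"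
  by (simp add: rrb_Aut_def)

lemma one_rrb_Aut: "\<one>\<^bsub>rrb_Aut M\<^esub> = (\<one>\<^bsub>AutoGroup (grpH M)\<^esub>, \<one>\<^bsub>AutoGroup (grpG M)\<^esub>)"
  by (simp add: rrb_Aut_def)

lemma inv_rrb_Aut:
  "(f, g) \<in> carrier (rrb_Aut M) \<Longrightarrow>
    inv\<^bsub>rrb_Aut M\<^esub> (f, g) = (\<lambda>x\<in>hM. inv_into (hM) f x,
      \<lambda>x\<in>gM. inv_into (gM) g x)"
proof -
  assume fg: "(f, g) \<in> carrier (rrb_Aut M)"
  have eq: "AA\<lparr>carrier := carrier (rrb_Aut M)\<rparr> = rrb_Aut M"
    by (simp add: rrb_Aut_def)
  have "inv\<^bsub>rrb_Aut M\<^esub> (f, g) = inv\<^bsub>AA\<^esub> (f, g)"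
    using group.m_inv_consistent[OF group_auto_prod subgroup_rrb_Aut fg, unfolded eq] .
  also have "\<dots> = (inv\<^bsub>AutoGroup (grpH M)\<^esub> f, inv\<^bsub>AutoGroup (grpG M)\<^esub> g)"
    using fg by (intro inv_DirProd[OF H.AutoGroup G.AutoGroup]) (auto simp: mem_rrb_Aut)
  finally show ?thesis
    using fg H.inv_AutoGroup[of f] G.inv_AutoGroup[of g] by (simp add: mem_rrb_Aut)
qed

end

section \<open>The cochain groups\<close>

lemma comm_group_product_group:
  assumes "\<And>i. i \<in> I \<Longrightarrow> comm_group (G i)" shows "comm_group (product_group I G)"
proof (rule group.group_comm_groupI)
  show "group (product_group I G)"
    using assms by (simp add: comm_group.axioms(2))
  fix x y assume "x \<in> carrier (product_group I G)" "y \<in> carrier (product_group I G)"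
  then show "x \<otimes>\<^bsub>product_group I G\<^esub> y = y \<otimes>\<^bsub>product_group I G\<^esub> x"
    using assms by (auto intro!: restrict_ext comm_monoid.m_comm[OF comm_group.axioms(1)])
qed

lemma comm_group_DirProd:
  assumes "comm_group G" "comm_group H" shows "comm_group (G \<times>\<times> H)"
proof (rule group.group_comm_groupI)
  show "group (G \<times>\<times> H)"
    using assms by (simp add: DirProd_group comm_group.axioms(2))
  fix x y assume "x \<in> carrier (G \<times>\<times> H)" "y \<in> carrier (G \<times>\<times> H)"
  then show "x \<otimes>\<^bsub>G \<times>\<times> H\<^esub> y = y \<otimes>\<^bsub>G \<times>\<times> H\<^esub> x"
    using assms[THEN comm_group.axioms(1), THEN comm_monoid.m_comm] by auto
qed

text \<open>The ambient group of all quadruples of maps, before the values at identities are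
  prescribed. It is a product of function groups, and \<open>Z2_RRB\<close> gets its group structure
  as a subgroup of it.\<close>

definition cochain_prod :: "('a, 'b) rrb \<Rightarrow> ('k, 'l) rrb \<Rightarrow> ('a, 'b, 'k, 'l) cochain2 monoid" where
  "cochain_prod A K =
     product_group (carrier (grpH A) \<times> carrier (grpH A)) (\<lambda>_. grpH K)
      \<times>\<times> product_group (carrier (grpG A) \<times> carrier (grpG A)) (\<lambda>_. grpG K)
      \<times>\<times> product_group (carrier (grpH A) \<times> carrier (grpG A)) (\<lambda>_. grpH K)
      \<times>\<times> product_group (carrier (grpH A)) (\<lambda>_. grpG K)"

lemma mem_cochain_prod:
  "(t1, t2, r, x) \<in> carrier (cochain_prod A K) \<longleftrightarrow>
     t1 \<in> carrier (grpH A) \<times> carrier (grpH A) \<rightarrow>\<^sub>E carrier (grpH K) \<and>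
     t2 \<in> carrier (grpG A) \<times> carrier (grpG A) \<rightarrow>\<^sub>E carrier (grpG K) \<and>
     r \<in> carrier (grpH A) \<times> carrier (grpG A) \<rightarrow>\<^sub>E carrier (grpH K) \<and>
     x \<in> carrier (grpH A) \<rightarrow>\<^sub>E carrier (grpG K)"
  by (simp add: cochain_prod_def)

lemma mult_cochain_prod:
  "(t1, t2, r, x) \<otimes>\<^bsub>cochain_prod A K\<^esub> (t1', t2', r', x') =
    (\<lambda>p\<in>carrier (grpH A) \<times> carrier (grpH A). t1 p \<otimes>\<^bsub>grpH K\<^esub> t1' p,
     \<lambda>p\<in>carrier (grpG A) \<times> carrier (grpG A). t2 p \<otimes>\<^bsub>grpG K\<^esub> t2' p,
     \<lambda>p\<in>carrier (grpH A) \<times> carrier (grpG A). r p \<otimes>\<^bsub>grpH K\<^esub> r' p,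
     \<lambda>a\<in>carrier (grpH A). x a \<otimes>\<^bsub>grpG K\<^esub> x' a)"
  by (simp add: cochain_prod_def)

lemma cochain_eqI:
  assumes "(t1, t2, r, x) \<in> carrier (cochain_prod A K)" "(t1', t2', r', x') \<in> carrier (cochain_prod A K)"
    and "\<And>a1 a2. a1 \<in> carrier (grpH A) \<Longrightarrow> a2 \<in> carrier (grpH A) \<Longrightarrow> t1 (a1, a2) = t1' (a1, a2)"
    and "\<And>b1 b2. b1 \<in> carrier (grpG A) \<Longrightarrow> b2 \<in> carrier (grpG A) \<Longrightarrow> t2 (b1, b2) = t2' (b1, b2)"
    and "\<And>a b. a \<in> carrier (grpH A) \<Longrightarrow> b \<in> carrier (grpG A) \<Longrightarrow> r (a, b) = r' (a, b)"
    and "\<And>a. a \<in> carrier (grpH A) \<Longrightarrow> x a = x' a"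
  shows "(t1, t2, r, x) = (t1', t2', r', x')"
proof -
  note m = assms(1)[unfolded mem_cochain_prod] assms(2)[unfolded mem_cochain_prod]
  have "t1 = t1'"
    by (rule PiE_ext[OF m(1)[THEN conjunct1] m(2)[THEN conjunct1]]) (auto simp: assms(3))
  moreover have "t2 = t2'"
    by (rule PiE_ext[OF m(1)[THEN conjunct2, THEN conjunct1] m(2)[THEN conjunct2, THEN conjunct1]])
      (auto simp: assms(4))
  moreover have "r = r'"
    by (rule PiE_ext[OF m(1)[THEN conjunct2, THEN conjunct2, THEN conjunct1]
          m(2)[THEN conjunct2, THEN conjunct2, THEN conjunct1]]) (auto simp: assms(5))
  moreover have "x = x'"
    by (rule PiE_ext[OF m(1)[THEN conjunct2, THEN conjunct2, THEN conjunct2]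
          m(2)[THEN conjunct2, THEN conjunct2, THEN conjunct2]]) (rule assms(6))
  ultimately show ?thesis by simp
qed

locale rrb_pair = A: rel_rb A + K: rel_rb K
  for A :: "('a, 'b) rrb" and K :: "('k, 'l) rrb"
begin

abbreviation "cA \<equiv> carrier (grpH A)"
abbreviation "cB \<equiv> carrier (grpG A)"
abbreviation "cK \<equiv> carrier (grpH K)"
abbreviation "cL \<equiv> carrier (grpG K)"
abbreviation mA (infixl "*\<^sub>A" 70) where "x *\<^sub>A y \<equiv> x \<otimes>\<^bsub>grpH A\<^esub> y"
abbreviation mB (infixl "*\<^sub>B" 70) where "x *\<^sub>B y \<equiv> x \<otimes>\<^bsub>grpG A\<^esub> y"
abbreviation mK (infixl "*\<^sub>K" 70) where "x *\<^sub>K y \<equiv> x \<otimes>\<^bsub>grpH K\<^esub> y"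
abbreviation mL (infixl "*\<^sub>L" 70) where "x *\<^sub>L y \<equiv> x \<otimes>\<^bsub>grpG K\<^esub> y"
abbreviation "eA \<equiv> \<one>\<^bsub>grpH A\<^esub>"
abbreviation "eB \<equiv> \<one>\<^bsub>grpG A\<^esub>"
abbreviation "eK \<equiv> \<one>\<^bsub>grpH K\<^esub>"
abbreviation "eL \<equiv> \<one>\<^bsub>grpG K\<^esub>"
abbreviation "\<beta> \<equiv> act A"
abbreviation "T \<equiv> rbop A"
abbreviation "S \<equiv> rbop K"
abbreviation iK ("inv\<^sub>K _" [81] 80) where "inv\<^sub>K x \<equiv> inv\<^bsub>grpH K\<^esub> x"
abbreviation iL ("inv\<^sub>L _" [81] 80) where "inv\<^sub>L x \<equiv> inv\<^bsub>grpG K\<^esub> x"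

end

text \<open>The coefficient data detached from any extension, as far as the cochain groups require
  them. Multiplicativity of \<open>ff D\<close> in L makes the cocycle identities and the coboundary
  formula multiplicative; \<open>rrb_ab_extI\<close> derives it from an extension.\<close>

locale rrb_coeff = rrb_pair A K
  for A :: "('a, 'b) rrb" and K :: "('k, 'l) rrb" +
  fixes D :: "('a, 'b, 'k, 'l) rrb_action"
  assumes comm_K: "comm_group (grpH K)" and comm_L: "comm_group (grpG K)"
    and triv: "rrb_trivial K"
    and nu_auto: "b \<in> carrier (grpG A) \<Longrightarrow> nu D b \<in> auto (grpH K)"
    and mu_auto: "a \<in> carrier (grpH A) \<Longrightarrow> mu D a \<in> auto (grpH K)"
    and sigma_auto: "b \<in> carrier (grpG A) \<Longrightarrow> sigma D b \<in> auto (grpG K)"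
    and ff_closed [simp]: "l \<in> carrier (grpG K) \<Longrightarrow> a \<in> carrier (grpH A) \<Longrightarrow> ff D l a \<in> carrier (grpH K)"
    and ff_mult [simp]: "l \<in> carrier (grpG K) \<Longrightarrow> l' \<in> carrier (grpG K) \<Longrightarrow> a \<in> carrier (grpH A) \<Longrightarrow>
      ff D (l \<otimes>\<^bsub>grpG K\<^esub> l') a = ff D l a \<otimes>\<^bsub>grpH K\<^esub> ff D l' a"

sublocale rrb_coeff \<subseteq> KH: comm_group "grpH K" + KL: comm_group "grpG K"
  by (rule comm_K comm_L)+

context rrb_coeff
begin

abbreviation "\<nu> \<equiv> nu D"
abbreviation "\<nu>' \<equiv> nu_inv K D"
abbreviation "\<mu> \<equiv> mu D"
abbreviation "\<sigma> \<equiv> sigma D"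
abbreviation "\<f> \<equiv> ff D"
abbreviation "cC \<equiv> carrier (C_group A K D)"
abbreviation "cP \<equiv> carrier (cochain_prod A K)"
abbreviation "cZ1 \<equiv> carrier (Z1_RRB A K D)"
abbreviation "cZ2 \<equiv> carrier (Z2_RRB A K D)"
abbreviation mC (infixl "*\<^sub>C" 70) where "x *\<^sub>C y \<equiv> x \<otimes>\<^bsub>C_group A K D\<^esub> y"
abbreviation mP (infixl "*\<^sub>P" 70) where "x *\<^sub>P y \<equiv> x \<otimes>\<^bsub>cochain_prod A K\<^esub> y"
abbreviation iP ("inv\<^sub>P _" [81] 80) where "inv\<^sub>P x \<equiv> inv\<^bsub>cochain_prod A K\<^esub> x"
abbreviation mH2 (infixl "*\<^sub>2" 70) where "x *\<^sub>2 y \<equiv> x \<otimes>\<^bsub>H2_RRB A K D\<^esub> y"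
abbreviation "B2 \<equiv> B2_RRB A K D"
abbreviation "cH2 \<equiv> carrier (H2_RRB A K D)"

lemma nu_closed [simp]: "b \<in> cB \<Longrightarrow> k \<in> cK \<Longrightarrow> \<nu> b k \<in> cK"
  by (rule auto_closed[OF nu_auto])

lemma nu_mult [simp]: "b \<in> cB \<Longrightarrow> k \<in> cK \<Longrightarrow> k' \<in> cK \<Longrightarrow> \<nu> b (k *\<^sub>K k') = \<nu> b k *\<^sub>K \<nu> b k'"
  by (rule auto_mult[OF nu_auto])

lemma nu_one [simp]: "b \<in> cB \<Longrightarrow> \<nu> b eK = eK"
  by (rule K.H.auto_one[OF nu_auto])

lemma nu_m_inv [simp]: "b \<in> cB \<Longrightarrow> k \<in> cK \<Longrightarrow> \<nu> b (inv\<^sub>K k) = inv\<^sub>K (\<nu> b k)"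
  by (rule K.H.auto_m_inv[OF nu_auto])

lemma mu_closed [simp]: "a \<in> cA \<Longrightarrow> k \<in> cK \<Longrightarrow> \<mu> a k \<in> cK"
  by (rule auto_closed[OF mu_auto])

lemma mu_mult [simp]: "a \<in> cA \<Longrightarrow> k \<in> cK \<Longrightarrow> k' \<in> cK \<Longrightarrow> \<mu> a (k *\<^sub>K k') = \<mu> a k *\<^sub>K \<mu> a k'"
  by (rule auto_mult[OF mu_auto])

lemma mu_one [simp]: "a \<in> cA \<Longrightarrow> \<mu> a eK = eK"
  by (rule K.H.auto_one[OF mu_auto])

lemma mu_m_inv [simp]: "a \<in> cA \<Longrightarrow> k \<in> cK \<Longrightarrow> \<mu> a (inv\<^sub>K k) = inv\<^sub>K (\<mu> a k)"
  by (rule K.H.auto_m_inv[OF mu_auto])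

lemma sigma_closed [simp]: "b \<in> cB \<Longrightarrow> l \<in> cL \<Longrightarrow> \<sigma> b l \<in> cL"
  by (rule auto_closed[OF sigma_auto])

lemma sigma_mult [simp]: "b \<in> cB \<Longrightarrow> l \<in> cL \<Longrightarrow> l' \<in> cL \<Longrightarrow> \<sigma> b (l *\<^sub>L l') = \<sigma> b l *\<^sub>L \<sigma> b l'"
  by (rule auto_mult[OF sigma_auto])

lemma sigma_one [simp]: "b \<in> cB \<Longrightarrow> \<sigma> b eL = eL"
  by (rule K.G.auto_one[OF sigma_auto])

lemma sigma_m_inv [simp]: "b \<in> cB \<Longrightarrow> l \<in> cL \<Longrightarrow> \<sigma> b (inv\<^sub>L l) = inv\<^sub>L (\<sigma> b l)"
  by (rule K.G.auto_m_inv[OF sigma_auto])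

lemma nu_inv_closed [simp]: "b \<in> cB \<Longrightarrow> k \<in> cK \<Longrightarrow> \<nu>' b k \<in> cK"
  unfolding nu_inv_def by (rule auto_inv_into_closed[OF nu_auto])

lemma nu_inv_mult [simp]: "b \<in> cB \<Longrightarrow> k \<in> cK \<Longrightarrow> k' \<in> cK \<Longrightarrow> \<nu>' b (k *\<^sub>K k') = \<nu>' b k *\<^sub>K \<nu>' b k'"
  unfolding nu_inv_def by (rule K.H.auto_inv_into_mult[OF nu_auto])

lemma nu_inv_one [simp]: "b \<in> cB \<Longrightarrow> \<nu>' b eK = eK"
  unfolding nu_inv_def by (rule K.H.auto_inv_into_one[OF nu_auto])

lemma nu_nu_inv [simp]: "b \<in> cB \<Longrightarrow> k \<in> cK \<Longrightarrow> \<nu> b (\<nu>' b k) = k"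
  unfolding nu_inv_def by (rule f_auto_inv_into[OF nu_auto])

lemma nu_inv_nu [simp]: "b \<in> cB \<Longrightarrow> k \<in> cK \<Longrightarrow> \<nu>' b (\<nu> b k) = k"
  unfolding nu_inv_def by (rule auto_inv_into_f[OF nu_auto])

lemma nu_inv_m_inv [simp]:
  "b \<in> cB \<Longrightarrow> k \<in> cK \<Longrightarrow> \<nu>' b (inv\<^sub>K k) = inv\<^sub>K (\<nu>' b k)"
  by (metis K.H.inv_closed nu_inv_closed nu_inv_nu nu_m_inv nu_nu_inv)

lemma ff_one [simp]: "a \<in> cA \<Longrightarrow> \<f> eL a = eK"
  using ff_mult[of eL eL a] by (simp del: ff_mult)

lemma ff_m_inv [simp]: "l \<in> cL \<Longrightarrow> a \<in> cA \<Longrightarrow> \<f> (inv\<^sub>L l) a = inv\<^sub>K (\<f> l a)"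
  by (metis K.H.inv_equality K.G.inv_closed K.G.l_inv ff_closed ff_mult ff_one)

lemma act_K [simp]: "l \<in> cL \<Longrightarrow> k \<in> cK \<Longrightarrow> act K l k = k"
  using triv by (simp add: rrb_trivial_def)

text \<open>For a trivial action the Rota--Baxter identity is plain multiplicativity.\<close>

lemma S_mult [simp]: "k \<in> cK \<Longrightarrow> k' \<in> cK \<Longrightarrow> S (k *\<^sub>K k') = S k *\<^sub>L S k'"
  using K.rb_mult[of k k'] by simp

lemma S_m_inv [simp]: "k \<in> cK \<Longrightarrow> S (inv\<^sub>K k) = inv\<^sub>L (S k)"
  by (metis K.H.inv_closed K.H.l_inv K.rb_closed K.rb_one K.G.inv_equality S_mult)

lemma comm_group_cochain_prod: "comm_group (cochain_prod A K)"
  by (simp add: cochain_prod_def comm_group_DirProd comm_group_product_group comm_K comm_L)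

end

sublocale rrb_coeff \<subseteq> CP: comm_group "cochain_prod A K"
  by (rule comm_group_cochain_prod)

section \<open>Cocycles, coboundaries and the second cohomology group\<close>

context rrb_coeff
begin

lemma one_cochain_prod:
  "\<one>\<^bsub>cochain_prod A K\<^esub> = (\<lambda>_\<in>cA \<times> cA. eK, \<lambda>_\<in>cB \<times> cB. eL, \<lambda>_\<in>cA \<times> cB. eK, \<lambda>_\<in>cA. eL)"
  by (simp add: cochain_prod_def)

lemma inv_cochain_prod:
  assumes "(t1, t2, r, x) \<in> cP"
  shows "inv\<^sub>P (t1, t2, r, x) =
    (\<lambda>p\<in>cA \<times> cA. inv\<^sub>K (t1 p), \<lambda>p\<in>cB \<times> cB. inv\<^sub>L (t2 p),
     \<lambda>p\<in>cA \<times> cB. inv\<^sub>K (r p), \<lambda>a\<in>cA. inv\<^sub>L (x a))"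
  using assms
  by (simp add: cochain_prod_def DirProd_group)

lemma Z2_eq: "Z2_RRB A K D = (cochain_prod A K)\<lparr>carrier := cZ2\<rparr>"
  by (simp add: Z2_RRB_def C2_RRB_def cochain_prod_def)

lemma mult_Z2 [simp]: "monoid.mult (Z2_RRB A K D) = monoid.mult (cochain_prod A K)"
  and one_Z2 [simp]: "one (Z2_RRB A K D) = one (cochain_prod A K)"
  by (subst Z2_eq, simp)+

lemma mem_Z2:
  "(t1, t2, r, x) \<in> cZ2 \<longleftrightarrow>
   (t1, t2, r, x) \<in> cP \<and>
   (\<forall>a\<in>cA. t1 (eA, a) = eK \<and> t1 (a, eA) = eK) \<and> (\<forall>b\<in>cB. t2 (eB, b) = eL \<and> t2 (b, eB) = eL) \<and>
   (\<forall>b\<in>cB. r (eA, b) = eK) \<and> (\<forall>a\<in>cA. r (a, eB) = eK) \<and> x eA = eL \<and>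
   (\<forall>a1\<in>cA. \<forall>a2\<in>cA. \<forall>a3\<in>cA.
      t1 (a2, a3) *\<^sub>K t1 (a1, a2 *\<^sub>A a3) = t1 (a1 *\<^sub>A a2, a3) *\<^sub>K \<mu> a3 (t1 (a1, a2))) \<and>
   (\<forall>b1\<in>cB. \<forall>b2\<in>cB. \<forall>b3\<in>cB.
      t2 (b2, b3) *\<^sub>L t2 (b1, b2 *\<^sub>B b3) = t2 (b1 *\<^sub>B b2, b3) *\<^sub>L \<sigma> b3 (t2 (b1, b2))) \<and>
   (\<forall>a1\<in>cA. \<forall>b1\<in>cB. \<forall>b2\<in>cB.
      r (\<beta> b2 a1, b1) *\<^sub>K \<nu> b1 (r (a1, b2)) = r (a1, b1 *\<^sub>B b2) *\<^sub>K \<nu> (b1 *\<^sub>B b2) (\<f> (t2 (b1, b2)) a1)) \<and>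
   (\<forall>a1\<in>cA. \<forall>a2\<in>cA. \<forall>b1\<in>cB.
      r (a1 *\<^sub>A a2, b1) *\<^sub>K \<nu> b1 (t1 (a1, a2))
      = \<mu> (\<beta> b1 a2) (r (a1, b1)) *\<^sub>K r (a2, b1) *\<^sub>K t1 (\<beta> b1 a1, \<beta> b1 a2)) \<and>
   (\<forall>a1\<in>cA. \<forall>a2\<in>cA.
      t2 (T a1, T a2) *\<^sub>L x a2 *\<^sub>L inv\<^sub>L (x (a1 *\<^sub>A \<beta> (T a1) a2)) *\<^sub>L \<sigma> (T a2) (x a1)
      = S (\<nu>' (T (a1 *\<^sub>A \<beta> (T a1) a2))
          (r (a2, T a1) *\<^sub>K t1 (a1, \<beta> (T a1) a2) *\<^sub>K \<nu> (T a1) (\<f> (x a1) a2))))"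
  unfolding Z2_RRB_def C2_RRB_def mem_cochain_prod circ_T_def by simp

lemma cochain_closed:
  assumes "(t1, t2, r, x) \<in> cP"
  shows "a1 \<in> cA \<Longrightarrow> a2 \<in> cA \<Longrightarrow> t1 (a1, a2) \<in> cK" "b1 \<in> cB \<Longrightarrow> b2 \<in> cB \<Longrightarrow> t2 (b1, b2) \<in> cL"
    "a1 \<in> cA \<Longrightarrow> b1 \<in> cB \<Longrightarrow> r (a1, b1) \<in> cK" "a1 \<in> cA \<Longrightarrow> x a1 \<in> cL"
  using assms by (auto simp: mem_cochain_prod)

lemma Z2_carrier: "z \<in> cZ2 \<Longrightarrow> z \<in> cP"
  by (cases z) (simp add: mem_Z2)

lemma Z2D:
  assumes "(t1, t2, r, x) \<in> cZ2"
  shows "a \<in> cA \<Longrightarrow> t1 (eA, a) = eK" "a \<in> cA \<Longrightarrow> t1 (a, eA) = eK"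
    "b \<in> cB \<Longrightarrow> t2 (eB, b) = eL" "b \<in> cB \<Longrightarrow> t2 (b, eB) = eL"
    "b \<in> cB \<Longrightarrow> r (eA, b) = eK" "a \<in> cA \<Longrightarrow> r (a, eB) = eK" "x eA = eL"
  using assms unfolding mem_Z2 by (elim conjE; blast)+

lemma Z2_eqs:
  assumes "(t1, t2, r, x) \<in> cZ2"
  shows "a1 \<in> cA \<Longrightarrow> a2 \<in> cA \<Longrightarrow> a3 \<in> cA \<Longrightarrow>
      t1 (a2, a3) *\<^sub>K t1 (a1, a2 *\<^sub>A a3) = t1 (a1 *\<^sub>A a2, a3) *\<^sub>K \<mu> a3 (t1 (a1, a2))"
    and "b1 \<in> cB \<Longrightarrow> b2 \<in> cB \<Longrightarrow> b3 \<in> cB \<Longrightarrow>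
      t2 (b2, b3) *\<^sub>L t2 (b1, b2 *\<^sub>B b3) = t2 (b1 *\<^sub>B b2, b3) *\<^sub>L \<sigma> b3 (t2 (b1, b2))"
    and "a1 \<in> cA \<Longrightarrow> b1 \<in> cB \<Longrightarrow> b2 \<in> cB \<Longrightarrow>
      r (\<beta> b2 a1, b1) *\<^sub>K \<nu> b1 (r (a1, b2)) = r (a1, b1 *\<^sub>B b2) *\<^sub>K \<nu> (b1 *\<^sub>B b2) (\<f> (t2 (b1, b2)) a1)"
    and "a1 \<in> cA \<Longrightarrow> a2 \<in> cA \<Longrightarrow> b1 \<in> cB \<Longrightarrow>
      r (a1 *\<^sub>A a2, b1) *\<^sub>K \<nu> b1 (t1 (a1, a2))
      = \<mu> (\<beta> b1 a2) (r (a1, b1)) *\<^sub>K r (a2, b1) *\<^sub>K t1 (\<beta> b1 a1, \<beta> b1 a2)"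
    and "a1 \<in> cA \<Longrightarrow> a2 \<in> cA \<Longrightarrow>
      t2 (T a1, T a2) *\<^sub>L x a2 *\<^sub>L inv\<^sub>L (x (a1 *\<^sub>A \<beta> (T a1) a2)) *\<^sub>L \<sigma> (T a2) (x a1)
      = S (\<nu>' (T (a1 *\<^sub>A \<beta> (T a1) a2))
          (r (a2, T a1) *\<^sub>K t1 (a1, \<beta> (T a1) a2) *\<^sub>K \<nu> (T a1) (\<f> (x a1) a2)))"
  using assms unfolding mem_Z2 by (elim conjE; blast)+

text \<open>Both sides of every cocycle condition are multiplicative in the cochain, since K and L
  are commutative and all structure maps are homomorphisms in the relevant argument. Hence the
  equations may be inverted and multiplied.\<close>

lemma subgroup_Z2: "subgroup cZ2 (cochain_prod A K)"
proof (rule group.subgroupI)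
  show "group (cochain_prod A K)" by (rule CP.is_group)
  show "cZ2 \<subseteq> cP"
    by (auto intro: Z2_carrier)
  have "\<one>\<^bsub>cochain_prod A K\<^esub> \<in> cZ2"
    using CP.one_closed by (simp add: one_cochain_prod mem_Z2)
  then show "cZ2 \<noteq> {}" by blast
next
  fix z assume z: "z \<in> cZ2"
  obtain t1 t2 r x where z_def: "z = (t1, t2, r, x)" by (cases z)
  have zc: "(t1, t2, r, x) \<in> cP" using z Z2_carrier by (simp add: z_def)
  note [simp] = cochain_closed[OF zc] Z2D[OF z[unfolded z_def]]
  note e = Z2_eqs[OF z[unfolded z_def]]
  note ac = KH.inv_mult KL.inv_mult KH.m_ac KL.m_ac
  \<comment> \<open>Below, goals 2 to 8 are the normalisation conditions and goals 9 to 13 the five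
    identities, obtained by inverting both sides of those for \<open>z\<close>. The product is
    handled with the same numbering.\<close>
  show "inv\<^sub>P z \<in> cZ2"
    unfolding z_def inv_cochain_prod[OF zc] mem_Z2
  proof (intro conjI ballI, goal_cases)
    case 1 then show ?case using CP.inv_closed[OF zc] by (simp add: inv_cochain_prod[OF zc])
  next
    case (9 a1 a2 a3)
    show ?case using 9 arg_cong[OF e(1)[OF 9], of "m_inv (grpH K)"] by (simp add: ac)
  next
    case (10 a1 a2 a3)
    show ?case using 10 arg_cong[OF e(2)[OF 10], of "m_inv (grpG K)"] by (simp add: ac)
  next
    case (11 a1 b1 b2)
    show ?case using 11 arg_cong[OF e(3)[OF 11], of "m_inv (grpH K)"] by (simp add: ac)
  next
    case (12 a1 a2 b1)
    show ?case using 12 arg_cong[OF e(4)[OF 12], of "m_inv (grpH K)"] by (simp add: ac)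
  next
    case (13 a1 a2)
    show ?case using 13 arg_cong[OF e(5)[OF 13], of "m_inv (grpG K)"] by (simp add: ac)
  qed simp_all
next
  fix z z' assume zz: "z \<in> cZ2" "z' \<in> cZ2"
  obtain t1 t2 r x where z_def: "z = (t1, t2, r, x)" by (cases z)
  obtain t1' t2' r' x' where z'_def: "z' = (t1', t2', r', x')" by (cases z')
  note z = zz(1)[unfolded z_def] and z' = zz(2)[unfolded z'_def]
  note [simp] = cochain_closed[OF Z2_carrier[OF z]] Z2D[OF z] cochain_closed[OF Z2_carrier[OF z']] Z2D[OF z']
  note ac = KH.inv_mult KL.inv_mult KH.m_ac KL.m_ac
  note e = Z2_eqs[OF z] and e' = Z2_eqs[OF z']
  show "z *\<^sub>P z' \<in> cZ2"
    unfolding z_def z'_def mult_cochain_prod mem_Z2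
  proof (intro conjI ballI, goal_cases)
    case 1 then show ?case using CP.m_closed[OF Z2_carrier[OF z] Z2_carrier[OF z']] by (simp add: mult_cochain_prod)
  next
    case (9 a1 a2 a3)
    show ?case using 9 arg_cong2[OF e(1)[OF 9] e'(1)[OF 9], of "monoid.mult (grpH K)"] by (simp add: ac)
  next
    case (10 a1 a2 a3)
    show ?case using 10 arg_cong2[OF e(2)[OF 10] e'(2)[OF 10], of "monoid.mult (grpG K)"] by (simp add: ac)
  next
    case (11 a1 b1 b2)
    show ?case using 11 arg_cong2[OF e(3)[OF 11] e'(3)[OF 11], of "monoid.mult (grpH K)"] by (simp add: ac)
  next
    case (12 a1 a2 b1)
    show ?case using 12 arg_cong2[OF e(4)[OF 12] e'(4)[OF 12], of "monoid.mult (grpH K)"] by (simp add: ac)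
  next
    case (13 a1 a2)
    show ?case using 13 arg_cong2[OF e(5)[OF 13] e'(5)[OF 13], of "monoid.mult (grpG K)"] by (simp add: ac)
  qed simp_all
qed

lemma comm_group_Z2: "comm_group (Z2_RRB A K D)"
proof -
  show ?thesis
    using CP.subgroup_imp_group[OF subgroup_Z2, folded Z2_eq]
    by (rule group.group_comm_groupI) (auto intro: CP.m_comm dest: Z2_carrier)
qed

lemma inv_Z2: "z \<in> cZ2 \<Longrightarrow> inv\<^bsub>Z2_RRB A K D\<^esub> z = inv\<^sub>P z"
  using group.m_inv_consistent[OF comm_group.axioms(2)[OF comm_group_cochain_prod] subgroup_Z2]
  by (simp add: Z2_eq[symmetric])

text \<open>The factor by which the cocycle of an extension changes when its sections are multiplied
  on the right by \<kappa>1 and \<kappa>2, see \<open>ext_cocycle_change\<close>.\<close>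

definition coboundary :: "('a \<Rightarrow> 'k) \<Rightarrow> ('b \<Rightarrow> 'l) \<Rightarrow> ('a, 'b, 'k, 'l) cochain2" where
  "coboundary \<kappa>1 \<kappa>2 =
    (\<lambda>(a1, a2)\<in>cA \<times> cA. inv\<^sub>K (\<kappa>1 (a1 *\<^sub>A a2)) *\<^sub>K \<kappa>1 a2 *\<^sub>K \<mu> a2 (\<kappa>1 a1),
     \<lambda>(b1, b2)\<in>cB \<times> cB. inv\<^sub>L (\<kappa>2 (b1 *\<^sub>B b2)) *\<^sub>L \<kappa>2 b2 *\<^sub>L \<sigma> b2 (\<kappa>2 b1),
     \<lambda>(a, b)\<in>cA \<times> cB. \<nu> b (\<f> (\<kappa>2 b) a *\<^sub>K \<kappa>1 a) *\<^sub>K inv\<^sub>K (\<kappa>1 (\<beta> b a)),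
     \<lambda>a\<in>cA. S (\<nu>' (T a) (\<kappa>1 a)) *\<^sub>L inv\<^sub>L (\<kappa>2 (T a)))"

lemma coboundary_closed:
  "\<kappa>1 \<in> cA \<rightarrow> cK \<Longrightarrow> \<kappa>2 \<in> cB \<rightarrow> cL \<Longrightarrow> coboundary \<kappa>1 \<kappa>2 \<in> cP"
  by (auto simp: coboundary_def mem_cochain_prod Pi_iff)

lemma coboundary_mult:
  assumes "\<kappa>1 \<in> cA \<rightarrow> cK" "\<kappa>2 \<in> cB \<rightarrow> cL" "\<kappa>1' \<in> cA \<rightarrow> cK" "\<kappa>2' \<in> cB \<rightarrow> cL"
  shows "coboundary (\<lambda>a. \<kappa>1 a *\<^sub>K \<kappa>1' a) (\<lambda>b. \<kappa>2 b *\<^sub>L \<kappa>2' b) =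
    coboundary \<kappa>1 \<kappa>2 *\<^sub>P coboundary \<kappa>1' \<kappa>2'"
  using assms
  by (auto simp: coboundary_def mult_cochain_prod Pi_iff KH.inv_mult KL.inv_mult KH.m_ac KL.m_ac
      intro!: restrict_ext)

lemma coboundary_one:
  "coboundary (\<lambda>_. eK) (\<lambda>_. eL) = \<one>\<^bsub>cochain_prod A K\<^esub>"
  by (auto simp: coboundary_def one_cochain_prod intro!: restrict_ext)

lemma coboundary_m_inv:
  assumes "\<kappa>1 \<in> cA \<rightarrow> cK" "\<kappa>2 \<in> cB \<rightarrow> cL"
  shows "coboundary (\<lambda>a. inv\<^sub>K (\<kappa>1 a)) (\<lambda>b. inv\<^sub>L (\<kappa>2 b)) =
    inv\<^sub>P (coboundary \<kappa>1 \<kappa>2)"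
  using assms
  by (subst (2) coboundary_def, subst inv_cochain_prod, simp flip: coboundary_def add: coboundary_closed)
    (auto simp: coboundary_def Pi_iff KH.inv_mult KL.inv_mult KH.m_ac KL.m_ac intro!: restrict_ext)

text \<open>\<open>B2_RRB\<close> states the coboundary formulas pointwise. Cocycles are
  extensional, so the four formulas amount to a single equation between quadruples.\<close>

lemma mem_B2:
  "z \<in> B2 \<longleftrightarrow> z \<in> cZ2 \<and>
    (\<exists>\<kappa>1 \<in> cA \<rightarrow> cK. \<exists>\<kappa>2 \<in> cB \<rightarrow> cL. \<kappa>1 eA = eK \<and> \<kappa>2 eB = eL \<and> z = coboundary \<kappa>1 \<kappa>2)"
proof -
  obtain t1 t2 r x where z_def: "z = (t1, t2, r, x)" by (cases z)
  have "(\<forall>a1 \<in> cA. \<forall>a2 \<in> cA. t1 (a1, a2) = inv\<^sub>K (\<kappa>1 (a1 *\<^sub>A a2)) *\<^sub>K \<kappa>1 a2 *\<^sub>K \<mu> a2 (\<kappa>1 a1)) \<and>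
      (\<forall>b1 \<in> cB. \<forall>b2 \<in> cB. t2 (b1, b2) = inv\<^sub>L (\<kappa>2 (b1 *\<^sub>B b2)) *\<^sub>L \<kappa>2 b2 *\<^sub>L \<sigma> b2 (\<kappa>2 b1)) \<and>
      (\<forall>a \<in> cA. \<forall>b \<in> cB. r (a, b) = \<nu> b (\<f> (\<kappa>2 b) a *\<^sub>K \<kappa>1 a) *\<^sub>K inv\<^sub>K (\<kappa>1 (\<beta> b a))) \<and>
      (\<forall>a \<in> cA. x a = S (\<nu>' (T a) (\<kappa>1 a)) *\<^sub>L inv\<^sub>L (\<kappa>2 (T a)))
      \<longleftrightarrow> z = coboundary \<kappa>1 \<kappa>2" (is "?l \<longleftrightarrow> _")
    if z: "z \<in> cZ2" and k: "\<kappa>1 \<in> cA \<rightarrow> cK" "\<kappa>2 \<in> cB \<rightarrow> cL" for \<kappa>1 \<kappa>2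
  proof
    assume ?l
    then show "z = coboundary \<kappa>1 \<kappa>2"
      unfolding coboundary_def z_def
      by (intro cochain_eqI[of _ _ _ _ A K])
        (use Z2_carrier[OF z] coboundary_closed[OF k] in \<open>auto simp: z_def coboundary_def\<close>)
  next
    assume "z = coboundary \<kappa>1 \<kappa>2"
    then show ?l by (simp add: z_def coboundary_def)
  qed
  note eq = this
  show ?thesis
    by (cases "z \<in> cZ2")
      (auto simp: B2_RRB_def z_def eq[unfolded z_def] simp del: split_paired_Ex)
qed

text \<open>The coboundary map is multiplicative, so the witnesses \<kappa>1 and \<kappa>2 are
  inverted and multiplied pointwise.\<close>

lemma subgroup_B2: "subgroup B2 (Z2_RRB A K D)"
proof -
  interpret Z: comm_group "Z2_RRB A K D" by (rule comm_group_Z2)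
  show ?thesis
  proof (rule Z.subgroupI)
    show "B2 \<subseteq> cZ2" by (auto simp: mem_B2)
    have "\<one>\<^bsub>Z2_RRB A K D\<^esub> \<in> B2"
      using Z.one_closed coboundary_one unfolding mem_B2
      by (intro conjI bexI[of _ "\<lambda>_. eK"] bexI[of _ "\<lambda>_. eL"]) auto
    then show "B2 \<noteq> {}" by blast
  next
    fix z assume z: "z \<in> B2"
    then obtain \<kappa>1 \<kappa>2 where k: "\<kappa>1 \<in> cA \<rightarrow> cK" "\<kappa>2 \<in> cB \<rightarrow> cL" "\<kappa>1 eA = eK" "\<kappa>2 eB = eL"
      "z = coboundary \<kappa>1 \<kappa>2" unfolding mem_B2 by blast
    show "inv\<^bsub>Z2_RRB A K D\<^esub> z \<in> B2"
      unfolding mem_B2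
      using k z Z.inv_closed[of z]
      by (intro conjI bexI[of _ "\<lambda>a. inv\<^sub>K (\<kappa>1 a)"] bexI[of _ "\<lambda>b. inv\<^sub>L (\<kappa>2 b)"])
        (auto simp: coboundary_m_inv inv_Z2 mem_B2 Pi_iff)
  next
    fix z z' assume z: "z \<in> B2" "z' \<in> B2"
    from z(1) obtain \<kappa>1 \<kappa>2 where k: "\<kappa>1 \<in> cA \<rightarrow> cK" "\<kappa>2 \<in> cB \<rightarrow> cL" "\<kappa>1 eA = eK" "\<kappa>2 eB = eL"
      "z = coboundary \<kappa>1 \<kappa>2" unfolding mem_B2 by blast
    from z(2) obtain \<kappa>1' \<kappa>2' where k': "\<kappa>1' \<in> cA \<rightarrow> cK" "\<kappa>2' \<in> cB \<rightarrow> cL" "\<kappa>1' eA = eK" "\<kappa>2' eB = eL"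
      "z' = coboundary \<kappa>1' \<kappa>2'" unfolding mem_B2 by blast
    show "z \<otimes>\<^bsub>Z2_RRB A K D\<^esub> z' \<in> B2"
      unfolding mem_B2
      using k k' z Z.m_closed[of z z']
      by (intro conjI bexI[of _ "\<lambda>a. \<kappa>1 a *\<^sub>K \<kappa>1' a"] bexI[of _ "\<lambda>b. \<kappa>2 b *\<^sub>L \<kappa>2' b"])
        (auto simp: coboundary_mult mem_B2 Pi_iff)
  qed
qed

lemma normal_B2: "B2 \<lhd> Z2_RRB A K D"
  by (rule comm_group.subgroup_imp_normal[OF comm_group_Z2 subgroup_B2])

lemma group_H2: "group (H2_RRB A K D)"
  unfolding H2_RRB_def by (rule normal.factorgroup_is_group[OF normal_B2])

definition coset (\<open>\<lbrakk>_\<rbrakk>\<close>) where "\<lbrakk>z\<rbrakk> = B2 #>\<^bsub>Z2_RRB A K D\<^esub> z"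

lemma carrier_H2: "cH2 = coset ` cZ2"
  by (auto simp: H2_RRB_def FactGroup_def RCOSETS_def coset_def)

lemma mult_H2:
  "z \<in> cZ2 \<Longrightarrow> z' \<in> cZ2 \<Longrightarrow>
    \<lbrakk>z\<rbrakk> *\<^sub>2 \<lbrakk>z'\<rbrakk> = \<lbrakk>z \<otimes>\<^bsub>Z2_RRB A K D\<^esub> z'\<rbrakk>"
  by (simp add: H2_RRB_def FactGroup_def coset_def normal.rcos_sum[OF normal_B2])

lemma coset_eq_iff:
  assumes "z \<in> cZ2" "z' \<in> cZ2"
  shows "\<lbrakk>z\<rbrakk> = \<lbrakk>z'\<rbrakk> \<longleftrightarrow> (\<exists>b \<in> B2. z = b \<otimes>\<^bsub>Z2_RRB A K D\<^esub> z')"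
proof -
  interpret Z: comm_group "Z2_RRB A K D" by (rule comm_group_Z2)
  have "\<lbrakk>z\<rbrakk> = \<lbrakk>z'\<rbrakk> \<longleftrightarrow> z \<in> \<lbrakk>z'\<rbrakk>"
    unfolding coset_def
    by (metis Z.rcos_self Z.repr_independence assms subgroup_B2)
  then show ?thesis by (auto simp: coset_def r_coset_def)
qed

lemma one_H2: "\<one>\<^bsub>H2_RRB A K D\<^esub> = \<lbrakk>\<one>\<^bsub>Z2_RRB A K D\<^esub>\<rbrakk>"
proof -
  interpret Z: comm_group "Z2_RRB A K D" by (rule comm_group_Z2)
  show ?thesis
    using subgroup.subset[OF subgroup_B2] by (simp add: H2_RRB_def FactGroup_def coset_def del: one_Z2)
qed

end

section \<open>Derivations and compatible pairs\<close>

context rrb_coeff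
begin

lemma mult_Z1:
  "(\<kappa>1, \<kappa>2) \<otimes>\<^bsub>Z1_RRB A K D\<^esub> (\<kappa>1', \<kappa>2') =
    (\<lambda>a\<in>cA. \<kappa>1 a *\<^sub>K \<kappa>1' a, \<lambda>b\<in>cB. \<kappa>2 b *\<^sub>L \<kappa>2' b)"
  by (simp add: Z1_RRB_def)

lemma mem_Z1:
  "(\<kappa>1, \<kappa>2) \<in> cZ1 \<longleftrightarrow>
    \<kappa>1 \<in> cA \<rightarrow>\<^sub>E cK \<and> \<kappa>2 \<in> cB \<rightarrow>\<^sub>E cL \<and> \<kappa>1 eA = eK \<and> \<kappa>2 eB = eL \<and>
    (\<forall>a1 \<in> cA. \<forall>a2 \<in> cA. \<kappa>1 (a1 *\<^sub>A a2) = \<kappa>1 a2 *\<^sub>K \<mu> a2 (\<kappa>1 a1)) \<and>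
    (\<forall>b1 \<in> cB. \<forall>b2 \<in> cB. \<kappa>2 (b1 *\<^sub>B b2) = \<kappa>2 b2 *\<^sub>L \<sigma> b2 (\<kappa>2 b1)) \<and>
    (\<forall>a \<in> cA. \<forall>b \<in> cB. \<nu> b (\<f> (\<kappa>2 b) a *\<^sub>K \<kappa>1 a) = \<kappa>1 (\<beta> b a)) \<and>
    (\<forall>a \<in> cA. S (\<nu>' (T a) (\<kappa>1 a)) = \<kappa>2 (T a))"
  by (simp add: Z1_RRB_def)

text \<open>The derivation equations oriented as rewrite rules: compound arguments of \<kappa>1 and
  \<kappa>2 are resolved into values at their parts, with \<open>\<nu>\<close> already distributed
  over the product.\<close>

lemma Z1D:
  assumes "(\<kappa>1, \<kappa>2) \<in> cZ1"
  shows "a1 \<in> cA \<Longrightarrow> \<kappa>1 a1 \<in> cK" "b1 \<in> cB \<Longrightarrow> \<kappa>2 b1 \<in> cL" "\<kappa>1 eA = eK" "\<kappa>2 eB = eL"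
    "a1 \<in> cA \<Longrightarrow> a2 \<in> cA \<Longrightarrow> \<kappa>1 (a1 *\<^sub>A a2) = \<kappa>1 a2 *\<^sub>K \<mu> a2 (\<kappa>1 a1)"
    "b1 \<in> cB \<Longrightarrow> b2 \<in> cB \<Longrightarrow> \<kappa>2 (b1 *\<^sub>B b2) = \<kappa>2 b2 *\<^sub>L \<sigma> b2 (\<kappa>2 b1)"
    "a1 \<in> cA \<Longrightarrow> b1 \<in> cB \<Longrightarrow> \<kappa>1 (\<beta> b1 a1) = \<nu> b1 (\<f> (\<kappa>2 b1) a1) *\<^sub>K \<nu> b1 (\<kappa>1 a1)"
    "a1 \<in> cA \<Longrightarrow> \<kappa>2 (T a1) = S (\<nu>' (T a1) (\<kappa>1 a1))"
proof -
  have c: "\<kappa>1 \<in> cA \<rightarrow> cK" "\<kappa>2 \<in> cB \<rightarrow> cL" using assms by (auto simp: mem_Z1)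
  then show 1: "a1 \<in> cA \<Longrightarrow> \<kappa>1 a1 \<in> cK" and 2: "b1 \<in> cB \<Longrightarrow> \<kappa>2 b1 \<in> cL" by auto
  show "\<kappa>1 eA = eK" "\<kappa>2 eB = eL"
    "a1 \<in> cA \<Longrightarrow> a2 \<in> cA \<Longrightarrow> \<kappa>1 (a1 *\<^sub>A a2) = \<kappa>1 a2 *\<^sub>K \<mu> a2 (\<kappa>1 a1)"
    "b1 \<in> cB \<Longrightarrow> b2 \<in> cB \<Longrightarrow> \<kappa>2 (b1 *\<^sub>B b2) = \<kappa>2 b2 *\<^sub>L \<sigma> b2 (\<kappa>2 b1)"
    "a1 \<in> cA \<Longrightarrow> \<kappa>2 (T a1) = S (\<nu>' (T a1) (\<kappa>1 a1))"
    using assms unfolding mem_Z1 by simp_all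
  show "\<kappa>1 (\<beta> b1 a1) = \<nu> b1 (\<f> (\<kappa>2 b1) a1) *\<^sub>K \<nu> b1 (\<kappa>1 a1)" if "a1 \<in> cA" "b1 \<in> cB"
  proof -
    have "\<kappa>1 (\<beta> b1 a1) = \<nu> b1 (\<f> (\<kappa>2 b1) a1 *\<^sub>K \<kappa>1 a1)" using assms that unfolding mem_Z1 by simp
    then show ?thesis using that 1 2 by simp
  qed
qed

text \<open>As for cocycles, commutativity of K and L makes every defining equation multiplicative,
  which gives a subgroup of a product of function groups.\<close>

lemma group_Z1: "group (Z1_RRB A K D)"
proof -
  define P where "P = product_group cA (\<lambda>_. grpH K) \<times>\<times> product_group cB (\<lambda>_. grpG K)"
  have "group P" by (simp add: P_def DirProd_group)
  then interpret P: group P .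
  have eq: "Z1_RRB A K D = P\<lparr>carrier := cZ1\<rparr>"
    by (simp add: Z1_RRB_def P_def)
  have Pm: "(f, g) \<otimes>\<^bsub>P\<^esub> (f', g') = (\<lambda>a\<in>cA. f a *\<^sub>K f' a, \<lambda>b\<in>cB. g b *\<^sub>L g' b)" for f g f' g'
    by (simp add: P_def)
  have Pi: "inv\<^bsub>P\<^esub> (f, g) = (\<lambda>a\<in>cA. inv\<^sub>K (f a), \<lambda>b\<in>cB. inv\<^sub>L (g b))"
    if "f \<in> cA \<rightarrow>\<^sub>E cK" "g \<in> cB \<rightarrow>\<^sub>E cL" for f g
    using that by (simp add: P_def)
  note ac = KH.inv_mult KL.inv_mult KH.m_ac KL.m_ac
  have "subgroup cZ1 P"
  proof (rule P.subgroupI)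
    show "cZ1 \<subseteq> carrier P"
      by (auto simp: Z1_RRB_def P_def)
    have "(\<lambda>a\<in>cA. eK, \<lambda>b\<in>cB. eL) \<in> cZ1"
      by (simp add: mem_Z1)
    then show "cZ1 \<noteq> {}" by blast
  next
    fix z assume z: "z \<in> cZ1"
    obtain f g where z_def: "z = (f, g)" by (cases z)
    note [simp] = Z1D[OF z[unfolded z_def]]
    have fg: "f \<in> cA \<rightarrow>\<^sub>E cK" "g \<in> cB \<rightarrow>\<^sub>E cL" using z by (auto simp: z_def mem_Z1)
    show "inv\<^bsub>P\<^esub> z \<in> cZ1"
      unfolding z_def Pi[OF fg] mem_Z1 by (simp add: ac)
  next
    fix z z' assume z: "z \<in> cZ1" and z': "z' \<in> cZ1"
    obtain f g where z_def: "z = (f, g)" by (cases z)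
    obtain f' g' where z'_def: "z' = (f', g')" by (cases z')
    note [simp] = Z1D[OF z[unfolded z_def]] Z1D[OF z'[unfolded z'_def]]
    show "z \<otimes>\<^bsub>P\<^esub> z' \<in> cZ1"
      unfolding z_def z'_def Pm mem_Z1 by (simp add: ac)
  qed
  from P.subgroup_imp_group[OF this, folded eq] show ?thesis .
qed

text \<open>Clearing the inverses of \<theta>1 and \<theta>2 turns the conjugation conditions into
  intertwining equations, a form that composes and that can be used for rewriting.\<close>

lemma mem_C_group:
  "((\<psi>1, \<psi>2), (\<theta>1, \<theta>2)) \<in> cC \<longleftrightarrow>
    (\<psi>1, \<psi>2) \<in> carrier (rrb_Aut A) \<and> (\<theta>1, \<theta>2) \<in> carrier (rrb_Aut K) \<and>
    (\<forall>b \<in> cB. \<forall>k \<in> cK. \<theta>1 (\<nu> b k) = \<nu> (\<psi>2 b) (\<theta>1 k)) \<and>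
    (\<forall>a \<in> cA. \<forall>k \<in> cK. \<theta>1 (\<mu> a k) = \<mu> (\<psi>1 a) (\<theta>1 k)) \<and>
    (\<forall>b \<in> cB. \<forall>l \<in> cL. \<theta>2 (\<sigma> b l) = \<sigma> (\<psi>2 b) (\<theta>2 l)) \<and>
    (\<forall>l \<in> cL. \<forall>a \<in> cA. \<theta>1 (\<f> l a) = \<f> (\<theta>2 l) (\<psi>1 a))"
proof -
  have "?thesis" if c: "(\<psi>1, \<psi>2) \<in> carrier (rrb_Aut A)" "(\<theta>1, \<theta>2) \<in> carrier (rrb_Aut K)"
  proof -
    from c have "\<psi>1 \<in> auto (grpH A)" "\<psi>2 \<in> auto (grpG A)" "\<theta>1 \<in> auto (grpH K)" "\<theta>2 \<in> auto (grpG K)"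
      by (auto simp: A.mem_rrb_Aut K.mem_rrb_Aut)
    with c show ?thesis
      by (simp add: C_group_def auto_inv_into_eq auto_closed)
  qed
  then show ?thesis by (auto simp: C_group_def)
qed

end

section \<open>Twisting cochains by a compatible pair\<close>

locale rrb_compatible = rrb_coeff A K D
  for A :: "('a, 'b) rrb" and K :: "('k, 'l) rrb" and D :: "('a, 'b, 'k, 'l) rrb_action" +
  fixes \<psi>1 \<psi>2 \<theta>1 \<theta>2
  assumes compat: "((\<psi>1, \<psi>2), (\<theta>1, \<theta>2)) \<in> cC"
begin

abbreviation "\<theta>1' \<equiv> inv_into cK \<theta>1"
abbreviation "\<theta>2' \<equiv> inv_into cL \<theta>2"

lemma autos: "\<psi>1 \<in> auto (grpH A)" "\<psi>2 \<in> auto (grpG A)" "\<theta>1 \<in> auto (grpH K)" "\<theta>2 \<in> auto (grpG K)"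
  using compat by (auto simp: mem_C_group A.mem_rrb_Aut K.mem_rrb_Aut)

lemmas psi_simps [simp] =
  autos(1,2)[THEN auto_closed] autos(1,2)[THEN auto_mult] A.H.auto_one[OF autos(1)] A.G.auto_one[OF autos(2)]
  autos(1,2)[THEN auto_inv_into_closed] autos(1,2)[THEN auto_inv_into_f] autos(1,2)[THEN f_auto_inv_into]

lemmas theta_simps [simp] =
  autos(3,4)[THEN auto_closed] autos(3,4)[THEN auto_mult] K.H.auto_one[OF autos(3)] K.G.auto_one[OF autos(4)]
  autos(3,4)[THEN auto_inv_into_closed] autos(3,4)[THEN auto_inv_into_f] autos(3,4)[THEN f_auto_inv_into]
  K.H.auto_inv_into_mult[OF autos(3)] K.G.auto_inv_into_mult[OF autos(4)]
  K.H.auto_inv_into_one[OF autos(3)] K.G.auto_inv_into_one[OF autos(4)]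

lemma psi_rb [simp]: "a \<in> cA \<Longrightarrow> \<psi>2 (T a) = T (\<psi>1 a)"
  and psi_act [simp]: "a \<in> cA \<Longrightarrow> b \<in> cB \<Longrightarrow> \<psi>1 (\<beta> b a) = \<beta> (\<psi>2 b) (\<psi>1 a)"
  and theta_rb [simp]: "k \<in> cK \<Longrightarrow> \<theta>2 (S k) = S (\<theta>1 k)"
  and theta_nu [simp]: "b \<in> cB \<Longrightarrow> k \<in> cK \<Longrightarrow> \<theta>1 (\<nu> b k) = \<nu> (\<psi>2 b) (\<theta>1 k)"
  and theta_mu [simp]: "a \<in> cA \<Longrightarrow> k \<in> cK \<Longrightarrow> \<theta>1 (\<mu> a k) = \<mu> (\<psi>1 a) (\<theta>1 k)"
  and theta_sigma [simp]: "b \<in> cB \<Longrightarrow> l \<in> cL \<Longrightarrow> \<theta>2 (\<sigma> b l) = \<sigma> (\<psi>2 b) (\<theta>2 l)"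
  and theta_ff [simp]: "a \<in> cA \<Longrightarrow> l \<in> cL \<Longrightarrow> \<theta>1 (\<f> l a) = \<f> (\<theta>2 l) (\<psi>1 a)"
  using compat by (auto simp: mem_C_group A.mem_rrb_Aut K.mem_rrb_Aut)

text \<open>Read from right to left in the next lemmas: an equation about an inverse of \<theta>1 or
  \<theta>2 is proved after applying the map.\<close>

lemma theta_inj: "k \<in> cK \<Longrightarrow> k' \<in> cK \<Longrightarrow> \<theta>1 k = \<theta>1 k' \<longleftrightarrow> k = k'"
  "l \<in> cL \<Longrightarrow> l' \<in> cL \<Longrightarrow> \<theta>2 l = \<theta>2 l' \<longleftrightarrow> l = l'"
  using autos(3,4)[THEN auto_inj] by auto

lemma theta_inv_m_inv [simp]:
  "k \<in> cK \<Longrightarrow> \<theta>1' (inv\<^sub>K k) = inv\<^sub>K (\<theta>1' k)"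
  "l \<in> cL \<Longrightarrow> \<theta>2' (inv\<^sub>L l) = inv\<^sub>L (\<theta>2' l)"
  by (simp_all add: theta_inj[symmetric] K.H.auto_m_inv[OF autos(3)] K.G.auto_m_inv[OF autos(4)])

lemma theta_inv_nu [simp]: "b \<in> cB \<Longrightarrow> k \<in> cK \<Longrightarrow> \<theta>1' (\<nu> (\<psi>2 b) k) = \<nu> b (\<theta>1' k)"
  by (simp add: theta_inj[symmetric])

lemma theta_inv_mu [simp]: "a \<in> cA \<Longrightarrow> k \<in> cK \<Longrightarrow> \<theta>1' (\<mu> (\<psi>1 a) k) = \<mu> a (\<theta>1' k)"
  by (simp add: theta_inj[symmetric])

lemma theta_inv_sigma [simp]: "b \<in> cB \<Longrightarrow> l \<in> cL \<Longrightarrow> \<theta>2' (\<sigma> (\<psi>2 b) l) = \<sigma> b (\<theta>2' l)"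
  by (simp add: theta_inj[symmetric])

lemma theta_inv_ff [simp]: "a \<in> cA \<Longrightarrow> l \<in> cL \<Longrightarrow> \<theta>1' (\<f> l (\<psi>1 a)) = \<f> (\<theta>2' l) a"
  by (simp add: theta_inj[symmetric])

lemma theta_inv_rb [simp]: "k \<in> cK \<Longrightarrow> \<theta>2' (S k) = S (\<theta>1' k)"
  by (simp add: theta_inj[symmetric])

lemma theta_inv_nu_inv [simp]: "b \<in> cB \<Longrightarrow> k \<in> cK \<Longrightarrow> \<theta>1' (\<nu>' (\<psi>2 b) k) = \<nu>' b (\<theta>1' k)"
  by (metis psi_simps(2) theta_inv_nu nu_inv_closed nu_inv_nu nu_nu_inv theta_simps(7))

text \<open>The rule \<open>psi_rb\<close> rewrites \<open>\<psi>2 (T a)\<close> to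
  \<open>T (\<psi>1 a)\<close>, so the preceding rule is also wanted for this form of the
  argument.\<close>

lemma theta_inv_nu_inv_rb [simp]: "a \<in> cA \<Longrightarrow> k \<in> cK \<Longrightarrow> \<theta>1' (\<nu>' (T (\<psi>1 a)) k) = \<nu>' (T a) (\<theta>1' k)"
  using theta_inv_nu_inv[of "T a" k] by simp

abbreviation "twist \<equiv> cochain_twist A K ((\<psi>1, \<psi>2), (\<theta>1, \<theta>2))"

lemma twist_closed:
  assumes "z \<in> cP" shows "twist z \<in> cP"
proof -
  obtain t1 t2 r x where z_def: "z = (t1, t2, r, x)" by (cases z)
  note [simp] = cochain_closed[OF assms[unfolded z_def]]
  show ?thesis by (auto simp: z_def cochain_twist_def mem_cochain_prod)
qed

lemma twist_mult:
  assumes "z \<in> cP" "z' \<in> cP"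
  shows "twist (z *\<^sub>P z') = twist z *\<^sub>P twist z'"
proof -
  obtain t1 t2 r x where z_def: "z = (t1, t2, r, x)" by (cases z)
  obtain t1' t2' r' x' where z'_def: "z' = (t1', t2', r', x')" by (cases z')
  note [simp] = cochain_closed[OF assms(1)[unfolded z_def]] cochain_closed[OF assms(2)[unfolded z'_def]]
  show ?thesis by (auto simp: z_def z'_def cochain_twist_def mult_cochain_prod intro!: restrict_ext)
qed

text \<open>The inverses of \<theta>1 and \<theta>2 intertwine every structure map in the coboundary
  formula with itself, its A- or B-argument being transported along \<psi>1 or \<psi>2; so the twist
  can be pushed inside to the maps \<kappa>1 and \<kappa>2.\<close>

lemma twist_coboundary:
  assumes k: "\<kappa>1 \<in> cA \<rightarrow> cK" "\<kappa>2 \<in> cB \<rightarrow> cL"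
  shows "twist (coboundary \<kappa>1 \<kappa>2) = coboundary (\<lambda>a. \<theta>1' (\<kappa>1 (\<psi>1 a))) (\<lambda>b. \<theta>2' (\<kappa>2 (\<psi>2 b)))"
proof -
  have [simp]: "a \<in> cA \<Longrightarrow> \<kappa>1 a \<in> cK" "b \<in> cB \<Longrightarrow> \<kappa>2 b \<in> cL" for a b
    using k by auto
  show ?thesis
    by (auto simp: coboundary_def cochain_twist_def intro!: restrict_ext)
qed

lemma twist_one: "twist \<one>\<^bsub>cochain_prod A K\<^esub> = \<one>\<^bsub>cochain_prod A K\<^esub>"
  by (auto simp: one_cochain_prod cochain_twist_def intro!: restrict_ext)

lemma twist_m_inv:
  assumes "z \<in> cP"
  shows "twist (inv\<^sub>P z) = inv\<^sub>P (twist z)"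
proof -
  show ?thesis
    by (rule CP.inv_equality[symmetric])
      (simp_all add: assms twist_closed twist_mult[symmetric] twist_one)
qed

end

section \<open>The group of compatible pairs and its right action on cochains\<close>

context rrb_coeff
begin

lemma rrb_compatibleI: "((\<psi>1, \<psi>2), (\<theta>1, \<theta>2)) \<in> cC \<Longrightarrow> rrb_compatible A K D \<psi>1 \<psi>2 \<theta>1 \<theta>2"
  by unfold_locales

lemma group_C_group: "group (C_group A K D)"
proof -
  define P where "P = rrb_Aut A \<times>\<times> rrb_Aut K"
  have "group P" unfolding P_def by (rule DirProd_group[OF A.group_rrb_Aut K.group_rrb_Aut])
  then interpret P: group P .
  have eq: "C_group A K D = P\<lparr>carrier := cC\<rparr>"
    by (simp add: C_group_def P_def)
  have "subgroup (cC) P"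
  proof (rule P.subgroupI)
    show "cC \<subseteq> carrier P"
      by (auto simp: C_group_def P_def)
    have "\<one>\<^bsub>P\<^esub> \<in> cC"
      using P.one_closed
      by (simp add: P_def A.one_rrb_Aut K.one_rrb_Aut mem_C_group one_AutoGroup_apply)
    then show "cC \<noteq> {}" by blast
  next
    fix c assume "c \<in> cC"
    moreover obtain \<psi>1 \<psi>2 \<theta>1 \<theta>2 where c_def: "c = ((\<psi>1, \<psi>2), (\<theta>1, \<theta>2))" by (metis prod.collapse)
    ultimately interpret rrb_compatible A K D \<psi>1 \<psi>2 \<theta>1 \<theta>2 by (intro rrb_compatibleI) simp
    have Au: "(\<psi>1, \<psi>2) \<in> carrier (rrb_Aut A)" "(\<theta>1, \<theta>2) \<in> carrier (rrb_Aut K)"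
      using compat by (auto simp: mem_C_group)
    \<comment> \<open>The four intertwining laws of the inverse pair are those of the pair,
      evaluated at preimages under \<psi>1 and \<psi>2.\<close>
    have 1: "\<theta>1' (\<nu> b k) = \<nu> (inv_into cB \<psi>2 b) (\<theta>1' k)" if "b \<in> cB" "k \<in> cK" for b k
      using that theta_inv_nu[of "inv_into cB \<psi>2 b" k] by (simp del: theta_inv_nu)
    have 2: "\<theta>1' (\<mu> a k) = \<mu> (inv_into cA \<psi>1 a) (\<theta>1' k)" if "a \<in> cA" "k \<in> cK" for a k
      using that theta_inv_mu[of "inv_into cA \<psi>1 a" k] by (simp del: theta_inv_mu)
    have 3: "\<theta>2' (\<sigma> b l) = \<sigma> (inv_into cB \<psi>2 b) (\<theta>2' l)" if "b \<in> cB" "l \<in> cL" for b l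
      using that theta_inv_sigma[of "inv_into cB \<psi>2 b" l] by (simp del: theta_inv_sigma)
    have 4: "\<theta>1' (\<f> l a) = \<f> (\<theta>2' l) (inv_into cA \<psi>1 a)" if "a \<in> cA" "l \<in> cL" for a l
      using that theta_inv_ff[of "inv_into cA \<psi>1 a" l] by (simp del: theta_inv_ff)
    have "inv\<^bsub>P\<^esub> c = (inv\<^bsub>rrb_Aut A\<^esub> (\<psi>1, \<psi>2), inv\<^bsub>rrb_Aut K\<^esub> (\<theta>1, \<theta>2))"
      unfolding P_def c_def by (rule inv_DirProd[OF A.group_rrb_Aut K.group_rrb_Aut Au])
    then show "inv\<^bsub>P\<^esub> c \<in> cC"
      using group.inv_closed[OF A.group_rrb_Aut Au(1)] group.inv_closed[OF K.group_rrb_Aut Au(2)]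
      by (simp add: A.inv_rrb_Aut[OF Au(1)] K.inv_rrb_Aut[OF Au(2)] mem_C_group 1 2 3 4)
  next
    fix c d assume cd: "c \<in> cC" "d \<in> cC"
    obtain \<psi>1 \<psi>2 \<theta>1 \<theta>2 where c_def: "c = ((\<psi>1, \<psi>2), (\<theta>1, \<theta>2))" by (metis prod.collapse)
    obtain \<psi>1' \<psi>2' \<theta>1' \<theta>2' where d_def: "d = ((\<psi>1', \<psi>2'), (\<theta>1', \<theta>2'))" by (metis prod.collapse)
    interpret c: rrb_compatible A K D \<psi>1 \<psi>2 \<theta>1 \<theta>2 using cd by (intro rrb_compatibleI) (simp add: c_def)
    interpret d: rrb_compatible A K D \<psi>1' \<psi>2' \<theta>1' \<theta>2' using cd by (intro rrb_compatibleI) (simp add: d_def)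
    have "(\<psi>1, \<psi>2) \<otimes>\<^bsub>rrb_Aut A\<^esub> (\<psi>1', \<psi>2') \<in> carrier (rrb_Aut A)"
      "(\<theta>1, \<theta>2) \<otimes>\<^bsub>rrb_Aut K\<^esub> (\<theta>1', \<theta>2') \<in> carrier (rrb_Aut K)"
      using cd by (auto simp: c_def d_def mem_C_group intro!: monoid.m_closed[OF group.is_monoid]
        A.group_rrb_Aut K.group_rrb_Aut)
    then show "c \<otimes>\<^bsub>P\<^esub> d \<in> cC"
      by (simp add: P_def c_def d_def A.mult_rrb_Aut K.mult_rrb_Aut mem_C_group mult_AutoGroup_apply
          c.autos d.autos)
  qed
  from P.subgroup_imp_group[OF this, folded eq] show ?thesis .
qed

lemma mult_C_group:
  "((\<psi>1, \<psi>2), (\<theta>1, \<theta>2)) *\<^sub>C ((\<psi>1', \<psi>2'), (\<theta>1', \<theta>2')) =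
    ((\<psi>1 \<otimes>\<^bsub>AutoGroup (grpH A)\<^esub> \<psi>1', \<psi>2 \<otimes>\<^bsub>AutoGroup (grpG A)\<^esub> \<psi>2'),
     (\<theta>1 \<otimes>\<^bsub>AutoGroup (grpH K)\<^esub> \<theta>1', \<theta>2 \<otimes>\<^bsub>AutoGroup (grpG K)\<^esub> \<theta>2'))"
  by (simp add: C_group_def A.mult_rrb_Aut K.mult_rrb_Aut)

lemma one_C_group:
  "\<one>\<^bsub>C_group A K D\<^esub> = ((\<one>\<^bsub>AutoGroup (grpH A)\<^esub>, \<one>\<^bsub>AutoGroup (grpG A)\<^esub>),
    (\<one>\<^bsub>AutoGroup (grpH K)\<^esub>, \<one>\<^bsub>AutoGroup (grpG K)\<^esub>))"
  by (simp add: C_group_def A.one_rrb_Aut K.one_rrb_Aut)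

lemma compat_cases:
  assumes "c \<in> cC"
  obtains \<psi>1 \<psi>2 \<theta>1 \<theta>2 where "c = ((\<psi>1, \<psi>2), (\<theta>1, \<theta>2))" "rrb_compatible A K D \<psi>1 \<psi>2 \<theta>1 \<theta>2"
  using assms by (metis prod.collapse rrb_compatibleI)

text \<open>Precomposing with \<psi> and inverting \<theta> both reverse the order of composition,
  so \<open>c\<close> acts first and twisting is a right action.\<close>

lemma cochain_twist_mult:
  assumes "c \<in> cC" "d \<in> cC" "z \<in> cP"
  shows "cochain_twist A K (c *\<^sub>C d) z = cochain_twist A K d (cochain_twist A K c z)"
proof -
  obtain \<psi>1 \<psi>2 \<theta>1 \<theta>2 where c_def: "c = ((\<psi>1, \<psi>2), (\<theta>1, \<theta>2))" and c: "rrb_compatible A K D \<psi>1 \<psi>2 \<theta>1 \<theta>2"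
    using assms(1) by (rule compat_cases)
  obtain \<psi>1' \<psi>2' \<theta>1' \<theta>2' where d_def: "d = ((\<psi>1', \<psi>2'), (\<theta>1', \<theta>2'))" and d: "rrb_compatible A K D \<psi>1' \<psi>2' \<theta>1' \<theta>2'"
    using assms(2) by (rule compat_cases)
  interpret c: rrb_compatible A K D \<psi>1 \<psi>2 \<theta>1 \<theta>2 by (rule c)
  interpret d: rrb_compatible A K D \<psi>1' \<psi>2' \<theta>1' \<theta>2' by (rule d)
  obtain t1 t2 r x where z_def: "z = (t1, t2, r, x)" by (cases z)
  note [simp] = cochain_closed[OF assms(3)[unfolded z_def]]
  have "\<theta>1 \<otimes>\<^bsub>AutoGroup (grpH K)\<^esub> \<theta>1' \<in> auto (grpH K)"
    by (rule K.H.mult_AutoGroup_in[OF c.autos(3) d.autos(3)])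
  then have 1: "inv_into cK (\<theta>1 \<otimes>\<^bsub>AutoGroup (grpH K)\<^esub> \<theta>1') k = inv_into cK \<theta>1' (inv_into cK \<theta>1 k)"
    if "k \<in> cK" for k
    by (intro sym[OF iffD2[OF auto_inv_into_eq]])
      (simp_all add: that mult_AutoGroup_apply c.autos d.autos)
  have "\<theta>2 \<otimes>\<^bsub>AutoGroup (grpG K)\<^esub> \<theta>2' \<in> auto (grpG K)"
    by (rule K.G.mult_AutoGroup_in[OF c.autos(4) d.autos(4)])
  then have 2: "inv_into cL (\<theta>2 \<otimes>\<^bsub>AutoGroup (grpG K)\<^esub> \<theta>2') k = inv_into cL \<theta>2' (inv_into cL \<theta>2 k)"
    if "k \<in> cL" for k
    by (intro sym[OF iffD2[OF auto_inv_into_eq]])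
      (simp_all add: that mult_AutoGroup_apply c.autos d.autos)
  show ?thesis
    unfolding c_def d_def z_def mult_C_group
    by (auto simp: cochain_twist_def mult_AutoGroup_apply c.autos d.autos 1 2 intro!: restrict_ext)
qed

lemma cochain_twist_one:
  assumes "z \<in> cP"
  shows "cochain_twist A K \<one>\<^bsub>C_group A K D\<^esub> z = z"
proof -
  obtain t1 t2 r x where z_def: "z = (t1, t2, r, x)" by (cases z)
  note [simp] = cochain_closed[OF assms[unfolded z_def]]
  have 1: "inv_into cK \<one>\<^bsub>AutoGroup (grpH K)\<^esub> k = k" if "k \<in> cK" for k
    using auto_inv_into_f[OF K.H.one_AutoGroup_in that] that by (simp add: one_AutoGroup_apply)
  have 2: "inv_into cL \<one>\<^bsub>AutoGroup (grpG K)\<^esub> k = k" if "k \<in> cL" for k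
    using auto_inv_into_f[OF K.G.one_AutoGroup_in that] that by (simp add: one_AutoGroup_apply)
  have t: "cochain_twist A K \<one>\<^bsub>C_group A K D\<^esub> (t1, t2, r, x) =
    (\<lambda>p\<in>cA \<times> cA. t1 p, \<lambda>p\<in>cB \<times> cB. t2 p, \<lambda>p\<in>cA \<times> cB. r p, \<lambda>a\<in>cA. x a)"
    unfolding one_C_group
    by (auto simp: cochain_twist_def one_AutoGroup_apply 1 2 intro!: restrict_ext)
  show ?thesis
    using assms unfolding z_def t by (auto simp: mem_cochain_prod PiE_iff extensional_restrict)
qed

end

section \<open>Extensions and their cocycles\<close>

text \<open>In right-nested products, such as those produced by \<open>m_ac\<close>, an element and
  its inverse can be separated by another factor; this cancels such a pair.\<close>

lemma (in comm_group) mult_cancel_inv: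
  "x \<in> carrier G \<Longrightarrow> y \<in> carrier G \<Longrightarrow> z \<in> carrier G \<Longrightarrow> x \<otimes> (y \<otimes> (inv x \<otimes> z)) = y \<otimes> z"
  by (metis inv_closed inv_solve_left m_closed m_lcomm)

locale rrb_ext_base = rrb_pair A K
  for A :: "('a, 'b) rrb" and K :: "('k, 'l) rrb" +
  fixes E :: "('a, 'b, 'k, 'l, 'h, 'g) rrb_extn"
  assumes ext: "rrb_extension A K E"

sublocale rrb_ext_base \<subseteq> E: rel_rb "middle E"
  using ext by unfold_locales (simp add: rrb_extension_def)

context rrb_ext_base
begin

abbreviation "cH \<equiv> carrier (grpH (middle E))"
abbreviation "cG \<equiv> carrier (grpG (middle E))"
abbreviation mH (infixl "*\<^sub>H" 70) where "x *\<^sub>H y \<equiv> x \<otimes>\<^bsub>grpH (middle E)\<^esub> y"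
abbreviation mG (infixl "*\<^sub>G" 70) where "x *\<^sub>G y \<equiv> x \<otimes>\<^bsub>grpG (middle E)\<^esub> y"
abbreviation "gH \<equiv> grpH (middle E)"
abbreviation "gG \<equiv> grpG (middle E)"
abbreviation "eH \<equiv> \<one>\<^bsub>grpH (middle E)\<^esub>"
abbreviation "eG \<equiv> \<one>\<^bsub>grpG (middle E)\<^esub>"
abbreviation iH ("inv\<^sub>H _" [81] 80) where "inv\<^sub>H x \<equiv> inv\<^bsub>grpH (middle E)\<^esub> x"
abbreviation iG ("inv\<^sub>G _" [81] 80) where "inv\<^sub>G x \<equiv> inv\<^bsub>grpG (middle E)\<^esub> x"
abbreviation "\<iota> \<equiv> inc1 E"
abbreviation "\<j> \<equiv> inc2 E"
abbreviation "\<p> \<equiv> proj1 E"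
abbreviation "\<q> \<equiv> proj2 E"
abbreviation "\<phi> \<equiv> act (middle E)"
abbreviation "R \<equiv> rbop (middle E)"

lemma inc_hom: "group_hom (grpH K) gH \<iota>" "group_hom (grpG K) gG \<j>"
  and proj_hom: "group_hom gH (grpH A) \<p>" "group_hom gG (grpG A) \<q>"
  using ext by (unfold_locales; simp add: rrb_extension_def rrb_hom_def)+

lemmas inc_simps [simp] =
  inc_hom[THEN group_hom.hom_closed] inc_hom[THEN group_hom.hom_mult]
  inc_hom[THEN group_hom.hom_one] inc_hom[THEN group_hom.hom_inv]

lemmas proj_simps [simp] =
  proj_hom[THEN group_hom.hom_closed] proj_hom[THEN group_hom.hom_mult]
  proj_hom[THEN group_hom.hom_one] proj_hom[THEN group_hom.hom_inv]

lemma inc_inj [simp]: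
  "k \<in> cK \<Longrightarrow> k' \<in> cK \<Longrightarrow> \<iota> k = \<iota> k' \<longleftrightarrow> k = k'"
  "l \<in> cL \<Longrightarrow> l' \<in> cL \<Longrightarrow> \<j> l = \<j> l' \<longleftrightarrow> l = l'"
  using ext by (auto simp: rrb_extension_def dest: inj_onD)

lemma inc_eq_one [simp]:
  "k \<in> cK \<Longrightarrow> \<iota> k = eH \<longleftrightarrow> k = eK"
  "l \<in> cL \<Longrightarrow> \<j> l = eG \<longleftrightarrow> l = eL"
  "k \<in> cK \<Longrightarrow> eH = \<iota> k \<longleftrightarrow> k = eK"
  "l \<in> cL \<Longrightarrow> eG = \<j> l \<longleftrightarrow> l = eL"
  using inc_inj(1)[of k "eK"] inc_inj(2)[of l "eL"] by auto

lemma proj_inc [simp]: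
  "k \<in> cK \<Longrightarrow> \<p> (\<iota> k) = eA"
  "l \<in> cL \<Longrightarrow> \<q> (\<j> l) = eB"
  using ext by (auto simp: rrb_extension_def kernel_def)

lemma proj_act [simp]: "g \<in> cG \<Longrightarrow> h \<in> cH \<Longrightarrow> \<p> (\<phi> g h) = act A (\<q> g) (\<p> h)"
  and proj_R [simp]: "h \<in> cH \<Longrightarrow> \<q> (R h) = rbop A (\<p> h)"
  and R_inc [simp]: "k \<in> cK \<Longrightarrow> R (\<iota> k) = \<j> (rbop K k)"
  and inc_act: "l \<in> cL \<Longrightarrow> k \<in> cK \<Longrightarrow> \<phi> (\<j> l) (\<iota> k) = \<iota> (act K l k)"
  using ext by (auto simp: rrb_extension_def rrb_hom_def)

lemma proj_surj:
  "a \<in> cA \<Longrightarrow> \<exists>h\<in>cH. \<p> h = a" "b \<in> cB \<Longrightarrow> \<exists>g\<in>cG. \<q> g = b"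
  using ext by (auto simp: rrb_extension_def image_iff) (metis imageE)+

lemma kernel_inc:
  "h \<in> cH \<Longrightarrow> \<p> h = eA \<Longrightarrow> \<exists>k\<in>cK. h = \<iota> k"
  "g \<in> cG \<Longrightarrow> \<q> g = eB \<Longrightarrow> \<exists>l\<in>cL. g = \<j> l"
  using ext by (auto simp: rrb_extension_def kernel_def image_iff set_eq_iff)

text \<open>The quotients h^-1 h' and g^-1 g' lie in the kernels of the projections, and exactness
  applies.\<close>

lemma same_proj:
  "h \<in> cH \<Longrightarrow> h' \<in> cH \<Longrightarrow> \<p> h = \<p> h' \<Longrightarrow> \<exists>k\<in>cK. h' = h *\<^sub>H \<iota> k"
  "g \<in> cG \<Longrightarrow> g' \<in> cG \<Longrightarrow> \<q> g = \<q> g' \<Longrightarrow> \<exists>l\<in>cL. g' = g *\<^sub>G \<j> l"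
  using kernel_inc(1)[of "inv\<^sub>H h *\<^sub>H h'"] kernel_inc(2)[of "inv\<^sub>G g *\<^sub>G g'"]
  by (auto simp: E.H.inv_solve_left' E.G.inv_solve_left')

lemma backK_inc [simp]: "k \<in> cK \<Longrightarrow> backK K E (\<iota> k) = k"
  and backL_inc [simp]: "l \<in> cL \<Longrightarrow> backL K E (\<j> l) = l"
  using ext by (auto simp: backK_def backL_def rrb_extension_def)

lemma inc_backK [simp]:
  "h \<in> cH \<Longrightarrow> \<p> h = eA \<Longrightarrow> \<iota> (backK K E h) = h"
  "h \<in> cH \<Longrightarrow> \<p> h = eA \<Longrightarrow> backK K E h \<in> cK"
  using kernel_inc(1)[of h] by auto

lemma inc_backL [simp]:
  "g \<in> cG \<Longrightarrow> \<q> g = eB \<Longrightarrow> \<j> (backL K E g) = g"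
  "g \<in> cG \<Longrightarrow> \<q> g = eB \<Longrightarrow> backL K E g \<in> cL"
  using kernel_inc(2)[of g] by auto

lemma sectionsD:
  assumes "sections A E sH sG"
  shows "a \<in> cA \<Longrightarrow> sH a \<in> cH" "b \<in> cB \<Longrightarrow> sG b \<in> cG"
    "a \<in> cA \<Longrightarrow> \<p> (sH a) = a" "b \<in> cB \<Longrightarrow> \<q> (sG b) = b"
    "sH eA = eH" "sG eB = eG"
  using assms by (auto simp: sections_def)

lemma sections_exist: "\<exists>sH sG. sections A E sH sG"
proof -
  have "\<forall>a. \<exists>h. a \<in> cA \<longrightarrow> h \<in> cH \<and> \<p> h = a \<and> (a = eA \<longrightarrow> h = eH)"
    using proj_surj(1) by (metis E.H.one_closed proj_simps(5))
  moreover have "\<forall>b. \<exists>g. b \<in> cB \<longrightarrow> g \<in> cG \<and> \<q> g = b \<and> (b = eB \<longrightarrow> g = eG)"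
    using proj_surj(2) by (metis E.G.one_closed proj_simps(6))
  ultimately obtain sH sG where
    "\<forall>a. a \<in> cA \<longrightarrow> sH a \<in> cH \<and> \<p> (sH a) = a \<and> (a = eA \<longrightarrow> sH a = eH)"
    "\<forall>b. b \<in> cB \<longrightarrow> sG b \<in> cG \<and> \<q> (sG b) = b \<and> (b = eB \<longrightarrow> sG b = eG)"
    by metis
  then have "sections A E sH sG" by (auto simp: sections_def)
  then show ?thesis by blast
qed

end

text \<open>The assumptions express the associated action on arbitrary elements of the middle groups
  rather than on the values of a section.\<close>

locale rrb_ab_ext = rrb_coeff A K D + rrb_ext_base A K E
  for A :: "('a, 'b) rrb" and K :: "('k, 'l) rrb" and D :: "('a, 'b, 'k, 'l) rrb_action"
    and E :: "('a, 'b, 'k, 'l, 'h, 'g) rrb_extn" +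
  assumes inc1_mult: "k \<in> cK \<Longrightarrow> h \<in> cH \<Longrightarrow> \<iota> k *\<^sub>H h = h *\<^sub>H \<iota> (\<mu> (\<p> h) k)"
    and inc2_mult: "l \<in> cL \<Longrightarrow> g \<in> cG \<Longrightarrow> \<j> l *\<^sub>G g = g *\<^sub>G \<j> (\<sigma> (\<q> g) l)"
    and act_inc1: "g \<in> cG \<Longrightarrow> k \<in> cK \<Longrightarrow> \<phi> g (\<iota> k) = \<iota> (\<nu> (\<q> g) k)"
    and inc2_act: "l \<in> cL \<Longrightarrow> h \<in> cH \<Longrightarrow> \<phi> (\<j> l) h = h *\<^sub>H \<iota> (\<f> l (\<p> h))"

text \<open>Write an element as a section value times a kernel element. The kernel element commutes
  with the images of K or L because these groups are commutative, and the action inside the kernel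
  is trivial; hence the formulas known for section values hold for all elements.\<close>

lemma rrb_ab_extI:
  assumes "abelian_extension A K E" "associated_action A K E D"
  shows "rrb_ab_ext A K D E"
proof -
  have ext: "rrb_extension A K E" and triv: "rrb_trivial K"
    and comm: "comm_group (grpH K)" "comm_group (grpG K)"
    using assms(1) by (auto simp: abelian_extension_def)
  interpret rrb_ext_base A K E
    using ext by unfold_locales (auto simp: rrb_extension_def)
  interpret KH: comm_group "grpH K" by fact
  interpret KL: comm_group "grpG K" by fact
  have autos: "\<And>b. b \<in> cB \<Longrightarrow> nu D b \<in> auto (grpH K)"
     "\<And>a. a \<in> cA \<Longrightarrow> mu D a \<in> auto (grpH K)"
     "\<And>b. b \<in> cB \<Longrightarrow> sigma D b \<in> auto (grpG K)"
    and ff [simp]: "\<And>l a. l \<in> cL \<Longrightarrow> a \<in> cA \<Longrightarrow> ff D l a \<in> cK"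
    using assms(2) by (auto simp: associated_action_def)
  note [simp] = autos[THEN auto_closed]
  have act_K [simp]: "\<phi> (\<j> l) (\<iota> k) = \<iota> k" if "l \<in> cL" "k \<in> cK" for l k
    using that triv by (simp add: inc_act rrb_trivial_def)
  \<comment> \<open>\<open>associated_action\<close> speaks about all sections, so one arbitrary
    pair already yields the formulas.\<close>
  obtain sH sG where s: "sections A E sH sG" using sections_exist by blast
  note [simp] = sectionsD[OF s]
  from assms(2) s have
    nu: "\<And>b k. b \<in> cB \<Longrightarrow> k \<in> cK \<Longrightarrow>
           nu D b k = backK K E (\<phi> (sG b) (\<iota> k))" and
    mu: "\<And>a k. a \<in> cA \<Longrightarrow> k \<in> cK \<Longrightarrow>
           mu D a k = backK K E (inv\<^sub>H (sH a) *\<^sub>H \<iota> k *\<^sub>H sH a)" and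
    sigma: "\<And>b l. b \<in> cB \<Longrightarrow> l \<in> cL \<Longrightarrow>
           sigma D b l = backL K E (inv\<^sub>G (sG b) *\<^sub>G \<j> l *\<^sub>G sG b)" and
    ffe: "\<And>a l. l \<in> cL \<Longrightarrow> a \<in> cA \<Longrightarrow>
           ff D l a = backK K E (inv\<^sub>H (sH a) *\<^sub>H \<phi> (\<j> l) (sH a))"
    unfolding associated_action_def by (elim conjE; fast)+
  have nu': "\<phi> (sG b) (\<iota> k) = \<iota> (nu D b k)" if "b \<in> cB" "k \<in> cK" for b k
    using that by (simp add: nu)
  have mu': "\<iota> k *\<^sub>H sH a = sH a *\<^sub>H \<iota> (mu D a k)" if "a \<in> cA" "k \<in> cK" for a k
    using that by (simp add: mu E.H.m_assoc[symmetric])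
  have sigma': "\<j> l *\<^sub>G sG b = sG b *\<^sub>G \<j> (sigma D b l)" if "b \<in> cB" "l \<in> cL" for b l
    using that by (simp add: sigma E.G.m_assoc[symmetric])
  have ff': "\<phi> (\<j> l) (sH a) = sH a *\<^sub>H \<iota> (ff D l a)" if "l \<in> cL" "a \<in> cA" for l a
    using that by (simp add: ffe E.H.m_assoc[symmetric])
  have ac1: "\<iota> k *\<^sub>H \<iota> k' = \<iota> k' *\<^sub>H \<iota> k" if "k \<in> cK" "k' \<in> cK" for k k'
    using that inc_simps(3) KH.m_comm by metis
  have ac2: "\<j> k *\<^sub>G \<j> k' = \<j> k' *\<^sub>G \<j> k" if "k \<in> cL" "k' \<in> cL" for k k'
    using that inc_simps(4) KL.m_comm by metis
  have dec1: "\<exists>k\<in>cK. h = sH (\<p> h) *\<^sub>H \<iota> k" if "h \<in> cH" for h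
    using that by (intro same_proj) auto
  have dec2: "\<exists>k\<in>cL. h = sG (\<q> h) *\<^sub>G \<j> k" if "h \<in> cG" for h
    using that by (intro same_proj) auto
  \<comment> \<open>Both sides measure how the product of \<open>l\<close> and \<open>l'\<close>
    moves a section value: acting in two stages adds the two displacements, since
    \<open>\<j> l\<close> fixes the image of K.\<close>
  have ff_mult: "ff D (l *\<^sub>L l') a = ff D l a *\<^sub>K ff D l' a"
    if "l \<in> cL" "l' \<in> cL" "a \<in> cA" for l l' a
  proof -
    have "sH a *\<^sub>H \<iota> (ff D (l *\<^sub>L l') a) = \<phi> (\<j> l) (\<phi> (\<j> l') (sH a))"
      using that by (simp flip: ff')
    also have "\<dots> = sH a *\<^sub>H \<iota> (ff D l a *\<^sub>K ff D l' a)"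
      using that by (simp add: ff' E.H.m_assoc)
    finally show ?thesis using that by (simp del: inc_simps(3))
  qed
  have 1: "\<iota> k *\<^sub>H h = h *\<^sub>H \<iota> (mu D (\<p> h) k)" if "k \<in> cK" "h \<in> cH" for k h
  proof -
    from dec1[OF that(2)] obtain k' where k': "k' \<in> cK" "h = sH (\<p> h) *\<^sub>H \<iota> k'" by blast
    define a where "a = \<p> h"
    have a: "a \<in> cA" "h = sH a *\<^sub>H \<iota> k'" using that k' by (auto simp: a_def)
    have "\<iota> k *\<^sub>H h = \<iota> k *\<^sub>H sH a *\<^sub>H \<iota> k'" using a k' that by (simp add: E.H.m_assoc)
    also have "\<dots> = sH a *\<^sub>H (\<iota> (mu D a k) *\<^sub>H \<iota> k')" using a k' that by (simp add: mu' E.H.m_assoc)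
    also have "\<dots> = h *\<^sub>H \<iota> (mu D a k)" using a k' that by (simp add: ac1 E.H.m_assoc)
    finally show ?thesis by (simp add: a_def)
  qed
  have 2: "\<j> k *\<^sub>G h = h *\<^sub>G \<j> (sigma D (\<q> h) k)" if "k \<in> cL" "h \<in> cG" for k h
  proof -
    from dec2[OF that(2)] obtain k' where k': "k' \<in> cL" "h = sG (\<q> h) *\<^sub>G \<j> k'" by blast
    define a where "a = \<q> h"
    have a: "a \<in> cB" "h = sG a *\<^sub>G \<j> k'" using that k' by (auto simp: a_def)
    have "\<j> k *\<^sub>G h = \<j> k *\<^sub>G sG a *\<^sub>G \<j> k'" using a k' that by (simp add: E.G.m_assoc)
    also have "\<dots> = sG a *\<^sub>G (\<j> (sigma D a k) *\<^sub>G \<j> k')" using a k' that by (simp add: sigma' E.G.m_assoc)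
    also have "\<dots> = h *\<^sub>G \<j> (sigma D a k)" using a k' that by (simp add: ac2 E.G.m_assoc)
    finally show ?thesis by (simp add: a_def)
  qed
  \<comment> \<open>The kernel part of \<open>g\<close> fixes the image of K, so only the section
    part of \<open>g\<close> contributes.\<close>
  have 3: "\<phi> g (\<iota> k) = \<iota> (nu D (\<q> g) k)" if "g \<in> cG" "k \<in> cK" for g k
  proof -
    from dec2[OF that(1)] obtain l where l: "l \<in> cL" "g = sG (\<q> g) *\<^sub>G \<j> l" by blast
    have "\<phi> g (\<iota> k) = \<phi> (sG (\<q> g) *\<^sub>G \<j> l) (\<iota> k)" using l by simp
    also have "\<dots> = \<iota> (nu D (\<q> g) k)" using that l(1) by (simp add: nu')
    finally show ?thesis .
  qed
  have 4: "\<phi> (\<j> l) h = h *\<^sub>H \<iota> (ff D l (\<p> h))" if "l \<in> cL" "h \<in> cH" for l h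
  proof -
    from dec1[OF that(2)] obtain k' where k': "k' \<in> cK" "h = sH (\<p> h) *\<^sub>H \<iota> k'" by blast
    define a where "a = \<p> h"
    have a: "a \<in> cA" "h = sH a *\<^sub>H \<iota> k'" using that k' by (auto simp: a_def)
    have "\<phi> (\<j> l) h = sH a *\<^sub>H (\<iota> (ff D l a) *\<^sub>H \<iota> k')" using a k' that by (simp add: ff' E.H.m_assoc)
    also have "\<dots> = h *\<^sub>H \<iota> (ff D l a)" using a k' that by (simp add: ac1 E.H.m_assoc)
    finally show ?thesis by (simp add: a_def)
  qed
  show ?thesis
    by unfold_locales (use triv autos ff_mult 1 2 3 4 in auto)
qed

context rrb_ab_ext
begin

abbreviation "eC \<equiv> \<one>\<^bsub>C_group A K D\<^esub>"
abbreviation "eH2 \<equiv> \<one>\<^bsub>H2_RRB A K D\<^esub>"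
abbreviation "\<omega> \<equiv> omega_map A K D E"
abbreviation "coc \<equiv> ext_cocycle A K E"
abbreviation oH (infixl "\<circ>\<^sub>H" 70) where "f \<circ>\<^sub>H g \<equiv> f \<otimes>\<^bsub>AutoGroup gH\<^esub> g"
abbreviation oG (infixl "\<circ>\<^sub>G" 70) where "f \<circ>\<^sub>G g \<equiv> f \<otimes>\<^bsub>AutoGroup gG\<^esub> g"
abbreviation "cN \<equiv> carrier (Aut_normalizing K E)"
abbreviation "\<rho> \<equiv> rho_map A K E"

lemma abelian_extension: "abelian_extension A K E"
  using ext comm_K comm_L triv by (simp add: abelian_extension_def)

text \<open>The converse of \<open>rrb_ab_extI\<close>. The laws of the locale depend on an element
  only through its projection, so the formulas come out the same for every choice of
  sections.\<close>

lemma associated_action: "associated_action A K E D"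
  unfolding associated_action_def
proof (intro conjI allI impI ballI Pi_I)
  fix sH sG assume "sections A E sH sG"
  note [simp] = sectionsD[OF this]
  show "\<nu> b k = backK K E (\<phi> (sG b) (\<iota> k))" if "b \<in> cB" "k \<in> cK" for b k
    using that by (simp add: act_inc1)
  show "\<mu> a k = backK K E (inv\<^sub>H (sH a) *\<^sub>H \<iota> k *\<^sub>H sH a)" if "a \<in> cA" "k \<in> cK" for a k
    using that by (simp add: inc1_mult E.H.m_assoc) (simp add: E.H.m_assoc[symmetric])
  show "\<sigma> b l = backL K E (inv\<^sub>G (sG b) *\<^sub>G \<j> l *\<^sub>G sG b)" if "b \<in> cB" "l \<in> cL" for b l
    using that by (simp add: inc2_mult E.G.m_assoc) (simp add: E.G.m_assoc[symmetric])
  show "\<f> l a = backK K E (inv\<^sub>H (sH a) *\<^sub>H \<phi> (\<j> l) (sH a))" if "l \<in> cL" "a \<in> cA" for l a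
    using that by (simp add: inc2_act) (simp add: E.H.m_assoc[symmetric])
qed (simp_all add: nu_auto mu_auto sigma_auto)

text \<open>The Rota--Baxter identity evaluates \<open>R\<close> only at products of
  \<open>h\<close> with an element in the image of \<open>\<phi> (R h)\<close>. The kernel factor is
  therefore written as such an image, which brings in the inverse of \<nu>.\<close>

lemma R_mult_inc [simp]:
  assumes "h \<in> cH" "k \<in> cK"
  shows "R (h *\<^sub>H \<iota> k) = R h *\<^sub>G \<j> (S (\<nu>' (T (\<p> h)) k))"
proof -
  have "\<iota> k = \<phi> (R h) (\<iota> (\<nu>' (T (\<p> h)) k))" using assms by (simp add: act_inc1)
  then show ?thesis using assms E.rb_mult[of h "\<iota> (\<nu>' (T (\<p> h)) k)"] by simp
qed

lemma inc2_act_inc1 [simp]: "l \<in> cL \<Longrightarrow> k \<in> cK \<Longrightarrow> \<phi> (\<j> l) (\<iota> k) = \<iota> k"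
  by (simp add: inc_act)

lemma cancel_inc [simp]:
  "h \<in> cH \<Longrightarrow> k \<in> cK \<Longrightarrow> k' \<in> cK \<Longrightarrow> h *\<^sub>H \<iota> k = h *\<^sub>H \<iota> k' \<longleftrightarrow> k = k'"
  "g \<in> cG \<Longrightarrow> l \<in> cL \<Longrightarrow> l' \<in> cL \<Longrightarrow> g *\<^sub>G \<j> l = g *\<^sub>G \<j> l' \<longleftrightarrow> l = l'"
  by simp_all

lemma mult_inc_inc:
  "h \<in> cH \<Longrightarrow> k \<in> cK \<Longrightarrow> k' \<in> cK \<Longrightarrow> h *\<^sub>H \<iota> k *\<^sub>H \<iota> k' = h *\<^sub>H \<iota> (k *\<^sub>K k')"
  "g \<in> cG \<Longrightarrow> l \<in> cL \<Longrightarrow> l' \<in> cL \<Longrightarrow> g *\<^sub>G \<j> l *\<^sub>G \<j> l' = g *\<^sub>G \<j> (l *\<^sub>L l')"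
  by (simp_all add: E.H.m_assoc E.G.m_assoc)

text \<open>Kernel factors travel to the right at the price of \<mu> or \<sigma>. With
  \<open>mult_inc_inc\<close>, which merges them, this leads to the normal form with one kernel
  factor at the right end.\<close>

lemma mult_inc_mult:
  "h \<in> cH \<Longrightarrow> h' \<in> cH \<Longrightarrow> k \<in> cK \<Longrightarrow> h *\<^sub>H \<iota> k *\<^sub>H h' = h *\<^sub>H h' *\<^sub>H \<iota> (\<mu> (\<p> h') k)"
  "g \<in> cG \<Longrightarrow> g' \<in> cG \<Longrightarrow> l \<in> cL \<Longrightarrow> g *\<^sub>G \<j> l *\<^sub>G g' = g *\<^sub>G g' *\<^sub>G \<j> (\<sigma> (\<q> g') l)"
  by (simp_all add: E.H.m_assoc E.G.m_assoc inc1_mult inc2_mult)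

lemma act_mult_inc:
  "g \<in> cG \<Longrightarrow> l \<in> cL \<Longrightarrow> h \<in> cH \<Longrightarrow> \<phi> (g *\<^sub>G \<j> l) h = \<phi> g h *\<^sub>H \<iota> (\<nu> (\<q> g) (\<f> l (\<p> h)))"
  by (simp add: inc2_act act_inc1)

lemma backK_eq_iff:
  assumes "h \<in> cH" "h' \<in> cH" "\<p> h = \<p> h'" "k \<in> cK"
  shows "backK K E (inv\<^sub>H h *\<^sub>H h') = k \<longleftrightarrow> h' = h *\<^sub>H \<iota> k"
proof -
  have "backK K E (inv\<^sub>H h *\<^sub>H h') = k \<longleftrightarrow> inv\<^sub>H h *\<^sub>H h' = \<iota> k"
    using assms by (metis A.H.l_inv E.H.inv_closed E.H.m_closed backK_inc inc_backK(1) proj_simps(1,3,7))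
  then show ?thesis using assms by (simp add: E.H.inv_solve_left')
qed

lemma backL_eq_iff:
  assumes "g \<in> cG" "g' \<in> cG" "\<q> g = \<q> g'" "l \<in> cL"
  shows "backL K E (inv\<^sub>G g *\<^sub>G g') = l \<longleftrightarrow> g' = g *\<^sub>G \<j> l"
proof -
  have "backL K E (inv\<^sub>G g *\<^sub>G g') = l \<longleftrightarrow> inv\<^sub>G g *\<^sub>G g' = \<j> l"
    using assms by (metis A.G.l_inv E.G.inv_closed E.G.m_closed backL_inc inc_backL(1) proj_simps(2,4,8))
  then show ?thesis using assms by (simp add: E.G.inv_solve_left')
qed

text \<open>The defining equations of the cocycle, solved for the products of section values so that
  the partial inverses of the inclusions disappear.\<close>

definition realizes :: "('a \<Rightarrow> 'h) \<Rightarrow> ('b \<Rightarrow> 'g) \<Rightarrow> ('a, 'b, 'k, 'l) cochain2 \<Rightarrow> bool" where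
  "realizes sH sG = (\<lambda>(t1, t2, r, x).
    (\<forall>a1\<in>cA. \<forall>a2\<in>cA. sH a1 *\<^sub>H sH a2 = sH (a1 *\<^sub>A a2) *\<^sub>H \<iota> (t1 (a1, a2))) \<and>
    (\<forall>b1\<in>cB. \<forall>b2\<in>cB. sG b1 *\<^sub>G sG b2 = sG (b1 *\<^sub>B b2) *\<^sub>G \<j> (t2 (b1, b2))) \<and>
    (\<forall>a\<in>cA. \<forall>b\<in>cB. \<phi> (sG b) (sH a) = sH (\<beta> b a) *\<^sub>H \<iota> (r (a, b))) \<and>
    (\<forall>a\<in>cA. R (sH a) = sG (T a) *\<^sub>G \<j> (x a)))"

lemma realizesD:
  assumes "realizes sH sG (t1, t2, r, x)"
  shows "a1 \<in> cA \<Longrightarrow> a2 \<in> cA \<Longrightarrow> sH a1 *\<^sub>H sH a2 = sH (a1 *\<^sub>A a2) *\<^sub>H \<iota> (t1 (a1, a2))"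
    "b1 \<in> cB \<Longrightarrow> b2 \<in> cB \<Longrightarrow> sG b1 *\<^sub>G sG b2 = sG (b1 *\<^sub>B b2) *\<^sub>G \<j> (t2 (b1, b2))"
    "a1 \<in> cA \<Longrightarrow> b1 \<in> cB \<Longrightarrow> \<phi> (sG b1) (sH a1) = sH (\<beta> b1 a1) *\<^sub>H \<iota> (r (a1, b1))"
    "a1 \<in> cA \<Longrightarrow> R (sH a1) = sG (T a1) *\<^sub>G \<j> (x a1)"
  using assms by (auto simp: realizes_def)

lemma ext_cocycle_closed:
  assumes "sections A E sH sG" shows "coc sH sG \<in> cP"
proof -
  note [simp] = sectionsD[OF assms]
  show ?thesis
    by (auto simp: ext_cocycle_def mem_cochain_prod A.H.m_assoc A.G.m_assoc)
qed

text \<open>This is how cocycles are computed from here on: a candidate quadruple is shown to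
  satisfy the product equations of \<open>realizes\<close>, and is thereby identified as the
  cocycle.\<close>

lemma ext_cocycle_eq_iff:
  assumes s: "sections A E sH sG" and z: "z \<in> cP"
  shows "coc sH sG = z \<longleftrightarrow> realizes sH sG z"
proof -
  obtain t1 t2 r x where z_def: "z = (t1, t2, r, x)" by (cases z)
  note [simp] = sectionsD[OF s] cochain_closed[OF z[unfolded z_def]]
  obtain t1' t2' r' x' where c_def: "coc sH sG = (t1', t2', r', x')"
    by (cases "coc sH sG")
  have c: "t1' (a1, a2) = backK K E (inv\<^sub>H (sH (a1 *\<^sub>A a2)) *\<^sub>H (sH a1 *\<^sub>H sH a2))"
      "t2' (b1, b2) = backL K E (inv\<^sub>G (sG (b1 *\<^sub>B b2)) *\<^sub>G (sG b1 *\<^sub>G sG b2))"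
      "r' (a1, b1) = backK K E (inv\<^sub>H (sH (\<beta> b1 a1)) *\<^sub>H \<phi> (sG b1) (sH a1))"
      "x' a1 = backL K E (inv\<^sub>G (sG (T a1)) *\<^sub>G R (sH a1))"
    if "a1 \<in> cA" "a2 \<in> cA" "b1 \<in> cB" "b2 \<in> cB" for a1 a2 b1 b2
    using c_def that by (auto simp: ext_cocycle_def E.H.m_assoc E.G.m_assoc)
  \<comment> \<open>The equations in \<open>e\<close> are quantified over four elements at once; the
    identities are dummy values for those that an individual equation does not mention.\<close>
  have eA: "eA \<in> cA" and eB: "eB \<in> cB" by simp_all
  have e: "t1' (a1, a2) = t1 (a1, a2) \<longleftrightarrow> sH a1 *\<^sub>H sH a2 = sH (a1 *\<^sub>A a2) *\<^sub>H \<iota> (t1 (a1, a2))"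
    "t2' (b1, b2) = t2 (b1, b2) \<longleftrightarrow> sG b1 *\<^sub>G sG b2 = sG (b1 *\<^sub>B b2) *\<^sub>G \<j> (t2 (b1, b2))"
    "r' (a1, b1) = r (a1, b1) \<longleftrightarrow> \<phi> (sG b1) (sH a1) = sH (\<beta> b1 a1) *\<^sub>H \<iota> (r (a1, b1))"
    "x' a1 = x a1 \<longleftrightarrow> R (sH a1) = sG (T a1) *\<^sub>G \<j> (x a1)"
    if "a1 \<in> cA" "a2 \<in> cA" "b1 \<in> cB" "b2 \<in> cB" for a1 a2 b1 b2
    unfolding c[OF that] using that by (subst backK_eq_iff backL_eq_iff; simp)+
  note e' = e(1)[OF _ _ eB eB] e(2)[OF eA eA] e(3)[OF _ eA _ eB] e(4)[OF _ eA eB eB]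
  have "(t1', t2', r', x') = (t1, t2, r, x) \<longleftrightarrow> realizes sH sG (t1, t2, r, x)"
  proof
    assume "(t1', t2', r', x') = (t1, t2, r, x)"
    then have eq: "t1' = t1" "t2' = t2" "r' = r" "x' = x" by simp_all
    show "realizes sH sG (t1, t2, r, x)"
      unfolding realizes_def
      using e'(1)[THEN iffD1] e'(2)[THEN iffD1] e'(3)[THEN iffD1] e'(4)[THEN iffD1]
      unfolding eq by blast
  next
    assume "realizes sH sG (t1, t2, r, x)"
    note * = realizesD[OF this]
    show "(t1', t2', r', x') = (t1, t2, r, x)"
    proof (rule cochain_eqI[of _ _ _ _ A K])
      show "(t1', t2', r', x') \<in> cP"
        using ext_cocycle_closed[OF s] by (simp add: c_def)
      show "(t1, t2, r, x) \<in> cP" using z by (simp add: z_def)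
      show "t1' (a1, a2) = t1 (a1, a2)" if "a1 \<in> cA" "a2 \<in> cA" for a1 a2
        by (rule e'(1)[OF that, THEN iffD2]) (rule *(1)[OF that])
      show "t2' (b1, b2) = t2 (b1, b2)" if "b1 \<in> cB" "b2 \<in> cB" for b1 b2
        by (rule e'(2)[OF that, THEN iffD2]) (rule *(2)[OF that])
      show "r' (a, b) = r (a, b)" if "a \<in> cA" "b \<in> cB" for a b
        by (rule e'(3)[OF that, THEN iffD2]) (rule *(3)[OF that])
      show "x' a = x a" if "a \<in> cA" for a
        by (rule e'(4)[OF that, THEN iffD2]) (rule *(4)[OF that])
    qed
  qed
  then show ?thesis by (simp add: c_def z_def)
qed

lemma ext_cocycle_cases:
  assumes "sections A E sH sG"
  obtains t1 t2 r x where "coc sH sG = (t1, t2, r, x)" "(t1, t2, r, x) \<in> cP" "realizes sH sG (t1, t2, r, x)"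
  using ext_cocycle_closed[OF assms] ext_cocycle_eq_iff[OF assms] by (metis prod_cases4)

text \<open>Rewrite rules towards the normal form. Products are bracketed to the left so that a
  kernel factor and the next section value become neighbours and can be exchanged.\<close>

lemma section_simps:
  assumes "sections A E sH sG"
  shows "h \<in> cH \<Longrightarrow> k \<in> cK \<Longrightarrow> a \<in> cA \<Longrightarrow> h *\<^sub>H \<iota> k *\<^sub>H sH a = h *\<^sub>H sH a *\<^sub>H \<iota> (\<mu> a k)"
    "g \<in> cG \<Longrightarrow> l \<in> cL \<Longrightarrow> b \<in> cB \<Longrightarrow> g *\<^sub>G \<j> l *\<^sub>G sG b = g *\<^sub>G sG b *\<^sub>G \<j> (\<sigma> b l)"
    "b \<in> cB \<Longrightarrow> k \<in> cK \<Longrightarrow> \<phi> (sG b) (\<iota> k) = \<iota> (\<nu> b k)"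
    "l \<in> cL \<Longrightarrow> a \<in> cA \<Longrightarrow> \<phi> (\<j> l) (sH a) = sH a *\<^sub>H \<iota> (\<f> l a)"
    "x \<in> cH \<Longrightarrow> y \<in> cH \<Longrightarrow> z \<in> cH \<Longrightarrow> x *\<^sub>H (y *\<^sub>H z) = x *\<^sub>H y *\<^sub>H z"
    "x' \<in> cG \<Longrightarrow> y' \<in> cG \<Longrightarrow> z' \<in> cG \<Longrightarrow> x' *\<^sub>G (y' *\<^sub>G z') = x' *\<^sub>G y' *\<^sub>G z'"
  using sectionsD[OF assms]
  by (simp_all add: mult_inc_mult act_inc1 inc2_act) (simp_all add: E.H.m_assoc E.G.m_assoc)

text \<open>Each identity comes from evaluating one law of the middle term at section values and
  comparing kernel components: associativity in H and in G, the two laws of the action, and the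
  Rota--Baxter identity. The normalisation conditions are the product equations at the
  identity.\<close>

lemma ext_cocycle_Z2:
  assumes s: "sections A E sH sG"
  shows "coc sH sG \<in> cZ2"
proof -
  obtain t1 t2 r x where c_def: "coc sH sG = (t1, t2, r, x)" and c: "(t1, t2, r, x) \<in> cP"
    and c': "realizes sH sG (t1, t2, r, x)" by (rule ext_cocycle_cases[OF s])
  note [simp] = sectionsD[OF s] cochain_closed[OF c]
  note e = realizesD[OF c']
  note norm = e section_simps[OF s] mult_inc_inc
  show ?thesis
    unfolding c_def mem_Z2
  proof (intro conjI ballI c, goal_cases)
    case (1 a) then show ?case using e(1)[of eA a] by simp
  next
    case (2 a) then show ?case using e(1)[of a eA] by simp
  next
    case (3 b) then show ?case using e(2)[of eB b] by simp
  next
    case (4 b) then show ?case using e(2)[of b eB] by simp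
  next
    case (5 b) then show ?case using e(3)[of eA b] by simp
  next
    case (6 a) then show ?case using e(3)[of a eB] by simp
  next
    case 7 then show ?case using e(4)[of eA] by simp
  next
    case (8 a1 a2 a3)
    then have "sH a1 *\<^sub>H (sH a2 *\<^sub>H sH a3) = sH a1 *\<^sub>H sH a2 *\<^sub>H sH a3" by (simp add: E.H.m_assoc)
    with 8 show ?case by (simp add: norm A.H.m_assoc del: inc_simps(3)) (simp add: KH.m_comm)
  next
    case (9 a1 a2 a3)
    then have "sG a1 *\<^sub>G (sG a2 *\<^sub>G sG a3) = sG a1 *\<^sub>G sG a2 *\<^sub>G sG a3" by (simp add: E.G.m_assoc)
    with 9 show ?case by (simp add: norm A.G.m_assoc del: inc_simps(4)) (simp add: KL.m_comm)
  next
    case (10 a b1 b2)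
    then have "\<phi> (sG b1) (\<phi> (sG b2) (sH a)) = \<phi> (sG b1 *\<^sub>G sG b2) (sH a)" by simp
    with 10 show ?case by (simp add: norm del: inc_simps(3))
  next
    case (11 a1 a2 b)
    then have "\<phi> (sG b) (sH a1) *\<^sub>H \<phi> (sG b) (sH a2) = \<phi> (sG b) (sH a1 *\<^sub>H sH a2)" by simp
    with 11 show ?case by (simp add: norm del: inc_simps(3)) (simp add: KH.m_ac)
  next
    case (12 a1 a2)
    then have "R (sH a1) *\<^sub>G R (sH a2) = R (sH a1 *\<^sub>H \<phi> (R (sH a1)) (sH a2))" by (simp add: E.rb_mult)
    with 12 have "\<sigma> (T a2) (x a1) *\<^sub>L x a2 *\<^sub>L t2 (T a1, T a2)
      = x (a1 *\<^sub>A \<beta> (T a1) a2) *\<^sub>L S (\<nu>' (T (a1 *\<^sub>A \<beta> (T a1) a2))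
          (r (a2, T a1) *\<^sub>K t1 (a1, \<beta> (T a1) a2) *\<^sub>K \<nu> (T a1) (\<f> (x a1) a2)))" (is "_ = ?x *\<^sub>L ?w")
      by (simp add: norm A.rb_mult KH.m_ac KL.m_ac del: inc_simps(3,4))
    \<comment> \<open>The last condition of \<open>Z2_RRB\<close> is solved for the value of
      \<open>S\<close>, so the factor \<open>?x\<close> moves to the other side.\<close>
    then have "inv\<^sub>L ?x *\<^sub>L (\<sigma> (T a2) (x a1) *\<^sub>L x a2 *\<^sub>L t2 (T a1, T a2)) = ?w"
      using 12 by (simp add: K.G.m_assoc[symmetric])
    then show ?case using 12 by (simp add: KL.m_ac)
  qed
qed

lemma sections_change:
  assumes s: "sections A E sH sG" and k: "\<kappa>1 \<in> cA \<rightarrow> cK" "\<kappa>2 \<in> cB \<rightarrow> cL" "\<kappa>1 eA = eK" "\<kappa>2 eB = eL"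
  shows "sections A E (\<lambda>a. sH a *\<^sub>H \<iota> (\<kappa>1 a)) (\<lambda>b. sG b *\<^sub>G \<j> (\<kappa>2 b))"
proof -
  note [simp] = sectionsD[OF s]
  have [simp]: "a \<in> cA \<Longrightarrow> \<kappa>1 a \<in> cK" "b \<in> cB \<Longrightarrow> \<kappa>2 b \<in> cL" for a b
    using k by auto
  show ?thesis using k by (auto simp: sections_def)
qed

text \<open>Carrying the inserted kernel factors to the right end of each product equation produces
  the terms of \<open>coboundary\<close>; K and L being commutative, they can be collected into one
  factor.\<close>

lemma ext_cocycle_change:
  assumes s: "sections A E sH sG" and s': "sections A E sH' sG'"
    and k: "\<kappa>1 \<in> cA \<rightarrow> cK" "\<kappa>2 \<in> cB \<rightarrow> cL"
    and H: "\<And>a. a \<in> cA \<Longrightarrow> sH' a = sH a *\<^sub>H \<iota> (\<kappa>1 a)"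
    and G: "\<And>b. b \<in> cB \<Longrightarrow> sG' b = sG b *\<^sub>G \<j> (\<kappa>2 b)"
  shows "coc sH' sG' = coc sH sG *\<^sub>P coboundary \<kappa>1 \<kappa>2"
proof -
  obtain t1 t2 r x where c_def: "coc sH sG = (t1, t2, r, x)" and c: "(t1, t2, r, x) \<in> cP"
    and c': "realizes sH sG (t1, t2, r, x)" by (rule ext_cocycle_cases[OF s])
  have [simp]: "a \<in> cA \<Longrightarrow> \<kappa>1 a \<in> cK" "b \<in> cB \<Longrightarrow> \<kappa>2 b \<in> cL" for a b
    using k by auto
  note [simp] = sectionsD[OF s] cochain_closed[OF c] H G
  note e = realizesD[OF c']
  note norm = e section_simps[OF s] mult_inc_inc
  have cl: "(t1, t2, r, x) *\<^sub>P coboundary \<kappa>1 \<kappa>2 \<in> cP"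
    using c coboundary_closed[OF k] by simp
  have "realizes sH' sG' ((t1, t2, r, x) *\<^sub>P coboundary \<kappa>1 \<kappa>2)"
    unfolding coboundary_def mult_cochain_prod realizes_def prod.case
  proof (intro conjI ballI, goal_cases)
    case (1 a1 a2)
    \<comment> \<open>The new section value at the product contributes
      \<open>\<kappa>1 (a1 *\<^sub>A a2)\<close>, which cancels the inverse contained in the
      coboundary. The other three cases follow the same pattern.\<close>
    then have "\<kappa>1 (a1 *\<^sub>A a2) *\<^sub>K (t1 (a1, a2) *\<^sub>K (inv\<^sub>K (\<kappa>1 (a1 *\<^sub>A a2)) *\<^sub>K
        (\<kappa>1 a2 *\<^sub>K \<mu> a2 (\<kappa>1 a1)))) = t1 (a1, a2) *\<^sub>K (\<kappa>1 a2 *\<^sub>K \<mu> a2 (\<kappa>1 a1))"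
      by (intro KH.mult_cancel_inv) simp_all
    with 1 show ?case by (simp add: norm KH.m_ac del: inc_simps(3))
  next
    case (2 b1 b2)
    then have "\<kappa>2 (b1 *\<^sub>B b2) *\<^sub>L (t2 (b1, b2) *\<^sub>L (inv\<^sub>L (\<kappa>2 (b1 *\<^sub>B b2)) *\<^sub>L
        (\<kappa>2 b2 *\<^sub>L \<sigma> b2 (\<kappa>2 b1)))) = t2 (b1, b2) *\<^sub>L (\<kappa>2 b2 *\<^sub>L \<sigma> b2 (\<kappa>2 b1))"
      by (intro KL.mult_cancel_inv) simp_all
    with 2 show ?case by (simp add: norm KL.m_ac del: inc_simps(4))
  next
    case (3 a b)
    then have "\<kappa>1 (\<beta> b a) *\<^sub>K (r (a, b) *\<^sub>K (inv\<^sub>K (\<kappa>1 (\<beta> b a)) *\<^sub>K \<nu> b (\<f> (\<kappa>2 b) a *\<^sub>K \<kappa>1 a)))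
      = r (a, b) *\<^sub>K \<nu> b (\<f> (\<kappa>2 b) a *\<^sub>K \<kappa>1 a)"
      by (intro KH.mult_cancel_inv) simp_all
    with 3 show ?case by (simp add: norm KH.m_ac del: inc_simps(3))
  next
    case (4 a)
    then have "\<kappa>2 (T a) *\<^sub>L (x a *\<^sub>L (inv\<^sub>L (\<kappa>2 (T a)) *\<^sub>L S (\<nu>' (T a) (\<kappa>1 a))))
      = x a *\<^sub>L S (\<nu>' (T a) (\<kappa>1 a))"
      by (intro KL.mult_cancel_inv) simp_all
    with 4 show ?case by (simp add: norm KL.m_ac del: inc_simps(4))
  qed
  then show ?thesis
    using ext_cocycle_eq_iff[OF s' cl] by (simp add: c_def)
qed

lemma sections_differ:
  assumes s: "sections A E sH sG" and s': "sections A E sH' sG'"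
  obtains \<kappa>1 \<kappa>2 where "\<kappa>1 \<in> cA \<rightarrow> cK" "\<kappa>2 \<in> cB \<rightarrow> cL" "\<kappa>1 eA = eK" "\<kappa>2 eB = eL"
    "\<And>a. a \<in> cA \<Longrightarrow> sH' a = sH a *\<^sub>H \<iota> (\<kappa>1 a)" "\<And>b. b \<in> cB \<Longrightarrow> sG' b = sG b *\<^sub>G \<j> (\<kappa>2 b)"
proof -
  note d = sectionsD[OF s] sectionsD[OF s']
  have "\<forall>a\<in>cA. \<exists>k\<in>cK. sH' a = sH a *\<^sub>H \<iota> k" using d by (auto intro!: same_proj)
  then obtain \<kappa>1 where 1: "\<And>a. a \<in> cA \<Longrightarrow> \<kappa>1 a \<in> cK" "\<And>a. a \<in> cA \<Longrightarrow> sH' a = sH a *\<^sub>H \<iota> (\<kappa>1 a)"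
    by metis
  have "\<forall>b\<in>cB. \<exists>k\<in>cL. sG' b = sG b *\<^sub>G \<j> k" using d by (auto intro!: same_proj)
  then obtain \<kappa>2 where 2: "\<And>a. a \<in> cB \<Longrightarrow> \<kappa>2 a \<in> cL" "\<And>a. a \<in> cB \<Longrightarrow> sG' a = sG a *\<^sub>G \<j> (\<kappa>2 a)"
    by metis
  show thesis
  proof (rule that)
    show "\<kappa>1 eA = eK" "\<kappa>2 eB = eL"
      using 1[of eA] 2[of eB] d by auto
  qed (use 1 2 in auto)
qed

text \<open>A coboundary is the quotient of the cocycles of \<open>E\<close> for two pairs of sections, so the
  cocycle equations need not be checked for it.\<close>

lemma coboundary_Z2:
  assumes k: "\<kappa>1 \<in> cA \<rightarrow> cK" "\<kappa>2 \<in> cB \<rightarrow> cL" "\<kappa>1 eA = eK" "\<kappa>2 eB = eL"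
  shows "coboundary \<kappa>1 \<kappa>2 \<in> cZ2"
proof -
  obtain sH sG where s: "sections A E sH sG" using sections_exist by blast
  note s' = sections_change[OF s k]
  let ?c = "coc sH sG"
  have c: "?c \<in> cP" by (rule ext_cocycle_closed[OF s])
  have "?c *\<^sub>P coboundary \<kappa>1 \<kappa>2 \<in> cZ2"
    using ext_cocycle_change[OF s s' k(1,2)] ext_cocycle_Z2[OF s'] by simp
  then have "inv\<^sub>P ?c *\<^sub>P (?c *\<^sub>P coboundary \<kappa>1 \<kappa>2)
      \<in> cZ2"
    using subgroup.m_closed[OF subgroup_Z2] subgroup.m_inv_closed[OF subgroup_Z2] ext_cocycle_Z2[OF s] by blast
  moreover have "inv\<^sub>P ?c *\<^sub>P (?c *\<^sub>P coboundary \<kappa>1 \<kappa>2)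
      = coboundary \<kappa>1 \<kappa>2"
    using c coboundary_closed[OF k(1,2)] by (simp add: CP.m_assoc[symmetric])
  ultimately show ?thesis by simp
qed

lemma B2_eq: "B2 = {coboundary \<kappa>1 \<kappa>2 | \<kappa>1 \<kappa>2. \<kappa>1 \<in> cA \<rightarrow> cK \<and> \<kappa>2 \<in> cB \<rightarrow> cL \<and> \<kappa>1 eA = eK \<and> \<kappa>2 eB = eL}"
  using coboundary_Z2 by (auto simp: set_eq_iff mem_B2)

lemma coset_ext_cocycle:
  assumes s: "sections A E sH sG" and s': "sections A E sH' sG'"
  shows "\<lbrakk>coc sH' sG'\<rbrakk> = \<lbrakk>coc sH sG\<rbrakk>"
proof -
  obtain \<kappa>1 \<kappa>2 where k: "\<kappa>1 \<in> cA \<rightarrow> cK" "\<kappa>2 \<in> cB \<rightarrow> cL" "\<kappa>1 eA = eK" "\<kappa>2 eB = eL"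
    "\<And>a. a \<in> cA \<Longrightarrow> sH' a = sH a *\<^sub>H \<iota> (\<kappa>1 a)" "\<And>b. b \<in> cB \<Longrightarrow> sG' b = sG b *\<^sub>G \<j> (\<kappa>2 b)"
    using sections_differ[OF s s'] by metis
  have "coc sH' sG' = coc sH sG *\<^sub>P coboundary \<kappa>1 \<kappa>2"
    by (rule ext_cocycle_change[OF s s' k(1,2,5,6)])
  also have "\<dots> = coboundary \<kappa>1 \<kappa>2 *\<^sub>P coc sH sG"
    by (rule CP.m_comm[OF ext_cocycle_closed[OF s] coboundary_closed[OF k(1,2)]])
  finally have "coc sH' sG' =
    coboundary \<kappa>1 \<kappa>2 \<otimes>\<^bsub>Z2_RRB A K D\<^esub> coc sH sG" by simp
  moreover have "coboundary \<kappa>1 \<kappa>2 \<in> B2" using k(1-4) by (auto simp: B2_eq)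
  ultimately show ?thesis
    using coset_eq_iff[OF ext_cocycle_Z2[OF s'] ext_cocycle_Z2[OF s]] by blast
qed

end

section \<open>Equivalence and translation of extensions\<close>

text \<open>\<open>u\<close> and \<open>v\<close> are parametrisations by the same index set. They
  will be the decompositions of two middle groups into section value and kernel element.\<close>

lemma bij_betw_images:
  "inj_on v I \<Longrightarrow> (\<And>x. x \<in> I \<Longrightarrow> f (u x) = v x) \<Longrightarrow> bij_betw f (u ` I) (v ` I)"
  by (auto simp: bij_betw_def inj_on_def image_image)

text \<open>Bijectivity comes from the action laws: the map attached to the inverse of
  \<open>g\<close> inverts the map attached to \<open>g\<close>.\<close>

lemma act_homI:
  assumes "group G" "group H"
    and "\<And>g. g \<in> carrier G \<Longrightarrow> f g \<in> extensional (carrier H)"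
    and "\<And>g x. g \<in> carrier G \<Longrightarrow> x \<in> carrier H \<Longrightarrow> f g x \<in> carrier H"
    and "\<And>g x y. g \<in> carrier G \<Longrightarrow> x \<in> carrier H \<Longrightarrow> y \<in> carrier H \<Longrightarrow>
      f g (x \<otimes>\<^bsub>H\<^esub> y) = f g x \<otimes>\<^bsub>H\<^esub> f g y"
    and "\<And>x. x \<in> carrier H \<Longrightarrow> f \<one>\<^bsub>G\<^esub> x = x"
    and "\<And>g g' x. g \<in> carrier G \<Longrightarrow> g' \<in> carrier G \<Longrightarrow> x \<in> carrier H \<Longrightarrow>
      f (g \<otimes>\<^bsub>G\<^esub> g') x = f g (f g' x)"
  shows "f \<in> hom G (AutoGroup H)"
proof -
  interpret G: group G by fact
  interpret H: group H by fact
  have a: "f g \<in> auto H" if g: "g \<in> carrier G" for g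
  proof -
    have "f (inv\<^bsub>G\<^esub> g) (f g x) = x" "f g (f (inv\<^bsub>G\<^esub> g) x) = x" if "x \<in> carrier H" for x
      using assms(6)[OF that] assms(7)[of "inv\<^bsub>G\<^esub> g" g x] assms(7)[of g "inv\<^bsub>G\<^esub> g" x] g that by simp_all
    then have "bij_betw (f g) (carrier H) (carrier H)"
      using g assms(4) by (intro bij_betw_byWitness[where f' = "f (inv\<^bsub>G\<^esub> g)"]) auto
    then show ?thesis using assms(3-5) g by (auto simp: auto_iff hom_def)
  qed
  show ?thesis
  proof (rule homI)
    show "f g \<in> carrier (AutoGroup H)" if "g \<in> carrier G" for g using a that by simp
    show "f (g \<otimes>\<^bsub>G\<^esub> g') = f g \<otimes>\<^bsub>AutoGroup H\<^esub> f g'" if g: "g \<in> carrier G" "g' \<in> carrier G" for g g'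
    proof (rule auto_ext)
      show "f (g \<otimes>\<^bsub>G\<^esub> g') \<in> auto H" "f g \<otimes>\<^bsub>AutoGroup H\<^esub> f g' \<in> auto H"
        using a g by (simp_all add: H.mult_AutoGroup_in)
    qed (simp add: assms(7) g mult_AutoGroup_apply a)
  qed
qed

context rrb_ab_ext
begin

lemma section_decomp:
  assumes s: "sections A E sH sG"
  shows "h \<in> cH \<Longrightarrow> \<exists>k\<in>cK. h = sH (\<p> h) *\<^sub>H \<iota> k" "g \<in> cG \<Longrightarrow> \<exists>l\<in>cL. g = sG (\<q> g) *\<^sub>G \<j> l"
  using sectionsD[OF s] by (auto intro!: same_proj)

lemma section_cases:
  assumes "sections A E sH sG" "h \<in> cH"
  obtains a k where "a \<in> cA" "k \<in> cK" "h = sH a *\<^sub>H \<iota> k"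
  using section_decomp(1)[OF assms] assms(2) proj_simps(1) by blast

lemma section_cases2:
  assumes "sections A E sH sG" "g \<in> cG"
  obtains b l where "b \<in> cB" "l \<in> cL" "g = sG b *\<^sub>G \<j> l"
  using section_decomp(2)[OF assms] assms(2) proj_simps(2) by blast

lemma section_image:
  assumes s: "sections A E sH sG"
  shows "(\<lambda>(a, k). sH a *\<^sub>H \<iota> k) ` (cA \<times> cK) = cH" "(\<lambda>(b, l). sG b *\<^sub>G \<j> l) ` (cB \<times> cL) = cG"
  using sectionsD[OF s] by (auto elim: section_cases[OF s] section_cases2[OF s] intro: rev_image_eqI)

lemma section_inj:
  assumes s: "sections A E sH sG"
  shows "inj_on (\<lambda>(a, k). sH a *\<^sub>H \<iota> k) (cA \<times> cK)" "inj_on (\<lambda>(b, l). sG b *\<^sub>G \<j> l) (cB \<times> cL)"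
proof -
  note [simp] = sectionsD[OF s]
  have "a = a'" if "a \<in> cA" "a' \<in> cA" "k \<in> cK" "k' \<in> cK" "sH a *\<^sub>H \<iota> k = sH a' *\<^sub>H \<iota> k'" for a a' k k'
    using arg_cong[OF that(5), of \<p>] that(1-4) by simp
  then show "inj_on (\<lambda>(a, k). sH a *\<^sub>H \<iota> k) (cA \<times> cK)" by (fastforce simp: inj_on_def)
  have "b = b'" if "b \<in> cB" "b' \<in> cB" "l \<in> cL" "l' \<in> cL" "sG b *\<^sub>G \<j> l = sG b' *\<^sub>G \<j> l'" for b b' l l'
    using arg_cong[OF that(5), of \<q>] that(1-4) by simp
  then show "inj_on (\<lambda>(b, l). sG b *\<^sub>G \<j> l) (cB \<times> cL)" by (fastforce simp: inj_on_def)
qed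

text \<open>The crossed-product formulas. In the coordinates (a, k) and (b, l) every operation of
  the middle term is determined by the cocycle and the coefficient data, so extensions with equal
  cocycles have the same operations.\<close>

lemma section_ops:
  assumes s: "sections A E sH sG" and c_def: "coc sH sG = (t1, t2, r, x)"
  shows "a \<in> cA \<Longrightarrow> a' \<in> cA \<Longrightarrow> k \<in> cK \<Longrightarrow> k' \<in> cK \<Longrightarrow>
      (sH a *\<^sub>H \<iota> k) *\<^sub>H (sH a' *\<^sub>H \<iota> k') = sH (a *\<^sub>A a') *\<^sub>H \<iota> (t1 (a, a') *\<^sub>K \<mu> a' k *\<^sub>K k')"
    "b \<in> cB \<Longrightarrow> b' \<in> cB \<Longrightarrow> l \<in> cL \<Longrightarrow> l' \<in> cL \<Longrightarrow>
      (sG b *\<^sub>G \<j> l) *\<^sub>G (sG b' *\<^sub>G \<j> l') = sG (b *\<^sub>B b') *\<^sub>G \<j> (t2 (b, b') *\<^sub>L \<sigma> b' l *\<^sub>L l')"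
    "a \<in> cA \<Longrightarrow> b \<in> cB \<Longrightarrow> k \<in> cK \<Longrightarrow> l \<in> cL \<Longrightarrow>
      \<phi> (sG b *\<^sub>G \<j> l) (sH a *\<^sub>H \<iota> k) = sH (\<beta> b a) *\<^sub>H \<iota> (r (a, b) *\<^sub>K \<nu> b (\<f> l a) *\<^sub>K \<nu> b k)"
    "a \<in> cA \<Longrightarrow> k \<in> cK \<Longrightarrow> R (sH a *\<^sub>H \<iota> k) = sG (T a) *\<^sub>G \<j> (x a *\<^sub>L S (\<nu>' (T a) k))"
proof -
  have c: "(t1, t2, r, x) \<in> cP"
    using ext_cocycle_closed[OF s] by (simp add: c_def)
  have c': "realizes sH sG (t1, t2, r, x)"
    using ext_cocycle_eq_iff[OF s c] by (simp add: c_def)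
  note [simp] = sectionsD[OF s] cochain_closed[OF c]
  note norm = realizesD[OF c'] section_simps[OF s] mult_inc_inc
  show "(sH a *\<^sub>H \<iota> k) *\<^sub>H (sH a' *\<^sub>H \<iota> k') = sH (a *\<^sub>A a') *\<^sub>H \<iota> (t1 (a, a') *\<^sub>K \<mu> a' k *\<^sub>K k')"
    if "a \<in> cA" "a' \<in> cA" "k \<in> cK" "k' \<in> cK" using that by (simp add: norm del: inc_simps(3))
  show "(sG b *\<^sub>G \<j> l) *\<^sub>G (sG b' *\<^sub>G \<j> l') = sG (b *\<^sub>B b') *\<^sub>G \<j> (t2 (b, b') *\<^sub>L \<sigma> b' l *\<^sub>L l')"
    if "b \<in> cB" "b' \<in> cB" "l \<in> cL" "l' \<in> cL" using that by (simp add: norm del: inc_simps(4))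
  show "\<phi> (sG b *\<^sub>G \<j> l) (sH a *\<^sub>H \<iota> k) = sH (\<beta> b a) *\<^sub>H \<iota> (r (a, b) *\<^sub>K \<nu> b (\<f> l a) *\<^sub>K \<nu> b k)"
    if "a \<in> cA" "b \<in> cB" "k \<in> cK" "l \<in> cL" using that by (simp add: norm del: inc_simps(3))
  show "R (sH a *\<^sub>H \<iota> k) = sG (T a) *\<^sub>G \<j> (x a *\<^sub>L S (\<nu>' (T a) k))"
    if "a \<in> cA" "k \<in> cK" using that by (simp add: norm del: inc_simps(4))
qed

text \<open>Sections of E composed with the equivalence are sections of F, and applying the
  equivalence to the product equations of E yields those of F with the same kernel elements.\<close>

lemma ext_equiv_imp_same_cocycle:
  assumes F: "rrb_ab_ext A K D F" and eq: "ext_equiv A K E F" and s: "sections A E sH sG"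
  obtains sH' sG' where "sections A F sH' sG'" "ext_cocycle A K F sH' sG' = coc sH sG"
proof -
  interpret F: rrb_ab_ext A K D F by (rule F)
  obtain \<psi> \<eta> where iso: "rrb_iso (middle E) (middle F) (\<psi>, \<eta>)"
    and K: "\<And>k. k \<in> cK \<Longrightarrow> \<psi> (\<iota> k) = inc1 F k" and L: "\<And>l. l \<in> cL \<Longrightarrow> \<eta> (\<j> l) = inc2 F l"
    and P: "\<And>h. h \<in> cH \<Longrightarrow> proj1 F (\<psi> h) = \<p> h" and Q: "\<And>g. g \<in> cG \<Longrightarrow> proj2 F (\<eta> g) = \<q> g"
    using eq unfolding ext_equiv_def by blast
  have h: "group_hom gH (grpH (middle F)) \<psi>" "group_hom gG (grpG (middle F)) \<eta>"
    using iso by (unfold_locales; simp add: rrb_iso_def rrb_hom_def)+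
  have R: "\<And>h. h \<in> cH \<Longrightarrow> \<eta> (R h) = rbop (middle F) (\<psi> h)"
    and act: "\<And>g h. g \<in> cG \<Longrightarrow> h \<in> cH \<Longrightarrow> \<psi> (\<phi> g h) = act (middle F) (\<eta> g) (\<psi> h)"
    using iso by (auto simp: rrb_iso_def rrb_hom_def)
  note hs [simp] = h[THEN group_hom.hom_closed] h[THEN group_hom.hom_mult] h[THEN group_hom.hom_one]
  note [simp] = sectionsD[OF s]
  let ?H = "\<lambda>a. \<psi> (sH a)" and ?G = "\<lambda>b. \<eta> (sG b)"
  have s': "sections A F ?H ?G"
    by (auto simp: sections_def P Q)
  obtain t1 t2 r x where c_def: "coc sH sG = (t1, t2, r, x)" and c: "(t1, t2, r, x) \<in> cP"
    and c': "realizes sH sG (t1, t2, r, x)" by (rule ext_cocycle_cases[OF s])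
  note [simp] = cochain_closed[OF c]
  note e = realizesD[OF c']
  have "F.realizes ?H ?G (t1, t2, r, x)"
    unfolding F.realizes_def prod.case
  proof (intro conjI ballI, goal_cases)
    case (1 a1 a2) with arg_cong[OF e(1)[OF 1], of \<psi>] show ?case by (simp add: K)
  next
    case (2 b1 b2) with arg_cong[OF e(2)[OF 2], of \<eta>] show ?case by (simp add: L)
  next
    case (3 a b) with arg_cong[OF e(3)[OF 3], of \<psi>] show ?case by (simp add: K act)
  next
    case (4 a) with arg_cong[OF e(4)[OF 4], of \<eta>] show ?case by (simp add: L R)
  qed
  then have "ext_cocycle A K F ?H ?G = coc sH sG"
    using F.ext_cocycle_eq_iff[OF s' c] by (simp add: c_def)
  with s' show thesis by (rule that)
qed

text \<open>Elements with equal coordinates are matched. Since \<open>section_ops\<close> gives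
  identical formulas on both sides, this matching respects all operations.\<close>

lemma same_cocycle_imp_ext_equiv:
  assumes F: "rrb_ab_ext A K D F" and s: "sections A E sH sG" and s': "sections A F sH' sG'"
    and eq: "ext_cocycle A K F sH' sG' = coc sH sG"
  shows "ext_equiv A K E F"
proof -
  interpret F: rrb_ab_ext A K D F by (rule F)
  obtain t1 t2 r x where c_def: "coc sH sG = (t1, t2, r, x)" and c: "(t1, t2, r, x) \<in> cP"
    and c': "realizes sH sG (t1, t2, r, x)" by (rule ext_cocycle_cases[OF s])
  note [simp] = cochain_closed[OF c] sectionsD[OF s] F.sectionsD[OF s']
  note opE = section_ops[OF s c_def] and opF = F.section_ops[OF s' eq[unfolded c_def]]
  \<comment> \<open>The kernel coordinate of \<open>h\<close> is read off against the section of E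
    and attached to the corresponding section value of F.\<close>
  define \<psi> where "\<psi> h = sH' (\<p> h) \<otimes>\<^bsub>grpH (middle F)\<^esub> inc1 F (backK K E (inv\<^sub>H (sH (\<p> h)) *\<^sub>H h))" for h
  define \<eta> where "\<eta> g = sG' (\<q> g) \<otimes>\<^bsub>grpG (middle F)\<^esub> inc2 F (backL K E (inv\<^sub>G (sG (\<q> g)) *\<^sub>G g))" for g
  have psi: "\<psi> (sH a *\<^sub>H \<iota> k) = sH' a \<otimes>\<^bsub>grpH (middle F)\<^esub> inc1 F k" if "a \<in> cA" "k \<in> cK" for a k
    using that by (simp add: \<psi>_def E.H.m_assoc[symmetric])
  have eta: "\<eta> (sG b *\<^sub>G \<j> l) = sG' b \<otimes>\<^bsub>grpG (middle F)\<^esub> inc2 F l" if "b \<in> cB" "l \<in> cL" for b l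
    using that by (simp add: \<eta>_def E.G.m_assoc[symmetric])
  note caseH = section_cases[OF s] and caseG = section_cases2[OF s]
  have psi_hom: "\<psi> \<in> hom gH (grpH (middle F))"
  proof (rule homI)
    show "\<psi> h \<in> F.cH" if "h \<in> cH" for h using that by (rule caseH) (simp add: psi)
    show "\<psi> (h *\<^sub>H h') = \<psi> h \<otimes>\<^bsub>grpH (middle F)\<^esub> \<psi> h'" if "h \<in> cH" "h' \<in> cH" for h h'
      using that(1)
      by (rule caseH) (use that(2) in \<open>rule caseH, simp add: psi opE opF del: inc_simps F.inc_simps\<close>)
  qed
  have eta_hom: "\<eta> \<in> hom gG (grpG (middle F))"
  proof (rule homI)
    show "\<eta> h \<in> F.cG" if "h \<in> cG" for h using that by (rule caseG) (simp add: eta)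
    show "\<eta> (h *\<^sub>G h') = \<eta> h \<otimes>\<^bsub>grpG (middle F)\<^esub> \<eta> h'" if "h \<in> cG" "h' \<in> cG" for h h'
      using that(1)
      by (rule caseG) (use that(2) in \<open>rule caseG, simp add: eta opE opF del: inc_simps F.inc_simps\<close>)
  qed
  have P: "proj1 F (\<psi> h) = \<p> h" if "h \<in> cH" for h using that by (rule caseH) (simp add: psi)
  have Q: "proj2 F (\<eta> h) = \<q> h" if "h \<in> cG" for h using that by (rule caseG) (simp add: eta)
  have psi_bij: "bij_betw \<psi> cH F.cH"
    unfolding section_image[OF s, symmetric] F.section_image[OF s', symmetric]
    by (rule bij_betw_images[OF F.section_inj(1)[OF s']]) (auto simp: psi)
  have eta_bij: "bij_betw \<eta> cG F.cG"
    unfolding section_image[OF s, symmetric] F.section_image[OF s', symmetric]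
    by (rule bij_betw_images[OF F.section_inj(2)[OF s']]) (auto simp: eta)
  have R: "\<eta> (R h) = rbop (middle F) (\<psi> h)" if "h \<in> cH" for h
    using that by (rule caseH) (simp add: psi eta opE opF del: inc_simps F.inc_simps R_mult_inc F.R_mult_inc)
  have act: "\<psi> (\<phi> g h) = act (middle F) (\<eta> g) (\<psi> h)" if "g \<in> cG" "h \<in> cH" for g h
    using that(1)
    by (rule caseG) (use that(2) in \<open>rule caseH, simp add: psi eta opE opF
      del: inc_simps F.inc_simps E.act_act F.E.act_act E.act_mult F.E.act_mult\<close>)
  have "rrb_iso (middle E) (middle F) (\<psi>, \<eta>)"
    using psi_hom eta_hom psi_bij eta_bij R act by (auto simp: rrb_iso_def rrb_hom_def iso_def)
  moreover have "\<psi> (\<iota> k) = inc1 F k" if "k \<in> cK" for k using psi[of eA k] that by simp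
  moreover have "\<eta> (\<j> l) = inc2 F l" if "l \<in> cL" for l using eta[of eB l] that by simp
  ultimately show ?thesis unfolding ext_equiv_def using P Q by blast
qed

text \<open>If the cocycles are merely cohomologous, a change of the sections of E makes them equal,
  and the preceding lemma applies.\<close>

lemma ext_equiv_iff:
  assumes F: "rrb_ab_ext A K D F" and s: "sections A E sH sG" and s': "sections A F sH' sG'"
  shows "ext_equiv A K E F \<longleftrightarrow> \<lbrakk>coc sH sG\<rbrakk> = \<lbrakk>ext_cocycle A K F sH' sG'\<rbrakk>"
proof -
  interpret F: rrb_ab_ext A K D F by (rule F)
  show ?thesis
  proof
    assume "ext_equiv A K E F"
    then obtain tH tG where t: "sections A F tH tG" "ext_cocycle A K F tH tG = coc sH sG"
      using ext_equiv_imp_same_cocycle[OF F _ s] by blast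
    then show "\<lbrakk>coc sH sG\<rbrakk> = \<lbrakk>ext_cocycle A K F sH' sG'\<rbrakk>"
      using F.coset_ext_cocycle[OF s' t(1)] by simp
  next
    assume "\<lbrakk>coc sH sG\<rbrakk> = \<lbrakk>ext_cocycle A K F sH' sG'\<rbrakk>"
    then obtain b where b: "b \<in> B2"
      "ext_cocycle A K F sH' sG' = b \<otimes>\<^bsub>Z2_RRB A K D\<^esub> coc sH sG"
      using coset_eq_iff[OF F.ext_cocycle_Z2[OF s'] ext_cocycle_Z2[OF s]] by auto
    then obtain \<kappa>1 \<kappa>2 where k: "\<kappa>1 \<in> cA \<rightarrow> cK" "\<kappa>2 \<in> cB \<rightarrow> cL" "\<kappa>1 eA = eK" "\<kappa>2 eB = eL"
      "b = coboundary \<kappa>1 \<kappa>2" unfolding mem_B2 by blast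
    note t = sections_change[OF s k(1-4)]
    have "ext_cocycle A K F sH' sG' = coc (\<lambda>a. sH a *\<^sub>H \<iota> (\<kappa>1 a)) (\<lambda>b. sG b *\<^sub>G \<j> (\<kappa>2 b))"
      using b(2) CP.m_comm[OF ext_cocycle_closed[OF s] coboundary_closed[OF k(1,2)]]
      by (simp add: ext_cocycle_change[OF s t k(1,2) refl refl] k(5))
    then show "ext_equiv A K E F" by (rule same_cocycle_imp_ext_equiv[OF F t s'])
  qed
qed

text \<open>The translated extension lives on the carriers of \<open>E\<close>, which avoids transporting the usual
  crossed product on \<open>A \<times> K\<close> to the types of the middle groups.\<close>

definition translate :: "('a, 'b, 'k, 'l) cochain2 \<Rightarrow> ('a, 'b, 'k, 'l, 'h, 'g) rrb_extn" where
  "translate = (\<lambda>(t1, t2, r, x). E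
    \<lparr>middle := \<lparr>
      grpH = \<lparr>carrier = cH, monoid.mult = \<lambda>h h'. h *\<^sub>H h' *\<^sub>H \<iota> (t1 (\<p> h, \<p> h')), one = eH\<rparr>,
      grpG = \<lparr>carrier = cG, monoid.mult = \<lambda>g g'. g *\<^sub>G g' *\<^sub>G \<j> (t2 (\<q> g, \<q> g')), one = eG\<rparr>,
      act = \<lambda>g. \<lambda>h\<in>cH. \<phi> g h *\<^sub>H \<iota> (r (\<p> h, \<q> g)),
      rbop = \<lambda>h. R h *\<^sub>G \<j> (x (\<p> h))\<rparr>\<rparr>)"

text \<open>The dictionary read backwards: each cocycle identity of \<open>z\<close> is what the
  corresponding law of the modified operations demands after the law of E has been used.
  Normalisation keeps the units and the embedded kernel as they were.\<close>

lemma translate_ext: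
  assumes z: "z \<in> cZ2"
  shows "rrb_ab_ext A K D (translate z)"
proof -
  obtain t1 t2 r x where z_def: "z = (t1, t2, r, x)" by (cases z)
  note z' = z[unfolded z_def]
  note [simp] = cochain_closed[OF Z2_carrier[OF z']] Z2D[OF z']
  note e = Z2_eqs[OF z']
  define H' where "H' = grpH (middle (translate z))"
  define G' where "G' = grpG (middle (translate z))"
  have H' [simp]: "carrier H' = cH" "h \<otimes>\<^bsub>H'\<^esub> h' = h *\<^sub>H h' *\<^sub>H \<iota> (t1 (\<p> h, \<p> h'))" "\<one>\<^bsub>H'\<^esub> = eH" for h h'
    by (simp_all add: H'_def translate_def z_def)
  have G' [simp]: "carrier G' = cG" "g \<otimes>\<^bsub>G'\<^esub> g' = g *\<^sub>G g' *\<^sub>G \<j> (t2 (\<q> g, \<q> g'))" "\<one>\<^bsub>G'\<^esub> = eG" for g g'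
    by (simp_all add: G'_def translate_def z_def)
  define f where "f = act (middle (translate z))"
  define R' where "R' = rbop (middle (translate z))"
  have f: "f g h = \<phi> g h *\<^sub>H \<iota> (r (\<p> h, \<q> g))" if "h \<in> cH" for g h
    using that by (simp add: f_def translate_def z_def)
  have R': "R' h = R h *\<^sub>G \<j> (x (\<p> h))" for h
    by (simp add: R'_def translate_def z_def)
  have same: "inc1 (translate z) = \<iota>" "inc2 (translate z) = \<j>" "proj1 (translate z) = \<p>" "proj2 (translate z) = \<q>"
    by (simp_all add: translate_def z_def)
  have grpH': "group H'"
  proof (rule groupI)
    fix h1 h2 h3 assume "h1 \<in> carrier H'" "h2 \<in> carrier H'" "h3 \<in> carrier H'"
    then have h: "h1 \<in> cH" "h2 \<in> cH" "h3 \<in> cH" by simp_all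
    then have "t1 (\<p> h1 *\<^sub>A \<p> h2, \<p> h3) *\<^sub>K \<mu> (\<p> h3) (t1 (\<p> h1, \<p> h2)) =
        t1 (\<p> h2, \<p> h3) *\<^sub>K t1 (\<p> h1, \<p> h2 *\<^sub>A \<p> h3)"
      using e(1)[of "\<p> h1" "\<p> h2" "\<p> h3"] by simp
    then show "h1 \<otimes>\<^bsub>H'\<^esub> h2 \<otimes>\<^bsub>H'\<^esub> h3 = h1 \<otimes>\<^bsub>H'\<^esub> (h2 \<otimes>\<^bsub>H'\<^esub> h3)"
      using h by (simp add: mult_inc_mult(1)[of _ h3] E.H.m_assoc[symmetric])
        (simp add: mult_inc_inc KH.m_comm del: inc_simps(3))
  next
    fix h assume "h \<in> carrier H'"
    then have h: "h \<in> cH" by simp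
    \<comment> \<open>The modified product of the old inverse with \<open>h\<close> leaves the
      factor \<open>t1\<close> at their projections. The correction \<open>k\<close> is placed to
      the left of the old inverse, where it meets that factor without being transformed by
      \<mu>.\<close>
    define k where "k = inv\<^sub>K (t1 (inv\<^bsub>grpH A\<^esub> \<p> h, \<p> h))"
    have k: "k \<in> cK" "k *\<^sub>K t1 (inv\<^bsub>grpH A\<^esub> \<p> h, \<p> h) = eK" using h by (simp_all add: k_def)
    have "\<iota> k *\<^sub>H inv\<^sub>H h \<in> carrier H'" using h k by simp
    moreover have "(\<iota> k *\<^sub>H inv\<^sub>H h) \<otimes>\<^bsub>H'\<^esub> h = \<one>\<^bsub>H'\<^esub>"
      using h k by (simp add: E.H.m_assoc flip: inc_simps(3))
    ultimately show "\<exists>y\<in>carrier H'. y \<otimes>\<^bsub>H'\<^esub> h = \<one>\<^bsub>H'\<^esub>" by blast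
  qed simp_all
  have grpG': "group G'"
  proof (rule groupI)
    fix h1 h2 h3 assume "h1 \<in> carrier G'" "h2 \<in> carrier G'" "h3 \<in> carrier G'"
    then have h: "h1 \<in> cG" "h2 \<in> cG" "h3 \<in> cG" by simp_all
    then have "t2 (\<q> h1 *\<^sub>B \<q> h2, \<q> h3) *\<^sub>L \<sigma> (\<q> h3) (t2 (\<q> h1, \<q> h2)) =
        t2 (\<q> h2, \<q> h3) *\<^sub>L t2 (\<q> h1, \<q> h2 *\<^sub>B \<q> h3)"
      using e(2)[of "\<q> h1" "\<q> h2" "\<q> h3"] by simp
    then show "h1 \<otimes>\<^bsub>G'\<^esub> h2 \<otimes>\<^bsub>G'\<^esub> h3 = h1 \<otimes>\<^bsub>G'\<^esub> (h2 \<otimes>\<^bsub>G'\<^esub> h3)"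
      using h by (simp add: mult_inc_mult(2)[of _ h3] E.G.m_assoc[symmetric])
        (simp add: mult_inc_inc KL.m_comm del: inc_simps(4))
  next
    fix h assume "h \<in> carrier G'"
    then have h: "h \<in> cG" by simp
    define k where "k = inv\<^sub>L (t2 (inv\<^bsub>grpG A\<^esub> \<q> h, \<q> h))"
    have k: "k \<in> cL" "k *\<^sub>L t2 (inv\<^bsub>grpG A\<^esub> \<q> h, \<q> h) = eL" using h by (simp_all add: k_def)
    have "\<j> k *\<^sub>G inv\<^sub>G h \<in> carrier G'" using h k by simp
    moreover have "(\<j> k *\<^sub>G inv\<^sub>G h) \<otimes>\<^bsub>G'\<^esub> h = \<one>\<^bsub>G'\<^esub>"
      using h k by (simp add: E.G.m_assoc flip: inc_simps(4))
    ultimately show "\<exists>y\<in>carrier G'. y \<otimes>\<^bsub>G'\<^esub> h = \<one>\<^bsub>G'\<^esub>" by blast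
  qed simp_all
  have f_closed [simp]: "f g h \<in> cH" if "g \<in> cG" "h \<in> cH" for g h
    using that by (simp add: f)
  have R'_closed [simp]: "R' h \<in> cG" if "h \<in> cH" for h using that by (simp add: R')
  have f_hom: "f \<in> hom G' (AutoGroup H')"
  proof (rule act_homI[OF grpG' grpH'])
    show "f g \<in> extensional (carrier H')" for g
      by (simp add: f_def translate_def z_def)
    show "f g x \<in> carrier H'" if "g \<in> carrier G'" "x \<in> carrier H'" for g x using that by simp
    show "f \<one>\<^bsub>G'\<^esub> h = h" if "h \<in> carrier H'" for h using that by (simp add: f)
  next
    fix g h1 h2 assume "g \<in> carrier G'" "h1 \<in> carrier H'" "h2 \<in> carrier H'"
    then have h: "g \<in> cG" "h1 \<in> cH" "h2 \<in> cH" by simp_all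
    then show "f g (h1 \<otimes>\<^bsub>H'\<^esub> h2) = f g h1 \<otimes>\<^bsub>H'\<^esub> f g h2"
      using e(4)[of "\<p> h1" "\<p> h2" "\<q> g"]
      by (simp add: f act_inc1 mult_inc_mult(1)[of _ "\<phi> g h2"] E.H.m_assoc[symmetric])
        (simp add: mult_inc_inc KH.m_ac del: inc_simps(3))
  next
    fix g1 g2 h assume "g1 \<in> carrier G'" "g2 \<in> carrier G'" "h \<in> carrier H'"
    then have h: "g1 \<in> cG" "g2 \<in> cG" "h \<in> cH" by simp_all
    \<comment> \<open>The extra factor of the new product in G acts through \<open>\<f>\<close>;
      this is the origin of the \<open>\<f>\<close>-term in the third cocycle identity.\<close>
    have 1: "\<phi> (g1 *\<^sub>G g2 *\<^sub>G \<j> (t2 (\<q> g1, \<q> g2))) h = \<phi> g1 (\<phi> g2 h) *\<^sub>H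
        \<iota> (\<nu> (\<q> g1 *\<^sub>B \<q> g2) (\<f> (t2 (\<q> g1, \<q> g2)) (\<p> h)))"
      using h act_mult_inc[of "g1 *\<^sub>G g2" "t2 (\<q> g1, \<q> g2)" h] by (simp del: E.act_act add: E.act_act[of g1 g2])
    show "f (g1 \<otimes>\<^bsub>G'\<^esub> g2) h = f g1 (f g2 h)"
      using h e(3)[of "\<p> h" "\<q> g1" "\<q> g2"]
      by (simp add: f 1 act_inc1 del: E.act_act) (simp add: mult_inc_inc KH.m_ac del: inc_simps(3))
  qed
  have rb: "R' h1 \<otimes>\<^bsub>G'\<^esub> R' h2 = R' (h1 \<otimes>\<^bsub>H'\<^esub> f (R' h1) h2)" if h: "h1 \<in> cH" "h2 \<in> cH" for h1 h2
  proof -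
    let ?c = "\<p> h1 *\<^sub>A \<beta> (T (\<p> h1)) (\<p> h2)"
    have c: "?c \<in> cA" using h by simp
    \<comment> \<open>Both sides become \<open>R h1 *\<^sub>G R h2\<close> times a kernel element,
      by the Rota--Baxter identity of E. Equality of the two kernel elements is then the last
      cocycle identity for \<open>z\<close>.\<close>
    have l: "R' h1 \<otimes>\<^bsub>G'\<^esub> R' h2 = R h1 *\<^sub>G R h2 *\<^sub>G
        \<j> (\<sigma> (T (\<p> h2)) (x (\<p> h1)) *\<^sub>L x (\<p> h2) *\<^sub>L t2 (T (\<p> h1), T (\<p> h2)))"
      using h by (simp add: R' mult_inc_mult(2)[of _ "R h2"] E.G.m_assoc[symmetric])
    have "f (R' h1) h2 = \<phi> (R h1) h2 *\<^sub>H \<iota> (\<nu> (T (\<p> h1)) (\<f> (x (\<p> h1)) (\<p> h2)) *\<^sub>K r (\<p> h2, T (\<p> h1)))"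
      using h by (simp add: f R' act_mult_inc mult_inc_inc del: E.act_act inc_simps(3))
    then have "h1 \<otimes>\<^bsub>H'\<^esub> f (R' h1) h2 = h1 *\<^sub>H \<phi> (R h1) h2 *\<^sub>H
        \<iota> (\<nu> (T (\<p> h1)) (\<f> (x (\<p> h1)) (\<p> h2)) *\<^sub>K r (\<p> h2, T (\<p> h1)) *\<^sub>K t1 (\<p> h1, \<beta> (T (\<p> h1)) (\<p> h2)))"
      using h by (simp add: E.H.m_assoc[symmetric])
    then have "R' (h1 \<otimes>\<^bsub>H'\<^esub> f (R' h1) h2) = R h1 *\<^sub>G R h2 *\<^sub>G \<j> (S (\<nu>' (T ?c)
        (\<nu> (T (\<p> h1)) (\<f> (x (\<p> h1)) (\<p> h2)) *\<^sub>K r (\<p> h2, T (\<p> h1)) *\<^sub>K t1 (\<p> h1, \<beta> (T (\<p> h1)) (\<p> h2))))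
        *\<^sub>L x ?c)"
      using h by (simp add: R' E.rb_mult mult_inc_inc del: inc_simps(3,4) H'(2))
    also have "S (\<nu>' (T ?c)
        (\<nu> (T (\<p> h1)) (\<f> (x (\<p> h1)) (\<p> h2)) *\<^sub>K r (\<p> h2, T (\<p> h1)) *\<^sub>K t1 (\<p> h1, \<beta> (T (\<p> h1)) (\<p> h2)))) =
      t2 (T (\<p> h1), T (\<p> h2)) *\<^sub>L x (\<p> h2) *\<^sub>L inv\<^sub>L (x ?c) *\<^sub>L \<sigma> (T (\<p> h2)) (x (\<p> h1))"
      using h e(5)[of "\<p> h1" "\<p> h2"] by (simp add: KH.m_ac KL.m_ac del: S_mult nu_inv_mult)
    also have "\<dots> *\<^sub>L x ?c = \<sigma> (T (\<p> h2)) (x (\<p> h1)) *\<^sub>L x (\<p> h2) *\<^sub>L t2 (T (\<p> h1), T (\<p> h2))"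
      using h c KL.mult_cancel_inv[of "x ?c" "t2 (T (\<p> h1), T (\<p> h2))" "x (\<p> h2) *\<^sub>L \<sigma> (T (\<p> h2)) (x (\<p> h1))"]
      by (simp add: KL.m_ac)
    finally show ?thesis by (simp only: l)
  qed
  have Gr: "rrb_group (middle (translate z))"
    unfolding rrb_group_def f_def[symmetric] R'_def[symmetric] H'_def[symmetric] G'_def[symmetric]
    using grpH' grpG' f_hom rb by (auto simp del: H'(2) G'(2))
  have ker: "\<p> h = eA \<longleftrightarrow> h \<in> \<iota> ` cK" "\<q> g = eB \<longleftrightarrow> g \<in> \<j> ` cL" if "h \<in> cH" "g \<in> cG" for h g
    using that kernel_inc by auto
  have ext': "rrb_extension A K (translate z)"
    unfolding rrb_extension_def rrb_hom_def same prod.case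
      f_def[symmetric] R'_def[symmetric] H'_def[symmetric] G'_def[symmetric]
  proof (intro conjI ballI A.rrb K.rrb Gr)
    show "\<iota> \<in> hom (grpH K) H'" "\<j> \<in> hom (grpG K) G'" by (auto intro!: homI)
    show "\<p> \<in> hom H' (grpH A)" "\<q> \<in> hom G' (grpG A)" by (auto intro!: homI)
    show "\<j> (S k) = R' (\<iota> k)" if "k \<in> cK" for k using that by (simp add: R')
    show "\<iota> (act K l k) = f (\<j> l) (\<iota> k)" if "l \<in> cL" "k \<in> cK" for l k using that by (simp add: f)
    show "\<q> (R' h) = T (\<p> h)" if "h \<in> carrier H'" for h using that by (simp add: R')
    show "\<p> (f g h) = \<beta> (\<q> g) (\<p> h)" if "h \<in> carrier H'" "g \<in> carrier G'" for g h using that by (simp add: f)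
    show "inj_on \<iota> cK" "inj_on \<j> cL" by (auto intro!: inj_onI)
    show "\<p> ` carrier H' = cA" "\<q> ` carrier G' = cB" using proj_surj by (auto simp: image_iff)
    show "\<iota> ` cK = kernel H' (grpH A) \<p>" "\<j> ` cL = kernel G' (grpG A) \<q>"
      using kernel_inc by (auto simp: kernel_def)
  qed
  \<comment> \<open>A component of \<open>z\<close> is trivial as soon as one argument is the
    identity, hence whenever a kernel element takes part. So the four laws of the associated action
    are literally those of E.\<close>
  show ?thesis
    by unfold_locales (unfold same f_def[symmetric] R'_def[symmetric] H'_def[symmetric] G'_def[symmetric],
      use ext' in \<open>auto simp: f inc1_mult inc2_mult act_inc1 inc2_act\<close>)
qed

text \<open>The old sections remain sections, and every product equation picks up exactly one value
  of \<open>z\<close> as an additional kernel factor.\<close>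

lemma translate_cocycle:
  assumes z: "z \<in> cZ2" and s: "sections A E sH sG"
  shows "sections A (translate z) sH sG"
    and "ext_cocycle A K (translate z) sH sG = coc sH sG *\<^sub>P z"
proof -
  interpret F: rrb_ab_ext A K D "translate z" by (rule translate_ext[OF z])
  obtain t1 t2 r x where z_def: "z = (t1, t2, r, x)" by (cases z)
  note z' = z[unfolded z_def]
  note [simp] = cochain_closed[OF Z2_carrier[OF z']] Z2D[OF z'] sectionsD[OF s]
  show s': "sections A (translate z) sH sG"
    using s by (simp add: sections_def translate_def z_def)
  obtain t1' t2' r' x' where c_def: "coc sH sG = (t1', t2', r', x')" and c: "(t1', t2', r', x') \<in> cP"
    and c': "realizes sH sG (t1', t2', r', x')" by (rule ext_cocycle_cases[OF s])
  note [simp] = cochain_closed[OF c]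
  note e = realizesD[OF c']
  have cl: "(t1', t2', r', x') *\<^sub>P z \<in> cP"
    using c Z2_carrier[OF z] by simp
  have "F.realizes sH sG ((t1', t2', r', x') *\<^sub>P z)"
    unfolding F.realizes_def
    unfolding z_def mult_cochain_prod prod.case
    by (intro conjI ballI; simp add: translate_def e E.H.m_assoc E.G.m_assoc)
  then show "ext_cocycle A K (translate z) sH sG = coc sH sG *\<^sub>P z"
    using F.ext_cocycle_eq_iff[OF s' cl] by (simp add: c_def)
qed

end

section \<open>Classes of extensions and the derivation\<close>

lemma rrb_ab_ext_iff:
  "abelian_extension A K E \<and> associated_action A K E D \<longleftrightarrow> rrb_ab_ext A K D E"
  using rrb_ab_extI rrb_ab_ext.abelian_extension rrb_ab_ext.associated_action by blast

context rrb_coeff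
begin

text \<open>Defined by choice and outside \<open>rrb_ab_ext\<close>, so that a single function
  applies to all extensions with coefficients D. That the choice of sections does not matter is
  \<open>ext_coset_eq\<close>.\<close>

definition ext_coset :: "('a, 'b, 'k, 'l, 'h, 'g) rrb_extn \<Rightarrow> ('a, 'b, 'k, 'l) cochain2 set" where
  "ext_coset E = (SOME y. \<exists>sH sG. sections A E sH sG \<and> y = \<lbrakk>ext_cocycle A K E sH sG\<rbrakk>)"

end

section \<open>Equivalence classes of extensions as cohomology classes\<close>

context rrb_ab_ext
begin

lemma ext_coset_eq:
  assumes s: "sections A E sH sG" shows "ext_coset E = \<lbrakk>coc sH sG\<rbrakk>"
  unfolding ext_coset_def
proof (rule some_equality)
  show "\<exists>tH tG. sections A E tH tG \<and> \<lbrakk>coc sH sG\<rbrakk> = \<lbrakk>coc tH tG\<rbrakk>"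
    using s by blast
qed (use coset_ext_cocycle[OF s] in blast)

lemma ext_coset_closed: "ext_coset E \<in> cH2"
  using sections_exist ext_coset_eq ext_cocycle_Z2 by (force simp: carrier_H2)

lemma ext_equiv_iff_coset:
  assumes F: "rrb_ab_ext A K D F" shows "ext_equiv A K E F \<longleftrightarrow> ext_coset E = ext_coset F"
  using sections_exist rrb_ext_base.sections_exist[OF rrb_ab_ext.axioms(2)[OF F]]
    ext_equiv_iff[OF F] ext_coset_eq rrb_ab_ext.ext_coset_eq[OF F] by metis

text \<open>Exhibits equivalence classes as fibres of \<open>ext_coset\<close>, so that questions
  about them become equations between cohomology classes.\<close>

lemma ext_class_eq: "ext_class A K D E = {F. rrb_ab_ext A K D F \<and> ext_coset F = ext_coset E}"
proof -
  have "F \<in> ext_class A K D E \<longleftrightarrow> (abelian_extension A K E \<and> associated_action A K E D) \<and>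
      (abelian_extension A K F \<and> associated_action A K F D) \<and> ext_equiv A K E F" for F
    by (auto simp: ext_class_def ext_rel_def)
  then show ?thesis
    unfolding rrb_ab_ext_iff using rrb_ab_ext_axioms by (auto simp: ext_equiv_iff_coset)
qed

text \<open>The description in \<open>class_to_H2\<close> has a unique solution because every member
  of the class, with any sections, gives the same coset.\<close>

lemma class_to_H2_eq: "class_to_H2 A K D (ext_class A K D E) = ext_coset E"
  unfolding class_to_H2_def coset_def[symmetric]
proof (rule the_equality)
  obtain sH sG where s: "sections A E sH sG" using sections_exist by blast
  show "\<exists>F\<in>ext_class A K D E. \<exists>sH sG. sections A F sH sG \<and> ext_coset E = \<lbrakk>ext_cocycle A K F sH sG\<rbrakk>"
    using s ext_coset_eq[OF s] rrb_ab_ext_axioms by (auto simp: ext_class_eq)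
next
  fix y assume "\<exists>F\<in>ext_class A K D E. \<exists>sH sG. sections A F sH sG \<and> y = \<lbrakk>ext_cocycle A K F sH sG\<rbrakk>"
  then obtain F :: "('a, 'b, 'k, 'l, 'h, 'g) rrb_extn" and sH sG where "rrb_ab_ext A K D F" "ext_coset F = ext_coset E" "sections A F sH sG"
    "y = \<lbrakk>ext_cocycle A K F sH sG\<rbrakk>" unfolding ext_class_eq by blast
  then show "y = ext_coset E"
    using rrb_ab_ext.ext_coset_eq by metis
qed

lemma ext_class_eq_iff:
  assumes F: "rrb_ab_ext A K D F"
  shows "ext_class A K D E = ext_class A K D F \<longleftrightarrow> ext_coset E = ext_coset F"
  using rrb_ab_ext.class_to_H2_eq[OF F] class_to_H2_eq ext_class_eq rrb_ab_ext.ext_class_eq[OF F] by metis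

lemma mem_Ext: "Y \<in> Ext A K D \<longleftrightarrow> (\<exists>F. rrb_ab_ext A K D F \<and> Y = ext_class A K D F)"
  by (auto simp: Ext_def quotient_def ext_class_def rrb_ab_ext_iff)

lemma ext_coset_translate:
  assumes "z \<in> cZ2"
  shows "ext_coset (translate z) = ext_coset E *\<^sub>2 \<lbrakk>z\<rbrakk>"
proof -
  obtain sH sG where s: "sections A E sH sG" using sections_exist by blast
  note t = translate_cocycle[OF assms s]
  show ?thesis
    using rrb_ab_ext.ext_coset_eq[OF translate_ext[OF assms] t(1)]
    by (simp add: t(2) ext_coset_eq[OF s] mult_H2 ext_cocycle_Z2[OF s] assms)
qed

text \<open>Existence for the description in \<open>ext_translate\<close> is provided by the
  explicit extension \<open>translate z\<close>. Uniqueness holds because a class of extensions is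
  determined by its cohomology class.\<close>

lemma ext_class_translate:
  assumes z: "z \<in> cZ2"
  shows "ext_translate A K D (ext_class A K D E) \<lbrakk>z\<rbrakk> = ext_class A K D (translate z)"
  unfolding ext_translate_def
proof (rule the_equality)
  note t = translate_ext[OF z]
  show "ext_class A K D (translate z) \<in> Ext A K D \<and> class_to_H2 A K D (ext_class A K D (translate z)) =
      class_to_H2 A K D (ext_class A K D E) *\<^sub>2 \<lbrakk>z\<rbrakk>"
    using t by (auto simp: rrb_ab_ext.class_to_H2_eq[OF t] class_to_H2_eq ext_coset_translate[OF z]
        rrb_ab_ext.mem_Ext[OF t])
next
  fix Y :: "('a, 'b, 'k, 'l, 'h, 'g) rrb_extn set"
  assume Y: "Y \<in> Ext A K D \<and> class_to_H2 A K D Y =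
      class_to_H2 A K D (ext_class A K D E) *\<^sub>2 \<lbrakk>z\<rbrakk>"
  then obtain F where F: "rrb_ab_ext A K D F" "Y = ext_class A K D F" by (auto simp: mem_Ext)
  then have "ext_coset F = ext_coset (translate z)"
    using Y rrb_ab_ext.class_to_H2_eq[OF F(1)] by (simp add: class_to_H2_eq ext_coset_translate[OF z])
  then show "Y = ext_class A K D (translate z)"
    using rrb_ab_ext.ext_class_eq_iff[OF F(1) translate_ext[OF z]] F(2) by simp
qed

text \<open>The defining equation of \<omega> becomes an equation in the group
  \<open>H2_RRB\<close>, where it can be solved by division.\<close>

lemma ext_class_eq_translate_iff:
  assumes F: "rrb_ab_ext A K D F" and h: "h \<in> cH2"
  shows "ext_class A K D F = ext_translate A K D (ext_class A K D E) h \<longleftrightarrow>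
    ext_coset F = ext_coset E *\<^sub>2 h"
proof -
  obtain z where z: "z \<in> cZ2" "h = \<lbrakk>z\<rbrakk>" using h by (auto simp: carrier_H2)
  show ?thesis
    unfolding z(2) ext_class_translate[OF z(1)] ext_coset_translate[OF z(1), symmetric]
    by (rule rrb_ab_ext.ext_class_eq_iff[OF F translate_ext[OF z(1)]])
qed

end

section \<open>Twisting an extension by a compatible pair\<close>

locale rrb_ext_compatible = rrb_ab_ext A K D E + rrb_compatible A K D \<psi>1 \<psi>2 \<theta>1 \<theta>2
  for A :: "('a, 'b) rrb" and K :: "('k, 'l) rrb" and D :: "('a, 'b, 'k, 'l) rrb_action"
    and E :: "('a, 'b, 'k, 'l, 'h, 'g) rrb_extn" and \<psi>1 \<psi>2 \<theta>1 \<theta>2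
begin

abbreviation "tw \<equiv> ext_twist A E ((\<psi>1, \<psi>2), (\<theta>1, \<theta>2))"

lemma tw_simps:
  "middle tw = middle E" "inc1 tw = \<iota> \<circ> \<theta>1" "inc2 tw = \<j> \<circ> \<theta>2"
  "proj1 tw = inv_into cA \<psi>1 \<circ> \<p>" "proj2 tw = inv_into cB \<psi>2 \<circ> \<q>"
  by (simp_all add: ext_twist_def)

lemma psi_inv_simps [simp]:
  "inv_into cA \<psi>1 eA = eA" "inv_into cB \<psi>2 eB = eB"
  "a \<in> cA \<Longrightarrow> a' \<in> cA \<Longrightarrow> inv_into cA \<psi>1 (a *\<^sub>A a') = inv_into cA \<psi>1 a *\<^sub>A inv_into cA \<psi>1 a'"
  "b \<in> cB \<Longrightarrow> b' \<in> cB \<Longrightarrow> inv_into cB \<psi>2 (b *\<^sub>B b') = inv_into cB \<psi>2 b *\<^sub>B inv_into cB \<psi>2 b'"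
  "a \<in> cA \<Longrightarrow> inv_into cB \<psi>2 (T a) = T (inv_into cA \<psi>1 a)"
  "a \<in> cA \<Longrightarrow> b \<in> cB \<Longrightarrow> inv_into cA \<psi>1 (\<beta> b a) = \<beta> (inv_into cB \<psi>2 b) (inv_into cA \<psi>1 a)"
proof -
  show "inv_into cA \<psi>1 eA = eA" "inv_into cB \<psi>2 eB = eB"
    by (rule A.H.auto_inv_into_one[OF autos(1)] A.G.auto_inv_into_one[OF autos(2)])+
  show "a \<in> cA \<Longrightarrow> a' \<in> cA \<Longrightarrow> inv_into cA \<psi>1 (a *\<^sub>A a') = inv_into cA \<psi>1 a *\<^sub>A inv_into cA \<psi>1 a'"
    "b \<in> cB \<Longrightarrow> b' \<in> cB \<Longrightarrow> inv_into cB \<psi>2 (b *\<^sub>B b') = inv_into cB \<psi>2 b *\<^sub>B inv_into cB \<psi>2 b'"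
    by (rule A.H.auto_inv_into_mult[OF autos(1)] A.G.auto_inv_into_mult[OF autos(2)]; assumption)+
  show "a \<in> cA \<Longrightarrow> inv_into cB \<psi>2 (T a) = T (inv_into cA \<psi>1 a)"
    by (rule sym, subst auto_inv_into_eq[OF autos(2)]) simp_all
  show "a \<in> cA \<Longrightarrow> b \<in> cB \<Longrightarrow> inv_into cA \<psi>1 (\<beta> b a) = \<beta> (inv_into cB \<psi>2 b) (inv_into cA \<psi>1 a)"
    by (rule sym, subst auto_inv_into_eq[OF autos(1)]) simp_all
qed

lemma psi_inv_one_iff:
  "a \<in> cA \<Longrightarrow> inv_into cA \<psi>1 a = eA \<longleftrightarrow> a = eA" "b \<in> cB \<Longrightarrow> inv_into cB \<psi>2 b = eB \<longleftrightarrow> b = eB"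
  using auto_inv_into_eq[OF autos(1), of eA a] auto_inv_into_eq[OF autos(2), of eB b] by auto

text \<open>The kernel maps are precomposed with automorphisms of K and L, and the projections
  followed by automorphisms of A and B, so exactness persists. The compatibility conditions say
  precisely that the associated action of the twisted extension is again D.\<close>

lemma tw_ext: "rrb_ab_ext A K D tw"
proof -
  have im: "\<theta>1 ` cK = cK" "\<theta>2 ` cL = cL" "inv_into cA \<psi>1 ` cA = cA" "inv_into cB \<psi>2 ` cB = cB"
    using autos bij_betw_inv_into[of \<psi>1 cA cA] bij_betw_inv_into[of \<psi>2 cB cB]
    by (auto simp: auto_iff bij_betw_def)
  have e: "\<p> ` cH = cA" "\<q> ` cG = cB" "\<iota> ` cK = kernel gH (grpH A) \<p>"
    "\<j> ` cL = kernel gG (grpG A) \<q>" "rrb_group (middle E)"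
    using ext by (auto simp: rrb_extension_def)
  have "rrb_extension A K tw"
    unfolding rrb_extension_def rrb_hom_def tw_simps prod.case
  proof (intro conjI ballI A.rrb K.rrb e(5))
    show "\<iota> \<circ> \<theta>1 \<in> hom (grpH K) gH" "\<j> \<circ> \<theta>2 \<in> hom (grpG K) gG"
      by (auto intro!: homI)
    show "inv_into cA \<psi>1 \<circ> \<p> \<in> hom gH (grpH A)"
      "inv_into cB \<psi>2 \<circ> \<q> \<in> hom gG (grpG A)"
      by (auto intro!: homI)
    show "inj_on (\<iota> \<circ> \<theta>1) cK" "inj_on (\<j> \<circ> \<theta>2) cL"
      by (auto intro!: inj_onI simp: theta_inj)
    show "(inv_into cA \<psi>1 \<circ> \<p>) ` cH = cA" "(inv_into cB \<psi>2 \<circ> \<q>) ` cG = cB"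
      by (simp_all only: image_comp[symmetric] e im)
    show "(\<iota> \<circ> \<theta>1) ` cK = kernel gH (grpH A) (inv_into cA \<psi>1 \<circ> \<p>)"
      by (simp only: image_comp[symmetric] e im) (auto simp: kernel_def psi_inv_one_iff)
    show "(\<j> \<circ> \<theta>2) ` cL = kernel gG (grpG A) (inv_into cB \<psi>2 \<circ> \<q>)"
      by (simp only: image_comp[symmetric] e im) (auto simp: kernel_def psi_inv_one_iff)
  qed auto
  then show ?thesis
    by unfold_locales (simp_all add: tw_simps inc1_mult inc2_mult act_inc1 inc2_act)
qed

lemma tw_cocycle:
  assumes s: "sections A E sH sG"
  shows "sections A tw (sH \<circ> \<psi>1) (sG \<circ> \<psi>2)"
    and "ext_cocycle A K tw (sH \<circ> \<psi>1) (sG \<circ> \<psi>2) = twist (coc sH sG)"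
proof -
  interpret F: rrb_ab_ext A K D tw by (rule tw_ext)
  note [simp] = sectionsD[OF s]
  show s': "sections A tw (sH \<circ> \<psi>1) (sG \<circ> \<psi>2)"
    by (auto simp: sections_def tw_simps)
  obtain t1 t2 r x where c_def: "coc sH sG = (t1, t2, r, x)" and c: "(t1, t2, r, x) \<in> cP"
    and c': "realizes sH sG (t1, t2, r, x)" by (rule ext_cocycle_cases[OF s])
  note [simp] = cochain_closed[OF c]
  note e = realizesD[OF c']
  have "F.realizes (sH \<circ> \<psi>1) (sG \<circ> \<psi>2) (twist (t1, t2, r, x))"
    unfolding F.realizes_def cochain_twist_def prod.case
    by (intro conjI ballI; simp add: tw_simps e)
  then show "ext_cocycle A K tw (sH \<circ> \<psi>1) (sG \<circ> \<psi>2) = twist (coc sH sG)"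
    using F.ext_cocycle_eq_iff[OF s' twist_closed[OF c]] by (simp add: c_def)
qed

text \<open>That the twisted coboundary is a cocycle again rests on \<open>B2_eq\<close>, hence on
  the existence of the extension E; this is why the statement belongs to a locale containing
  one.\<close>

lemma twist_B2: "b \<in> B2 \<Longrightarrow> twist b \<in> B2"
  unfolding B2_eq
proof (elim CollectE exE conjE)
  fix \<kappa>1 \<kappa>2 assume b: "b = coboundary \<kappa>1 \<kappa>2" and k: "\<kappa>1 \<in> cA \<rightarrow> cK" "\<kappa>2 \<in> cB \<rightarrow> cL" "\<kappa>1 eA = eK" "\<kappa>2 eB = eL"
  have "(\<lambda>a. \<theta>1' (\<kappa>1 (\<psi>1 a))) \<in> cA \<rightarrow> cK" "(\<lambda>b. \<theta>2' (\<kappa>2 (\<psi>2 b))) \<in> cB \<rightarrow> cL"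
    using k by (auto simp: Pi_iff)
  then show "twist b \<in> {coboundary \<kappa>1 \<kappa>2 |\<kappa>1 \<kappa>2. \<kappa>1 \<in> cA \<rightarrow> cK \<and> \<kappa>2 \<in> cB \<rightarrow> cL \<and> \<kappa>1 eA = eK \<and> \<kappa>2 eB = eL}"
    unfolding b twist_coboundary[OF k(1,2)] using k(3,4)
    by (intro CollectI exI conjI) (rule refl | assumption | simp)+
qed

end

section \<open>The map omega and its derivation law\<close>

context rrb_ab_ext
begin

lemma rrb_ext_compatible_cases:
  assumes "c \<in> cC"
  obtains \<psi>1 \<psi>2 \<theta>1 \<theta>2 where "c = ((\<psi>1, \<psi>2), (\<theta>1, \<theta>2))" "rrb_ext_compatible A K D E \<psi>1 \<psi>2 \<theta>1 \<theta>2"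
  using compat_cases[OF assms] rrb_ext_compatible.intro rrb_ab_ext_axioms by metis

lemma ext_twist_ext:
  assumes "c \<in> cC" shows "rrb_ab_ext A K D (ext_twist A E c)"
  using assms by (rule rrb_ext_compatible_cases) (simp add: rrb_ext_compatible.tw_ext)

lemma ext_twist_coset:
  assumes c: "c \<in> cC" and s: "sections A E sH sG"
  shows "cochain_twist A K c (coc sH sG) \<in> cZ2"
    and "ext_coset (ext_twist A E c) = \<lbrakk>cochain_twist A K c (coc sH sG)\<rbrakk>"
proof -
  obtain \<psi>1 \<psi>2 \<theta>1 \<theta>2 where c_def: "c = ((\<psi>1, \<psi>2), (\<theta>1, \<theta>2))" and l: "rrb_ext_compatible A K D E \<psi>1 \<psi>2 \<theta>1 \<theta>2"
    by (rule rrb_ext_compatible_cases[OF c])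
  interpret rrb_ext_compatible A K D E \<psi>1 \<psi>2 \<theta>1 \<theta>2 by (rule l)
  interpret F: rrb_ab_ext A K D tw by (rule tw_ext)
  note t = tw_cocycle[OF s]
  show "cochain_twist A K c (coc sH sG) \<in> cZ2"
    using F.ext_cocycle_Z2[OF t(1)] t(2) by (simp add: c_def)
  show "ext_coset (ext_twist A E c) = \<lbrakk>cochain_twist A K c (coc sH sG)\<rbrakk>"
    using F.ext_coset_eq[OF t(1)] t(2) by (simp add: c_def)
qed

lemma cochain_twist_closed:
  "c \<in> cC \<Longrightarrow> z \<in> cP \<Longrightarrow>
    cochain_twist A K c z \<in> cP"
  by (erule compat_cases) (simp add: rrb_compatible.twist_closed)

lemma cochain_twist_mult_hom:
  "c \<in> cC \<Longrightarrow> z \<in> cP \<Longrightarrow> z' \<in> cP \<Longrightarrow>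
    cochain_twist A K c (z *\<^sub>P z') =
    cochain_twist A K c z *\<^sub>P cochain_twist A K c z'"
  by (erule compat_cases) (simp add: rrb_compatible.twist_mult)

lemma cochain_twist_m_inv:
  "c \<in> cC \<Longrightarrow> z \<in> cP \<Longrightarrow>
    cochain_twist A K c (inv\<^sub>P z) = inv\<^sub>P (cochain_twist A K c z)"
  by (erule compat_cases) (simp add: rrb_compatible.twist_m_inv)

lemma cochain_twist_B2:
  "c \<in> cC \<Longrightarrow> b \<in> B2 \<Longrightarrow> cochain_twist A K c b \<in> B2"
  by (erule rrb_ext_compatible_cases) (simp add: rrb_ext_compatible.twist_B2)

text \<open>\<open>H2_twist\<close> takes the image of a coset as a set, which calls for an equality
  here. The reverse inclusion follows by twisting with the inverse of \<open>c\<close>, as twisting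
  is an action.\<close>

lemma cochain_twist_B2_image:
  assumes c: "c \<in> cC"
  shows "cochain_twist A K c ` B2 = B2"
proof
  interpret C: group "C_group A K D" by (rule group_C_group)
  show "cochain_twist A K c ` B2 \<subseteq> B2" using cochain_twist_B2[OF c] by blast
  show "B2 \<subseteq> cochain_twist A K c ` B2"
  proof
    fix b assume b: "b \<in> B2"
    then have bc: "b \<in> cP" using mem_B2 Z2_carrier by blast
    have "cochain_twist A K c (cochain_twist A K (inv\<^bsub>C_group A K D\<^esub> c) b) = b"
      using cochain_twist_mult[OF C.inv_closed[OF c] c bc] c cochain_twist_one[OF bc] by simp
    then show "b \<in> cochain_twist A K c ` B2"
      using cochain_twist_B2[OF C.inv_closed[OF c] b] by (metis imageI)
  qed
qed

lemma H2_twist_coset: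
  assumes c: "c \<in> cC" and z: "z \<in> cZ2"
  shows "H2_twist A K \<lbrakk>z\<rbrakk> c = \<lbrakk>cochain_twist A K c z\<rbrakk>"
proof -
  have "cochain_twist A K c ` (\<lambda>b. b *\<^sub>P z) ` B2 =
      (\<lambda>b. b *\<^sub>P cochain_twist A K c z) ` cochain_twist A K c ` B2"
    unfolding image_image
  proof (rule image_cong[OF refl])
    fix b assume "b \<in> B2"
    then have "b \<in> cP" using mem_B2 Z2_carrier by blast
    then show "cochain_twist A K c (b *\<^sub>P z) =
        cochain_twist A K c b *\<^sub>P cochain_twist A K c z"
      by (rule cochain_twist_mult_hom[OF c _ Z2_carrier[OF z]])
  qed
  then show ?thesis
    unfolding cochain_twist_B2_image[OF c]
    by (simp add: H2_twist_def coset_def r_coset_def UNION_singleton_eq_range)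
qed

text \<open>By \<open>ext_class_eq_translate_iff\<close>, the class of the twisted extension must be
  the class of E times the unknown; a group has exactly one solution.\<close>

lemma omega_map_eq:
  assumes c: "c \<in> cC"
  shows "\<omega> c = inv\<^bsub>H2_RRB A K D\<^esub> (ext_coset E) *\<^sub>2 ext_coset (ext_twist A E c)"
proof -
  interpret H2: group "H2_RRB A K D" by (rule group_H2)
  note F = ext_twist_ext[OF c]
  have 1: "ext_coset E \<in> cH2" "ext_coset (ext_twist A E c) \<in> cH2"
    using ext_coset_closed rrb_ab_ext.ext_coset_closed[OF F] by simp_all
  show ?thesis
    unfolding omega_map_def
    by (rule the_equality)
      (use 1 in \<open>auto simp: ext_class_eq_translate_iff[OF F] H2.m_assoc[symmetric]\<close>)
qed

lemma omega_map_closed: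
  "c \<in> cC \<Longrightarrow> \<omega> c \<in> cH2"
  by (simp add: omega_map_eq ext_coset_closed rrb_ab_ext.ext_coset_closed[OF ext_twist_ext]
      group.inv_closed[OF group_H2] monoid.m_closed[OF group.is_monoid[OF group_H2]])

lemma omega_map_one_iff:
  assumes c: "c \<in> cC"
  shows "\<omega> c = eH2 \<longleftrightarrow> ext_equiv A K E (ext_twist A E c)"
proof -
  interpret H2: group "H2_RRB A K D" by (rule group_H2)
  note F = ext_twist_ext[OF c]
  have 1: "ext_coset E \<in> cH2" "ext_coset (ext_twist A E c) \<in> cH2"
    using ext_coset_closed rrb_ab_ext.ext_coset_closed[OF F] by simp_all
  show ?thesis
    unfolding ext_equiv_iff_coset[OF F] omega_map_eq[OF c]
    using 1 by (auto simp: H2.inv_solve_left')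
qed

lemma omega_map_coset:
  assumes c: "c \<in> cC" and s: "sections A E sH sG"
  shows "\<omega> c = \<lbrakk>inv\<^sub>P (coc sH sG) \<otimes>\<^bsub>cochain_prod A K\<^esub>
    cochain_twist A K c (coc sH sG)\<rbrakk>"
proof -
  interpret H2: group "H2_RRB A K D" by (rule group_H2)
  interpret Z2: comm_group "Z2_RRB A K D" by (rule comm_group_Z2)
  let ?z = "coc sH sG"
  have z: "?z \<in> cZ2" by (rule ext_cocycle_Z2[OF s])
  have "\<lbrakk>inv\<^bsub>Z2_RRB A K D\<^esub> ?z\<rbrakk> *\<^sub>2 \<lbrakk>?z\<rbrakk> = eH2"
    using z by (simp add: mult_H2 one_H2 del: mult_Z2 one_Z2)
  then have "inv\<^bsub>H2_RRB A K D\<^esub> \<lbrakk>?z\<rbrakk> = \<lbrakk>inv\<^bsub>Z2_RRB A K D\<^esub> ?z\<rbrakk>"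
    using z by (intro H2.inv_equality) (auto simp: carrier_H2)
  then show ?thesis
    using z ext_twist_coset(1)[OF c s] Z2.inv_closed[OF z]
    by (simp add: omega_map_eq[OF c] ext_coset_eq[OF s] ext_twist_coset(2)[OF c s] mult_H2 inv_Z2)
qed

text \<open>Everything is checked for one representative \<open>z\<close>. Twisting is
  multiplicative and a right action, so the first factor is represented by the inverse of the
  \<open>d\<close>-twist of \<open>z\<close> times its twist by the product of \<open>c\<close> and
  \<open>d\<close>.\<close>

lemma omega_map_derivation:
  assumes c: "c \<in> cC" and d: "d \<in> cC"
  shows "\<omega> (c *\<^sub>C d) =
    H2_twist A K (\<omega> c) d *\<^sub>2 \<omega> d"
proof -
  interpret C: group "C_group A K D" by (rule group_C_group)
  interpret Z: subgroup "cZ2" "cochain_prod A K" by (rule subgroup_Z2)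
  note cd = C.m_closed[OF c d]
  obtain sH sG where s: "sections A E sH sG" using sections_exist by blast
  define z where "z = coc sH sG"
  have z: "z \<in> cZ2" unfolding z_def by (rule ext_cocycle_Z2[OF s])
  note zc = Z2_carrier[OF z]
  note tc = ext_twist_coset(1)[OF c s, folded z_def] and td = ext_twist_coset(1)[OF d s, folded z_def]
    and tcd = ext_twist_coset(1)[OF cd s, folded z_def]
  note om = omega_map_coset[OF _ s, folded z_def]
  let ?m = "monoid.mult (cochain_prod A K)" and ?i = "m_inv (cochain_prod A K)"
  have 1: "?m (?i z) (cochain_twist A K c z) \<in> cZ2"
    "?m (?i z) (cochain_twist A K d z) \<in> cZ2"
    using z tc td by simp_all
  have 2: "cochain_twist A K d (?m (?i z) (cochain_twist A K c z)) =
      ?m (?i (cochain_twist A K d z)) (cochain_twist A K (c *\<^sub>C d) z)"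
    by (simp add: cochain_twist_mult_hom[OF d] cochain_twist_m_inv[OF d] cochain_twist_mult[OF c d] zc
        cochain_twist_closed[OF c])
  have 3: "cochain_twist A K d (?m (?i z) (cochain_twist A K c z)) \<in> cZ2"
    unfolding 2 using td tcd by simp
  \<comment> \<open>The \<open>d\<close>-twist of \<open>z\<close> occurs once inverted in the first
    factor and once in the second, and drops out.\<close>
  have "?m (?m (?i (cochain_twist A K d z)) (cochain_twist A K (c *\<^sub>C d) z)) (?m (?i z) (cochain_twist A K d z))
      = ?m (?i z) (cochain_twist A K (c *\<^sub>C d) z)"
    using zc Z2_carrier[OF td] Z2_carrier[OF tcd]
      CP.mult_cancel_inv[of "cochain_twist A K d z" "?i z" "cochain_twist A K (c *\<^sub>C d) z"]
    by (simp add: CP.m_ac)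
  then show ?thesis
    by (simp add: om[OF cd] om[OF c] om[OF d] H2_twist_coset[OF d 1(1)] mult_H2[OF 3[unfolded 2] 1(2)] 2)
qed

end

section \<open>Automorphisms normalizing the kernel\<close>

text \<open>Stated for a single short exact sequence of groups, so that it serves both components of
  a relative Rota--Baxter group. Since \<open>g\<close> maps the kernel of \<open>p\<close> onto
  itself, p(g(h)) depends only on p(h), which makes the choice of \<open>s\<close>
  immaterial.\<close>

lemma induced_auto:
  assumes grps: "group N" "group H" "group Q"
    and i: "i \<in> hom N H" "inj_on i (carrier N)"
    and p: "p \<in> hom H Q" "p ` carrier H = carrier Q" "i ` carrier N = kernel H Q p"
    and g: "g \<in> auto H" "g ` i ` carrier N = i ` carrier N"
    and s: "\<And>a. a \<in> carrier Q \<Longrightarrow> s a \<in> carrier H" "\<And>a. a \<in> carrier Q \<Longrightarrow> p (s a) = a"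
  shows "(\<lambda>a\<in>carrier Q. p (g (s a))) \<in> auto Q"
    and "(\<lambda>k\<in>carrier N. inv_into (carrier N) i (g (i k))) \<in> auto N"
    and "\<And>h. h \<in> carrier H \<Longrightarrow> p (g h) = (\<lambda>a\<in>carrier Q. p (g (s a))) (p h)"
    and "\<And>k. k \<in> carrier N \<Longrightarrow> g (i k) = i ((\<lambda>k\<in>carrier N. inv_into (carrier N) i (g (i k))) k)"
proof -
  interpret i: group_hom N H i using grps i by (simp add: group_hom_def group_hom_axioms_def)
  interpret p: group_hom H Q p using grps p by (simp add: group_hom_def group_hom_axioms_def)
  define \<psi> where "\<psi> = (\<lambda>a\<in>carrier Q. p (g (s a)))"
  define \<theta> where "\<theta> = (\<lambda>k\<in>carrier N. inv_into (carrier N) i (g (i k)))"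
  have gc [simp]: "g h \<in> carrier H" if "h \<in> carrier H" for h using g(1) that by (rule auto_closed)
  have gm [simp]: "g (h \<otimes>\<^bsub>H\<^esub> h') = g h \<otimes>\<^bsub>H\<^esub> g h'" if "h \<in> carrier H" "h' \<in> carrier H" for h h'
    using g(1) that by (rule auto_mult)
  have ginv [simp]: "g (inv\<^bsub>H\<^esub> h) = inv\<^bsub>H\<^esub> (g h)" if "h \<in> carrier H" for h
    by (rule group.auto_m_inv[OF grps(2) g(1) that])
  have theta: "\<theta> k \<in> carrier N" "i (\<theta> k) = g (i k)" if "k \<in> carrier N" for k
  proof -
    have "g (i k) \<in> i ` carrier N" using that g(2) by blast
    then show "\<theta> k \<in> carrier N" "i (\<theta> k) = g (i k)"
      using that by (simp_all add: \<theta>_def inv_into_into f_inv_into_f)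
  qed
  \<comment> \<open>The equivalence in both directions matters: one gives well-definedness of the
    induced map on the quotient, the other its injectivity.\<close>
  have ker: "p (g h) = \<one>\<^bsub>Q\<^esub> \<longleftrightarrow> p h = \<one>\<^bsub>Q\<^esub>" if h: "h \<in> carrier H" for h
  proof -
    have "p (g h) = \<one>\<^bsub>Q\<^esub> \<longleftrightarrow> g h \<in> g ` i ` carrier N" using h p(3) g(2) by (auto simp: kernel_def)
    also have "\<dots> \<longleftrightarrow> h \<in> i ` carrier N" using h auto_inj[OF g(1)] i.hom_closed by (auto simp: image_iff)
    also have "\<dots> \<longleftrightarrow> p h = \<one>\<^bsub>Q\<^esub>" using h p(3) by (auto simp: kernel_def)
    finally show ?thesis .
  qed
  have eq: "p (g h) = p (g h') \<longleftrightarrow> p h = p h'" if "h \<in> carrier H" "h' \<in> carrier H" for h h'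
    using ker[of "inv\<^bsub>H\<^esub> h \<otimes>\<^bsub>H\<^esub> h'"] that by (auto simp: group.inv_solve_left'[OF grps(3)])
  have psi: "p (g h) = \<psi> (p h)" if "h \<in> carrier H" for h
    using that s by (simp add: \<psi>_def eq)
  have surj: "\<exists>h\<in>carrier H. a = p h" if "a \<in> carrier Q" for a using that p(2) by blast
  have g_surj: "\<exists>h'\<in>carrier H. h = g h'" if "h \<in> carrier H" for h
    using f_auto_inv_into[OF g(1) that] auto_inv_into_closed[OF g(1) that] by metis
  show "(\<lambda>a\<in>carrier Q. p (g (s a))) \<in> auto Q"
  proof (rule autoI; fold \<psi>_def)
    show "\<psi> \<in> hom Q Q"
    proof (rule homI)
      fix a assume "a \<in> carrier Q" then show "\<psi> a \<in> carrier Q" using s by (simp add: \<psi>_def)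
    next
      fix a a' assume "a \<in> carrier Q" "a' \<in> carrier Q"
      then obtain h h' where "h \<in> carrier H" "h' \<in> carrier H" "a = p h" "a' = p h'" using surj by metis
      then show "\<psi> (a \<otimes>\<^bsub>Q\<^esub> a') = \<psi> a \<otimes>\<^bsub>Q\<^esub> \<psi> a'"
        using psi[of "h \<otimes>\<^bsub>H\<^esub> h'"] by (simp add: psi)
    qed
    show "\<psi> \<in> extensional (carrier Q)" by (simp add: \<psi>_def)
    show "inj_on \<psi> (carrier Q)"
    proof (rule inj_onI)
      fix a a' assume "a \<in> carrier Q" "a' \<in> carrier Q" and e: "\<psi> a = \<psi> a'"
      then obtain h h' where "h \<in> carrier H" "h' \<in> carrier H" "a = p h" "a' = p h'" using surj by metis
      then show "a = a'" using e eq by (simp add: psi[symmetric])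
    qed
    show "\<psi> ` carrier Q = carrier Q"
    proof
      show "\<psi> ` carrier Q \<subseteq> carrier Q" using s by (auto simp: \<psi>_def)
      show "carrier Q \<subseteq> \<psi> ` carrier Q"
      proof
        fix a assume "a \<in> carrier Q"
        then obtain h where h: "h \<in> carrier H" "a = p h" using surj by blast
        then obtain h' where "h' \<in> carrier H" "h = g h'" using g_surj by blast
        then show "a \<in> \<psi> ` carrier Q" using h psi by auto
      qed
    qed
  qed
  show "(\<lambda>k\<in>carrier N. inv_into (carrier N) i (g (i k))) \<in> auto N"
  proof (rule autoI; fold \<theta>_def)
    show "\<theta> \<in> hom N N"
    proof (rule homI)
      fix k k' assume k: "k \<in> carrier N" "k' \<in> carrier N"
      then have "i (\<theta> (k \<otimes>\<^bsub>N\<^esub> k')) = i (\<theta> k \<otimes>\<^bsub>N\<^esub> \<theta> k')" by (simp add: theta)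
      then show "\<theta> (k \<otimes>\<^bsub>N\<^esub> k') = \<theta> k \<otimes>\<^bsub>N\<^esub> \<theta> k'" using k theta(1) i(2) by (simp add: inj_on_eq_iff del: i.hom_mult)
    qed (rule theta)
    show "\<theta> \<in> extensional (carrier N)" by (simp add: \<theta>_def)
    show "inj_on \<theta> (carrier N)"
    proof (rule inj_onI)
      fix k k' assume k: "k \<in> carrier N" "k' \<in> carrier N" and "\<theta> k = \<theta> k'"
      then have "g (i k) = g (i k')" by (simp add: theta(2)[symmetric])
      then show "k = k'" using k i(2) by (simp add: auto_inj[OF g(1)] inj_on_eq_iff)
    qed
    show "\<theta> ` carrier N = carrier N"
    proof
      show "\<theta> ` carrier N \<subseteq> carrier N" using theta(1) by blast
      show "carrier N \<subseteq> \<theta> ` carrier N"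
      proof
        fix k assume k: "k \<in> carrier N"
        then have "i k \<in> g ` i ` carrier N" using g(2) by blast
        then obtain k' where k': "k' \<in> carrier N" "i k = g (i k')" by blast
        then have "i k = i (\<theta> k')" by (simp add: theta)
        then have "k = \<theta> k'" using k k' theta(1) i(2) by (simp add: inj_on_eq_iff)
        then show "k \<in> \<theta> ` carrier N" using k' by blast
      qed
    qed
  qed
  show "\<And>h. h \<in> carrier H \<Longrightarrow> p (g h) = (\<lambda>a\<in>carrier Q. p (g (s a))) (p h)"
    using psi by (simp only: \<psi>_def)
  show "\<And>k. k \<in> carrier N \<Longrightarrow> g (i k) = i ((\<lambda>k\<in>carrier N. inv_into (carrier N) i (g (i k))) k)"
    using theta(2) by (simp only: \<theta>_def)
qed

section \<open>The map from normalizing automorphisms to compatible pairs\<close>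

context rrb_ab_ext
begin

lemma mem_Aut_normalizing:
  "(\<gamma>1, \<gamma>2) \<in> cN \<longleftrightarrow> (\<gamma>1, \<gamma>2) \<in> carrier (rrb_Aut (middle E)) \<and>
    \<gamma>1 ` \<iota> ` cK = \<iota> ` cK \<and> \<gamma>2 ` \<j> ` cL = \<j> ` cL"
  by (simp add: Aut_normalizing_def)

lemma mult_Aut_normalizing:
  "(f, g) \<otimes>\<^bsub>Aut_normalizing K E\<^esub> (f', g') =
    (f \<circ>\<^sub>H f', g \<circ>\<^sub>G g')"
  by (simp add: Aut_normalizing_def E.mult_rrb_Aut)

lemma Aut_normalizingD:
  assumes "(\<gamma>1, \<gamma>2) \<in> cN"
  shows "\<gamma>1 \<in> auto gH" "\<gamma>2 \<in> auto gG"
    "h \<in> cH \<Longrightarrow> \<gamma>2 (R h) = R (\<gamma>1 h)"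
    "g \<in> cG \<Longrightarrow> h \<in> cH \<Longrightarrow> \<gamma>1 (\<phi> g h) = \<phi> (\<gamma>2 g) (\<gamma>1 h)"
    "\<gamma>1 ` \<iota> ` cK = \<iota> ` cK" "\<gamma>2 ` \<j> ` cL = \<j> ` cL"
  using assms by (auto simp: mem_Aut_normalizing E.mem_rrb_Aut)

lemma group_Aut_normalizing: "group (Aut_normalizing K E)"
proof -
  interpret U: group "rrb_Aut (middle E)" by (rule E.group_rrb_Aut)
  have eq: "Aut_normalizing K E = rrb_Aut (middle E)\<lparr>carrier := cN\<rparr>"
    by (simp add: Aut_normalizing_def)
  have iH: "\<iota> ` cK \<subseteq> cH" and jG: "\<j> ` cL \<subseteq> cG" by auto
  have "subgroup (cN) (rrb_Aut (middle E))"
  proof (rule U.subgroupI)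
    show "cN \<subseteq> carrier (rrb_Aut (middle E))"
      by (auto simp: Aut_normalizing_def)
    have "\<one>\<^bsub>rrb_Aut (middle E)\<^esub> \<in> cN"
      using U.one_closed unfolding E.one_rrb_Aut mem_Aut_normalizing
      by (auto simp: one_AutoGroup_apply image_image)
    then show "cN \<noteq> {}" by blast
  next
    fix c assume c: "c \<in> cN"
    obtain f g where c_def: "c = (f, g)" by (cases c)
    note d = Aut_normalizingD[OF c[unfolded c_def]]
    have cU: "(f, g) \<in> carrier (rrb_Aut (middle E))" using c by (simp add: c_def mem_Aut_normalizing)
    show "inv\<^bsub>rrb_Aut (middle E)\<^esub> c \<in> cN"
      using U.inv_closed[OF cU] auto_inv_into_image[OF d(1) iH, unfolded d(5)]
        auto_inv_into_image[OF d(2) jG, unfolded d(6)]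
      by (simp only: c_def E.inv_rrb_Aut[OF cU] mem_Aut_normalizing)
  next
    fix c c' assume c: "c \<in> cN" and c': "c' \<in> cN"
    obtain f g where c_def: "c = (f, g)" by (cases c)
    obtain f' g' where c'_def: "c' = (f', g')" by (cases c')
    note d = Aut_normalizingD[OF c[unfolded c_def]] and d' = Aut_normalizingD[OF c'[unfolded c'_def]]
    have U: "c \<otimes>\<^bsub>rrb_Aut (middle E)\<^esub> c' \<in> carrier (rrb_Aut (middle E))"
      using c c' by (simp add: c_def c'_def mem_Aut_normalizing)
    have 1: "(f \<circ>\<^sub>H f') ` \<iota> ` cK = \<iota> ` cK"
    proof -
      have "(f \<circ>\<^sub>H f') ` \<iota> ` cK = f ` f' ` \<iota> ` cK"
        unfolding image_image by (intro image_cong) (auto simp: mult_AutoGroup_apply d(1) d'(1))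
      then show ?thesis by (simp only: d(5) d'(5))
    qed
    have 2: "(g \<circ>\<^sub>G g') ` \<j> ` cL = \<j> ` cL"
    proof -
      have "(g \<circ>\<^sub>G g') ` \<j> ` cL = g ` g' ` \<j> ` cL"
        unfolding image_image by (intro image_cong) (auto simp: mult_AutoGroup_apply d(2) d'(2))
      then show ?thesis by (simp only: d(6) d'(6))
    qed
    show "c \<otimes>\<^bsub>rrb_Aut (middle E)\<^esub> c' \<in> cN"
      using U 1 2 by (simp only: c_def c'_def E.mult_rrb_Aut mem_Aut_normalizing)
  qed
  from U.subgroup_imp_group[OF this, folded eq] show ?thesis .
qed

text \<open>Commutativity of the squares with the inclusions and the projections: a description of
  the induced pair that mentions neither sections nor inverses of inclusions, and hence is easy to
  compose.\<close>

definition induces where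
  "induces = (\<lambda>(\<gamma>1, \<gamma>2) ((\<psi>1, \<psi>2), (\<theta>1, \<theta>2)).
    (\<forall>h\<in>cH. \<p> (\<gamma>1 h) = \<psi>1 (\<p> h)) \<and> (\<forall>g\<in>cG. \<q> (\<gamma>2 g) = \<psi>2 (\<q> g)) \<and>
    (\<forall>k\<in>cK. \<gamma>1 (\<iota> k) = \<iota> (\<theta>1 k)) \<and> (\<forall>l\<in>cL. \<gamma>2 (\<j> l) = \<j> (\<theta>2 l)))"

text \<open>The commuting squares determine the pair on the carriers, and automorphisms are
  extensional. The map \<open>\<rho>\<close> is thus evaluated by exhibiting a pair that is
  induced.\<close>

lemma induces_imp_rho_map_eq:
  assumes i: "induces (\<gamma>1, \<gamma>2) ((\<psi>1, \<psi>2), (\<theta>1, \<theta>2))"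
    and a: "\<psi>1 \<in> auto (grpH A)" "\<psi>2 \<in> auto (grpG A)" "\<theta>1 \<in> auto (grpH K)" "\<theta>2 \<in> auto (grpG K)"
    and s: "sections A E sH sG"
  shows "\<rho> sH sG (\<gamma>1, \<gamma>2) = ((\<psi>1, \<psi>2), (\<theta>1, \<theta>2))"
proof -
  note [simp] = sectionsD[OF s] a(3,4)[THEN auto_closed]
  have e: "\<psi>1 \<in> extensional cA" "\<psi>2 \<in> extensional cB" "\<theta>1 \<in> extensional cK" "\<theta>2 \<in> extensional cL"
    using a by (auto simp: auto_iff)
  have "(\<lambda>a\<in>cA. \<p> (\<gamma>1 (sH a))) = \<psi>1" "(\<lambda>b\<in>cB. \<q> (\<gamma>2 (sG b))) = \<psi>2"
    "(\<lambda>k\<in>cK. backK K E (\<gamma>1 (\<iota> k))) = \<theta>1" "(\<lambda>l\<in>cL. backL K E (\<gamma>2 (\<j> l))) = \<theta>2"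
    using i by (intro extensionalityI[OF restrict_extensional e(1)] extensionalityI[OF restrict_extensional e(2)]
        extensionalityI[OF restrict_extensional e(3)] extensionalityI[OF restrict_extensional e(4)];
      simp add: induces_def)+
  then show ?thesis by (simp add: rho_map_def)
qed

text \<open>Each compatibility condition results from applying the automorphism to one law of the
  associated action and comparing kernel elements; the squares translate the outcome into \<psi> and
  \<theta>.\<close>

lemma rho_map_induces:
  assumes g: "(\<gamma>1, \<gamma>2) \<in> cN" and s: "sections A E sH sG"
  shows "induces (\<gamma>1, \<gamma>2) (\<rho> sH sG (\<gamma>1, \<gamma>2))"
    and "\<rho> sH sG (\<gamma>1, \<gamma>2) \<in> cC"
proof -
  note d = Aut_normalizingD[OF g]
  note sD = sectionsD[OF s]
  obtain \<psi>1 \<psi>2 \<theta>1 \<theta>2 where c: "\<rho> sH sG (\<gamma>1, \<gamma>2) = ((\<psi>1, \<psi>2), (\<theta>1, \<theta>2))"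
    by (metis prod.collapse)
  have defs: "(\<lambda>a\<in>cA. \<p> (\<gamma>1 (sH a))) = \<psi>1" "(\<lambda>b\<in>cB. \<q> (\<gamma>2 (sG b))) = \<psi>2"
    "(\<lambda>k\<in>cK. inv_into cK \<iota> (\<gamma>1 (\<iota> k))) = \<theta>1" "(\<lambda>l\<in>cL. inv_into cL \<j> (\<gamma>2 (\<j> l))) = \<theta>2"
    using c by (auto simp: rho_map_def backK_def backL_def)
  have x: "inj_on \<iota> cK" "inj_on \<j> cL" "\<p> ` cH = cA" "\<q> ` cG = cB"
    "\<iota> ` cK = kernel gH (grpH A) \<p>" "\<j> ` cL = kernel gG (grpG A) \<q>"
    "\<iota> \<in> hom (grpH K) gH" "\<j> \<in> hom (grpG K) gG"
    "\<p> \<in> hom gH (grpH A)" "\<q> \<in> hom gG (grpG A)"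
    using ext by (auto simp: rrb_extension_def rrb_hom_def)
  note a1 = induced_auto[OF K.H.is_group E.H.is_group A.H.is_group x(7,1,9,3,5) d(1,5), of sH, OF sD(1,3), unfolded defs]
  note a2 = induced_auto[OF K.G.is_group E.G.is_group A.G.is_group x(8,2,10,4,6) d(2,6), of sG, OF sD(2,4), unfolded defs]
  note [simp] = a1(3)[symmetric] a2(3)[symmetric] a1(4) a2(4) d(1,2)[THEN auto_closed]
    a1(2)[THEN auto_closed] a2(2)[THEN auto_closed]
  show i: "induces (\<gamma>1, \<gamma>2) (\<rho> sH sG (\<gamma>1, \<gamma>2))"
    unfolding c induces_def by simp
  \<comment> \<open>The conditions below are proved at projections of elements of the middle groups;
    surjectivity carries them over to all of A and B.\<close>
  have surj: "\<exists>h\<in>cH. a = \<p> h" "\<exists>g\<in>cG. b = \<q> g" if "a \<in> cA" "b \<in> cB" for a b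
    using x(3,4) that by blast+
  have "\<psi>2 (T (\<p> h)) = T (\<psi>1 (\<p> h))" if "h \<in> cH" for h
    using that a2(3)[of "R h"] by (simp add: d(3))
  moreover have "\<psi>1 (\<beta> (\<q> g) (\<p> h)) = \<beta> (\<psi>2 (\<q> g)) (\<psi>1 (\<p> h))" if "h \<in> cH" "g \<in> cG" for h g
    using that a1(3)[of "\<phi> g h"] by (simp add: d(4))
  ultimately have A: "(\<psi>1, \<psi>2) \<in> carrier (rrb_Aut A)"
    unfolding A.mem_rrb_Aut using a1(1) a2(1) surj by (metis A.G.one_closed A.H.one_closed)
  have "\<theta>2 (S k) = S (\<theta>1 k)" if "k \<in> cK" for k
  proof -
    have "\<j> (\<theta>2 (S k)) = \<gamma>2 (R (\<iota> k))" using that by simp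
    also have "\<dots> = R (\<gamma>1 (\<iota> k))" using that by (simp only: d(3) inc_simps)
    also have "\<dots> = \<j> (S (\<theta>1 k))" using that by simp
    finally show ?thesis using that by simp
  qed
  then have Kc: "(\<theta>1, \<theta>2) \<in> carrier (rrb_Aut K)"
    unfolding K.mem_rrb_Aut using a1(2) a2(2) by simp
  have nu: "\<theta>1 (\<nu> (\<q> g) k) = \<nu> (\<psi>2 (\<q> g)) (\<theta>1 k)" if "g \<in> cG" "k \<in> cK" for g k
  proof -
    have "\<iota> (\<theta>1 (\<nu> (\<q> g) k)) = \<gamma>1 (\<phi> g (\<iota> k))" using that by (simp add: act_inc1)
    also have "\<dots> = \<phi> (\<gamma>2 g) (\<gamma>1 (\<iota> k))" using that by (simp only: d(4) inc_simps)
    also have "\<dots> = \<iota> (\<nu> (\<psi>2 (\<q> g)) (\<theta>1 k))" using that by (simp add: act_inc1)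
    finally show ?thesis using that by simp
  qed
  have mu: "\<theta>1 (\<mu> (\<p> h) k) = \<mu> (\<psi>1 (\<p> h)) (\<theta>1 k)" if "h \<in> cH" "k \<in> cK" for h k
  proof -
    have "\<gamma>1 h *\<^sub>H \<iota> (\<theta>1 (\<mu> (\<p> h) k)) = \<gamma>1 (h *\<^sub>H \<iota> (\<mu> (\<p> h) k))"
      using that by (simp add: auto_mult[OF d(1)])
    also have "\<dots> = \<gamma>1 (\<iota> k *\<^sub>H h)" using that by (simp only: inc1_mult)
    also have "\<dots> = \<iota> (\<theta>1 k) *\<^sub>H \<gamma>1 h" using that by (simp add: auto_mult[OF d(1)])
    also have "\<dots> = \<gamma>1 h *\<^sub>H \<iota> (\<mu> (\<psi>1 (\<p> h)) (\<theta>1 k))"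
      using that inc1_mult[of "\<theta>1 k" "\<gamma>1 h"] by simp
    finally show ?thesis using that by simp
  qed
  have sigma: "\<theta>2 (\<sigma> (\<q> g) l) = \<sigma> (\<psi>2 (\<q> g)) (\<theta>2 l)" if "g \<in> cG" "l \<in> cL" for g l
  proof -
    have "\<gamma>2 g *\<^sub>G \<j> (\<theta>2 (\<sigma> (\<q> g) l)) = \<gamma>2 (g *\<^sub>G \<j> (\<sigma> (\<q> g) l))"
      using that by (simp add: auto_mult[OF d(2)])
    also have "\<dots> = \<gamma>2 (\<j> l *\<^sub>G g)" using that by (simp only: inc2_mult)
    also have "\<dots> = \<j> (\<theta>2 l) *\<^sub>G \<gamma>2 g" using that by (simp add: auto_mult[OF d(2)])
    also have "\<dots> = \<gamma>2 g *\<^sub>G \<j> (\<sigma> (\<psi>2 (\<q> g)) (\<theta>2 l))"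
      using that inc2_mult[of "\<theta>2 l" "\<gamma>2 g"] by simp
    finally show ?thesis using that by simp
  qed
  have ff: "\<theta>1 (\<f> l (\<p> h)) = \<f> (\<theta>2 l) (\<psi>1 (\<p> h))" if "h \<in> cH" "l \<in> cL" for h l
  proof -
    have "\<gamma>1 h *\<^sub>H \<iota> (\<theta>1 (\<f> l (\<p> h))) = \<gamma>1 (\<phi> (\<j> l) h)"
      using that by (simp add: inc2_act auto_mult[OF d(1)])
    also have "\<dots> = \<phi> (\<gamma>2 (\<j> l)) (\<gamma>1 h)" using that by (simp only: d(4) inc_simps)
    also have "\<dots> = \<gamma>1 h *\<^sub>H \<iota> (\<f> (\<theta>2 l) (\<psi>1 (\<p> h)))" using that by (simp add: inc2_act)
    finally show ?thesis using that by simp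
  qed
  show "\<rho> sH sG (\<gamma>1, \<gamma>2) \<in> cC"
    unfolding c mem_C_group
  proof (intro conjI ballI A Kc)
    show "\<theta>1 (\<nu> b k) = \<nu> (\<psi>2 b) (\<theta>1 k)" if "b \<in> cB" "k \<in> cK" for b k
      using that surj(2)[OF A.H.one_closed] nu by blast
    show "\<theta>1 (\<mu> a k) = \<mu> (\<psi>1 a) (\<theta>1 k)" if "a \<in> cA" "k \<in> cK" for a k
      using that surj(1)[OF _ A.G.one_closed] mu by blast
    show "\<theta>2 (\<sigma> b l) = \<sigma> (\<psi>2 b) (\<theta>2 l)" if "b \<in> cB" "l \<in> cL" for b l
      using that surj(2)[OF A.H.one_closed] sigma by blast
    show "\<theta>1 (\<f> l a) = \<f> (\<theta>2 l) (\<psi>1 a)" if "l \<in> cL" "a \<in> cA" for a l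
      using that surj(1)[OF _ A.G.one_closed] ff by blast
  qed
qed

text \<open>Commuting squares compose, and a pair of automorphisms that is induced is the value of
  \<open>\<rho>\<close>.\<close>

lemma group_hom_rho_map:
  assumes s: "sections A E sH sG"
  shows "group_hom (Aut_normalizing K E) (C_group A K D) (\<rho> sH sG)"
proof -
  interpret N: group "Aut_normalizing K E" by (rule group_Aut_normalizing)
  interpret C: group "C_group A K D" by (rule group_C_group)
  have "\<rho> sH sG \<in> hom (Aut_normalizing K E) (C_group A K D)"
  proof (rule homI)
    fix x assume "x \<in> cN"
    then show "\<rho> sH sG x \<in> cC"
      using rho_map_induces(2)[OF _ s] by (cases x) simp
  next
    fix x y assume x: "x \<in> cN" and y: "y \<in> cN"
    obtain f g where x_def: "x = (f, g)" by (cases x)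
    obtain f' g' where y_def: "y = (f', g')" by (cases y)
    note ix = rho_map_induces[OF x[unfolded x_def] s] and iy = rho_map_induces[OF y[unfolded y_def] s]
    obtain \<psi>1 \<psi>2 \<theta>1 \<theta>2 where c: "\<rho> sH sG x = ((\<psi>1, \<psi>2), (\<theta>1, \<theta>2))"
      by (metis prod.collapse)
    obtain \<psi>1' \<psi>2' \<theta>1' \<theta>2' where c': "\<rho> sH sG y = ((\<psi>1', \<psi>2'), (\<theta>1', \<theta>2'))"
      by (metis prod.collapse)
    interpret c: rrb_compatible A K D \<psi>1 \<psi>2 \<theta>1 \<theta>2
      using ix(2) by (intro rrb_compatibleI) (simp add: c[unfolded x_def])
    interpret c': rrb_compatible A K D \<psi>1' \<psi>2' \<theta>1' \<theta>2'
      using iy(2) by (intro rrb_compatibleI) (simp add: c'[unfolded y_def])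
    note dx = Aut_normalizingD(1,2)[OF x[unfolded x_def]] and dy = Aut_normalizingD(1,2)[OF y[unfolded y_def]]
    note [simp] = dx[THEN auto_closed] dy[THEN auto_closed]
    have "\<rho> sH sG (f \<circ>\<^sub>H f', g \<circ>\<^sub>G g') =
      ((\<psi>1 \<otimes>\<^bsub>AutoGroup (grpH A)\<^esub> \<psi>1', \<psi>2 \<otimes>\<^bsub>AutoGroup (grpG A)\<^esub> \<psi>2'),
       (\<theta>1 \<otimes>\<^bsub>AutoGroup (grpH K)\<^esub> \<theta>1', \<theta>2 \<otimes>\<^bsub>AutoGroup (grpG K)\<^esub> \<theta>2'))"
    proof (rule induces_imp_rho_map_eq[OF _ _ _ _ _ s])
      show "induces (f \<circ>\<^sub>H f', g \<circ>\<^sub>G g')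
        ((\<psi>1 \<otimes>\<^bsub>AutoGroup (grpH A)\<^esub> \<psi>1', \<psi>2 \<otimes>\<^bsub>AutoGroup (grpG A)\<^esub> \<psi>2'),
         (\<theta>1 \<otimes>\<^bsub>AutoGroup (grpH K)\<^esub> \<theta>1', \<theta>2 \<otimes>\<^bsub>AutoGroup (grpG K)\<^esub> \<theta>2'))"
        using ix(1) iy(1) unfolding c[unfolded x_def] c'[unfolded y_def]
        by (simp add: induces_def mult_AutoGroup_apply dx dy c.autos c'.autos)
    qed (simp_all add: A.H.mult_AutoGroup_in A.G.mult_AutoGroup_in K.H.mult_AutoGroup_in
        K.G.mult_AutoGroup_in c.autos c'.autos)
    then show "\<rho> sH sG (x \<otimes>\<^bsub>Aut_normalizing K E\<^esub> y) =
        \<rho> sH sG x *\<^sub>C \<rho> sH sG y"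
      unfolding c c' unfolding x_def y_def mult_Aut_normalizing mult_C_group .
  qed
  then show ?thesis by unfold_locales
qed

text \<open>E and its twist have the same middle term. An equivalence between them must carry the
  inclusions to their composites with \<theta> and the projections to their composites with the
  inverse of \<psi>, which is to say that it induces \<open>c\<close>.\<close>

lemma rho_map_image:
  assumes s: "sections A E sH sG"
  shows "\<rho> sH sG ` cN =
    {c \<in> cC. \<omega> c = eH2}"
proof
  show "\<rho> sH sG ` cN \<subseteq>
    {c \<in> cC. \<omega> c = eH2}"
  proof
    fix c assume "c \<in> \<rho> sH sG ` cN"
    then obtain f g where fg: "(f, g) \<in> cN" "c = \<rho> sH sG (f, g)"
      by (metis imageE prod.collapse)
    note i = rho_map_induces[OF fg(1) s, folded fg(2)]
    obtain \<psi>1 \<psi>2 \<theta>1 \<theta>2 where c_def: "c = ((\<psi>1, \<psi>2), (\<theta>1, \<theta>2))" and l: "rrb_ext_compatible A K D E \<psi>1 \<psi>2 \<theta>1 \<theta>2"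
      by (rule rrb_ext_compatible_cases[OF i(2)])
    interpret rrb_ext_compatible A K D E \<psi>1 \<psi>2 \<theta>1 \<theta>2 by (rule l)
    have "rrb_iso (middle E) (middle tw) (f, g)"
      using Aut_normalizingD(1-4)[OF fg(1)] by (auto simp: rrb_iso_def rrb_hom_def tw_simps(1) auto_iff iso_def)
    then have "ext_equiv A K E tw"
      unfolding ext_equiv_def
      by (intro exI[of _ f] exI[of _ g]) (use i(1) in \<open>simp add: tw_simps induces_def c_def\<close>)
    then show "c \<in> {c \<in> cC. \<omega> c = eH2}"
      using i(2) omega_map_one_iff[OF i(2)] by (simp add: c_def)
  qed
  show "{c \<in> cC. \<omega> c = eH2} \<subseteq>
    \<rho> sH sG ` cN"
  proof
    fix c assume "c \<in> {c \<in> cC. \<omega> c = eH2}"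
    then have c: "c \<in> cC" and "\<omega> c = eH2"
      by simp_all
    then have eq: "ext_equiv A K E (ext_twist A E c)" using omega_map_one_iff by blast
    obtain \<psi>1 \<psi>2 \<theta>1 \<theta>2 where c_def: "c = ((\<psi>1, \<psi>2), (\<theta>1, \<theta>2))" and l: "rrb_ext_compatible A K D E \<psi>1 \<psi>2 \<theta>1 \<theta>2"
      by (rule rrb_ext_compatible_cases[OF c])
    interpret rrb_ext_compatible A K D E \<psi>1 \<psi>2 \<theta>1 \<theta>2 by (rule l)
    obtain f g where iso: "rrb_iso (middle E) (middle E) (f, g)"
      and k: "\<And>k. k \<in> cK \<Longrightarrow> f (\<iota> k) = \<iota> (\<theta>1 k)" "\<And>l. l \<in> cL \<Longrightarrow> g (\<j> l) = \<j> (\<theta>2 l)"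
      and p': "\<And>h. h \<in> cH \<Longrightarrow> inv_into cA \<psi>1 (\<p> (f h)) = \<p> h"
        "\<And>h. h \<in> cG \<Longrightarrow> inv_into cB \<psi>2 (\<q> (g h)) = \<q> h"
      using eq unfolding ext_equiv_def c_def by (auto simp: tw_simps)
    have fg: "f \<in> hom gH gH" "g \<in> hom gG gG"
      "bij_betw f cH cH" "bij_betw g cG cG"
      "\<And>h. h \<in> cH \<Longrightarrow> g (R h) = R (f h)" "\<And>g' h. g' \<in> cG \<Longrightarrow> h \<in> cH \<Longrightarrow> f (\<phi> g' h) = \<phi> (g g') (f h)"
      using iso by (auto simp: rrb_iso_def rrb_hom_def iso_def)
    have cl [simp]: "h \<in> cH \<Longrightarrow> f h \<in> cH" "g' \<in> cG \<Longrightarrow> g g' \<in> cG" for h g'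
      using fg(1,2) by (auto simp: hom_def)
    have p: "\<p> (f h) = \<psi>1 (\<p> h)" if "h \<in> cH" for h
      using arg_cong[OF p'(1)[OF that], of \<psi>1] that by simp
    have q: "\<q> (g h) = \<psi>2 (\<q> h)" if "h \<in> cG" for h
      using arg_cong[OF p'(2)[OF that], of \<psi>2] that by simp
    \<comment> \<open>An equivalence is prescribed only on the carriers, whereas members of
      \<open>auto\<close> are extensional.\<close>
    define f' where "f' = restrict f cH"
    define g' where "g' = restrict g cG"
    have au: "f' \<in> auto gH" "g' \<in> auto gG"
      using fg(1-4) by (auto simp: f'_def g'_def auto_iff hom_def cong: bij_betw_cong)
    have ind: "induces (f', g') c"
      using p q k by (simp add: induces_def c_def f'_def g'_def)
    have im: "\<theta>1 ` cK = cK" "\<theta>2 ` cL = cL"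
      using autos by (auto simp: auto_iff bij_betw_def)
    have "f' ` \<iota> ` cK = \<iota> ` \<theta>1 ` cK" "g' ` \<j> ` cL = \<j> ` \<theta>2 ` cL"
      unfolding image_image by (intro image_cong; simp add: f'_def g'_def k)+
    then have "(f', g') \<in> cN"
      using au fg(5,6) by (simp add: mem_Aut_normalizing E.mem_rrb_Aut im) (simp add: f'_def g'_def)
    moreover have "\<rho> sH sG (f', g') = c"
      using induces_imp_rho_map_eq[OF ind[unfolded c_def] autos s] by (simp add: c_def)
    ultimately show "c \<in> \<rho> sH sG ` cN" by (metis imageI)
  qed
qed

section \<open>Derivations as automorphisms inducing the identity\<close>

definition shift :: "('a \<Rightarrow> 'k) \<times> ('b \<Rightarrow> 'l) \<Rightarrow> ('h \<Rightarrow> 'h) \<times> ('g \<Rightarrow> 'g)" where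
  "shift = (\<lambda>(\<kappa>1, \<kappa>2). (\<lambda>h\<in>cH. h *\<^sub>H \<iota> (\<kappa>1 (\<p> h)), \<lambda>g\<in>cG. g *\<^sub>G \<j> (\<kappa>2 (\<q> g))))"

text \<open>The four derivation equations correspond to the four laws of an automorphism:
  multiplicativity on H, multiplicativity on G, compatibility with \<open>\<phi>\<close>,
  compatibility with \<open>R\<close>. The value 1 at the identity makes the shift fix the
  kernel.\<close>

lemma shift_normalizing:
  assumes z: "(\<kappa>1, \<kappa>2) \<in> cZ1"
  shows "shift (\<kappa>1, \<kappa>2) \<in> cN"
proof -
  note [simp] = Z1D[OF z]
  define f where "f = (\<lambda>h\<in>cH. h *\<^sub>H \<iota> (\<kappa>1 (\<p> h)))"
  define g where "g = (\<lambda>g\<in>cG. g *\<^sub>G \<j> (\<kappa>2 (\<q> g)))"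
  have f: "f h = h *\<^sub>H \<iota> (\<kappa>1 (\<p> h))" if "h \<in> cH" for h using that by (simp add: f_def)
  have g: "g h = h *\<^sub>G \<j> (\<kappa>2 (\<q> h))" if "h \<in> cG" for h using that by (simp add: g_def)
  have "bij_betw f cH cH"
    \<comment> \<open>Shifting preserves the projection, so the shift by the pointwise inverse of
      \<kappa>1 undoes it.\<close>
    by (rule bij_betw_byWitness[where f' = "\<lambda>h. h *\<^sub>H \<iota> (inv\<^sub>K (\<kappa>1 (\<p> h)))"])
      (auto simp: f E.H.m_assoc)
  moreover have "f \<in> hom gH gH"
  proof (rule homI)
    fix h h' assume h: "h \<in> cH" "h' \<in> cH"
    then show "f (h *\<^sub>H h') = f h *\<^sub>H f h'"
      by (simp add: f mult_inc_mult(1)[of _ h'] E.H.m_assoc[symmetric])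
        (simp add: mult_inc_inc KH.m_comm del: inc_simps(3))
  qed (simp add: f)
  ultimately have 1: "f \<in> auto gH" by (simp add: auto_iff f_def)
  have "bij_betw g cG cG"
    by (rule bij_betw_byWitness[where f' = "\<lambda>h. h *\<^sub>G \<j> (inv\<^sub>L (\<kappa>2 (\<q> h)))"])
      (auto simp: g E.G.m_assoc)
  moreover have "g \<in> hom gG gG"
  proof (rule homI)
    fix h h' assume h: "h \<in> cG" "h' \<in> cG"
    then show "g (h *\<^sub>G h') = g h *\<^sub>G g h'"
      by (simp add: g mult_inc_mult(2)[of _ h'] E.G.m_assoc[symmetric])
        (simp add: mult_inc_inc KL.m_comm del: inc_simps(4))
  qed (simp add: g)
  ultimately have 2: "g \<in> auto gG" by (simp add: auto_iff g_def)
  have R: "g (R h) = R (f h)" if "h \<in> cH" for h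
    using that by (simp add: f g)
  have act: "f (\<phi> b h) = \<phi> (g b) (f h)" if "b \<in> cG" "h \<in> cH" for b h
  proof -
    have "\<phi> (g b) (f h) = \<phi> b h *\<^sub>H \<iota> (\<nu> (\<q> b) (\<f> (\<kappa>2 (\<q> b)) (\<p> h)) *\<^sub>K \<nu> (\<q> b) (\<kappa>1 (\<p> h)))"
      using that by (simp add: f g inc2_act act_inc1 E.H.m_assoc)
    then show ?thesis using that by (simp add: f)
  qed
  have "f ` \<iota> ` cK = (\<lambda>k. \<iota> k) ` cK" "g ` \<j> ` cL = (\<lambda>k. \<j> k) ` cL"
    unfolding image_image by (intro image_cong; simp add: f g)+
  then have "(f, g) \<in> cN"
    using 1 2 R act by (simp add: mem_Aut_normalizing E.mem_rrb_Aut)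
  then show ?thesis by (simp add: shift_def f_def g_def)
qed

text \<open>The converse: cancelling the middle element from each automorphism law leaves a
  derivation equation at projections, and the projections are surjective.\<close>

lemma shift_Z1:
  assumes s: "shift (\<kappa>1, \<kappa>2) \<in> cN"
    and k: "\<kappa>1 \<in> cA \<rightarrow>\<^sub>E cK" "\<kappa>2 \<in> cB \<rightarrow>\<^sub>E cL"
  shows "(\<kappa>1, \<kappa>2) \<in> cZ1"
proof -
  define f where "f = (\<lambda>h\<in>cH. h *\<^sub>H \<iota> (\<kappa>1 (\<p> h)))"
  define g where "g = (\<lambda>g\<in>cG. g *\<^sub>G \<j> (\<kappa>2 (\<q> g)))"
  have f: "f h = h *\<^sub>H \<iota> (\<kappa>1 (\<p> h))" if "h \<in> cH" for h using that by (simp add: f_def)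
  have g: "g h = h *\<^sub>G \<j> (\<kappa>2 (\<q> h))" if "h \<in> cG" for h using that by (simp add: g_def)
  have [simp]: "a \<in> cA \<Longrightarrow> \<kappa>1 a \<in> cK" "b \<in> cB \<Longrightarrow> \<kappa>2 b \<in> cL" for a b using k by auto
  have "(f, g) \<in> cN" using s by (simp add: shift_def f_def g_def)
  note d = Aut_normalizingD[OF this]
  have 1: "\<kappa>1 eA = eK" "\<kappa>2 eB = eL"
    using E.H.auto_one[OF d(1)] E.G.auto_one[OF d(2)] by (simp_all add: f g)
  have m1: "\<kappa>1 (\<p> h *\<^sub>A \<p> h') = \<kappa>1 (\<p> h') *\<^sub>K \<mu> (\<p> h') (\<kappa>1 (\<p> h))" if h: "h \<in> cH" "h' \<in> cH" for h h'
  proof -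
    have "h *\<^sub>H h' *\<^sub>H \<iota> (\<kappa>1 (\<p> h *\<^sub>A \<p> h')) = h *\<^sub>H \<iota> (\<kappa>1 (\<p> h)) *\<^sub>H h' *\<^sub>H \<iota> (\<kappa>1 (\<p> h'))"
      using auto_mult[OF d(1) h] h by (simp add: f E.H.m_assoc[symmetric])
    also have "\<dots> = h *\<^sub>H h' *\<^sub>H \<iota> (\<kappa>1 (\<p> h') *\<^sub>K \<mu> (\<p> h') (\<kappa>1 (\<p> h)))"
      using h by (simp add: mult_inc_mult(1)[of _ h'] mult_inc_inc KH.m_comm del: inc_simps(3))
    finally show ?thesis using h by (simp del: inc_simps(3))
  qed
  have m2: "\<kappa>2 (\<q> h *\<^sub>B \<q> h') = \<kappa>2 (\<q> h') *\<^sub>L \<sigma> (\<q> h') (\<kappa>2 (\<q> h))" if h: "h \<in> cG" "h' \<in> cG" for h h'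
  proof -
    have "h *\<^sub>G h' *\<^sub>G \<j> (\<kappa>2 (\<q> h *\<^sub>B \<q> h')) = h *\<^sub>G \<j> (\<kappa>2 (\<q> h)) *\<^sub>G h' *\<^sub>G \<j> (\<kappa>2 (\<q> h'))"
      using auto_mult[OF d(2) h] h by (simp add: g E.G.m_assoc[symmetric])
    also have "\<dots> = h *\<^sub>G h' *\<^sub>G \<j> (\<kappa>2 (\<q> h') *\<^sub>L \<sigma> (\<q> h') (\<kappa>2 (\<q> h)))"
      using h by (simp add: mult_inc_mult(2)[of _ h'] mult_inc_inc KL.m_comm del: inc_simps(4))
    finally show ?thesis using h by (simp del: inc_simps(4))
  qed
  have act: "\<nu> (\<q> b) (\<f> (\<kappa>2 (\<q> b)) (\<p> h) *\<^sub>K \<kappa>1 (\<p> h)) = \<kappa>1 (\<beta> (\<q> b) (\<p> h))" if h: "h \<in> cH" "b \<in> cG" for h b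
  proof -
    have "\<phi> b h *\<^sub>H \<iota> (\<kappa>1 (\<beta> (\<q> b) (\<p> h))) = f (\<phi> b h)" using h by (simp add: f)
    also have "\<dots> = \<phi> (g b) (f h)" using h d(4) by simp
    also have "\<dots> = \<phi> b h *\<^sub>H \<iota> (\<nu> (\<q> b) (\<f> (\<kappa>2 (\<q> b)) (\<p> h) *\<^sub>K \<kappa>1 (\<p> h)))"
      using h by (simp add: f g inc2_act act_inc1 E.H.m_assoc)
    finally show ?thesis using h by (simp del: inc_simps(3) nu_mult)
  qed
  have R: "S (\<nu>' (T (\<p> h)) (\<kappa>1 (\<p> h))) = \<kappa>2 (T (\<p> h))" if h: "h \<in> cH" for h
    using d(3)[OF h] h by (simp add: f g)
  have surj: "\<exists>h\<in>cH. a = \<p> h" "\<exists>g\<in>cG. b = \<q> g" if "a \<in> cA" "b \<in> cB" for a b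
    using proj_surj that by metis+
  show ?thesis
    unfolding mem_Z1
  proof (intro conjI ballI k 1)
    show "\<kappa>1 (a1 *\<^sub>A a2) = \<kappa>1 a2 *\<^sub>K \<mu> a2 (\<kappa>1 a1)" if "a1 \<in> cA" "a2 \<in> cA" for a1 a2
      using that surj(1)[OF _ A.G.one_closed] m1 by metis
    show "\<kappa>2 (a1 *\<^sub>B a2) = \<kappa>2 a2 *\<^sub>L \<sigma> a2 (\<kappa>2 a1)" if "a1 \<in> cB" "a2 \<in> cB" for a1 a2
      using that surj(2)[OF A.H.one_closed] m2 by metis
    show "\<nu> b (\<f> (\<kappa>2 b) a *\<^sub>K \<kappa>1 a) = \<kappa>1 (\<beta> b a)" if "a \<in> cA" "b \<in> cB" for a b
      using surj[OF that] act by blast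
    show "S (\<nu>' (T a) (\<kappa>1 a)) = \<kappa>2 (T a)" if "a \<in> cA" for a
      using surj(1)[OF that A.G.one_closed] R by blast
  qed
qed

text \<open>The inner shift leaves the projection unchanged, so the outer one evaluates its
  derivation at the same point; the two kernel factors may be exchanged.\<close>

lemma shift_mult:
  assumes z: "z \<in> cZ1" and z': "z' \<in> cZ1"
  shows "shift (z \<otimes>\<^bsub>Z1_RRB A K D\<^esub> z') = shift z \<otimes>\<^bsub>Aut_normalizing K E\<^esub> shift z'"
proof -
  obtain \<kappa>1 \<kappa>2 where z_def: "z = (\<kappa>1, \<kappa>2)" by (cases z)
  obtain \<kappa>1' \<kappa>2' where z'_def: "z' = (\<kappa>1', \<kappa>2')" by (cases z')
  obtain f g where s: "shift z = (f, g)" by (cases "shift z")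
  obtain f' g' where s': "shift z' = (f', g')" by (cases "shift z'")
  obtain f2 g2 where s2: "shift (z \<otimes>\<^bsub>Z1_RRB A K D\<^esub> z') = (f2, g2)" by (cases "shift (z \<otimes>\<^bsub>Z1_RRB A K D\<^esub> z')")
  have zz: "z \<otimes>\<^bsub>Z1_RRB A K D\<^esub> z' \<in> cZ1"
    using z z' monoid.m_closed[OF group.is_monoid[OF group_Z1]] by blast
  have n: "shift y \<in> cN" if "y \<in> cZ1" for y
    using shift_normalizing that by (cases y) simp
  note a = Aut_normalizingD(1,2)[OF n[OF z, unfolded s]] Aut_normalizingD(1,2)[OF n[OF z', unfolded s']]
    Aut_normalizingD(1,2)[OF n[OF zz, unfolded s2]]
  note [simp] = Z1D(1,2)[OF z[unfolded z_def]] Z1D(1,2)[OF z'[unfolded z'_def]]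
  have f: "f h = h *\<^sub>H \<iota> (\<kappa>1 (\<p> h))" "f' h = h *\<^sub>H \<iota> (\<kappa>1' (\<p> h))"
    "f2 h = h *\<^sub>H \<iota> (\<kappa>1 (\<p> h) *\<^sub>K \<kappa>1' (\<p> h))" if "h \<in> cH" for h
    using that s s' s2 unfolding z_def z'_def mult_Z1 shift_def by auto
  have g: "g h = h *\<^sub>G \<j> (\<kappa>2 (\<q> h))" "g' h = h *\<^sub>G \<j> (\<kappa>2' (\<q> h))"
    "g2 h = h *\<^sub>G \<j> (\<kappa>2 (\<q> h) *\<^sub>L \<kappa>2' (\<q> h))" if "h \<in> cG" for h
    using that s s' s2 unfolding z_def z'_def mult_Z1 shift_def by auto
  have "f2 = f \<circ>\<^sub>H f'"
    by (rule auto_ext[OF a(5) E.H.mult_AutoGroup_in[OF a(1,3)]])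
      (simp add: mult_AutoGroup_apply a f mult_inc_inc KH.m_comm del: inc_simps(3))
  moreover have "g2 = g \<circ>\<^sub>G g'"
    by (rule auto_ext[OF a(6) E.G.mult_AutoGroup_in[OF a(2,4)]])
      (simp add: mult_AutoGroup_apply a g mult_inc_inc KL.m_comm del: inc_simps(4))
  ultimately show ?thesis by (simp add: s s' s2 mult_Aut_normalizing)
qed

lemma group_hom_shift: "group_hom (Z1_RRB A K D) (Aut_normalizing K E) shift"
  using group_Z1 group_Aut_normalizing shift_normalizing shift_mult
  by (auto simp: group_hom_def group_hom_axioms_def hom_def)

lemma inj_on_shift: "inj_on shift cZ1"
proof (rule inj_onI)
  fix z z' assume z: "z \<in> cZ1" and z': "z' \<in> cZ1"
    and eq: "shift z = shift z'"
  obtain \<kappa>1 \<kappa>2 where z_def: "z = (\<kappa>1, \<kappa>2)" by (cases z)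
  obtain \<kappa>1' \<kappa>2' where z'_def: "z' = (\<kappa>1', \<kappa>2')" by (cases z')
  note [simp] = Z1D(1,2)[OF z[unfolded z_def]] Z1D(1,2)[OF z'[unfolded z'_def]]
  have k: "\<kappa>1 \<in> cA \<rightarrow>\<^sub>E cK" "\<kappa>1' \<in> cA \<rightarrow>\<^sub>E cK" "\<kappa>2 \<in> cB \<rightarrow>\<^sub>E cL" "\<kappa>2' \<in> cB \<rightarrow>\<^sub>E cL"
    using z z' unfolding z_def z'_def mem_Z1 by blast+
  have e: "(\<lambda>h\<in>cH. h *\<^sub>H \<iota> (\<kappa>1 (\<p> h))) = (\<lambda>h\<in>cH. h *\<^sub>H \<iota> (\<kappa>1' (\<p> h)))"
    "(\<lambda>g\<in>cG. g *\<^sub>G \<j> (\<kappa>2 (\<q> g))) = (\<lambda>g\<in>cG. g *\<^sub>G \<j> (\<kappa>2' (\<q> g)))"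
    using eq by (auto simp: z_def z'_def shift_def)
  have 1: "\<kappa>1 (\<p> h) = \<kappa>1' (\<p> h)" if "h \<in> cH" for h using fun_cong[OF e(1), of h] that by simp
  have 2: "\<kappa>2 (\<q> h) = \<kappa>2' (\<q> h)" if "h \<in> cG" for h using fun_cong[OF e(2), of h] that by simp
  have "\<kappa>1 = \<kappa>1'" by (rule PiE_ext[OF k(1,2)]) (use 1 proj_surj(1) in metis)
  moreover have "\<kappa>2 = \<kappa>2'" by (rule PiE_ext[OF k(3,4)]) (use 2 proj_surj(2) in metis)
  ultimately show "z = z'" by (simp add: z_def z'_def)
qed

lemma induces_one_iff:
  "induces (f, g) eC \<longleftrightarrow> (\<forall>h\<in>cH. \<p> (f h) = \<p> h) \<and> (\<forall>h\<in>cG. \<q> (g h) = \<q> h) \<and>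
    (\<forall>k\<in>cK. f (\<iota> k) = \<iota> k) \<and> (\<forall>l\<in>cL. g (\<j> l) = \<j> l)"
  by (simp add: induces_def one_C_group one_AutoGroup_apply)

text \<open>A shift preserves projections and fixes the kernel, so it induces the identity pair.
  Conversely, an automorphism inducing the identity moves each element within its fibre, and the
  displacement is the derivation.\<close>

lemma shift_image:
  assumes s: "sections A E sH sG"
  shows "shift ` cZ1 = kernel (Aut_normalizing K E) (C_group A K D) (\<rho> sH sG)"
proof
  show "shift ` cZ1 \<subseteq> kernel (Aut_normalizing K E) (C_group A K D) (\<rho> sH sG)"
  proof
    fix y assume "y \<in> shift ` cZ1"
    then obtain \<kappa>1 \<kappa>2 where z: "(\<kappa>1, \<kappa>2) \<in> cZ1" "y = shift (\<kappa>1, \<kappa>2)"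
      by (metis imageE prod.collapse)
    note [simp] = Z1D[OF z(1)]
    have i: "induces y eC"
      unfolding z(2) shift_def prod.case induces_one_iff by simp
    obtain f g where y: "y = (f, g)" by (cases y)
    have "\<rho> sH sG y = eC"
      unfolding y one_C_group
      by (rule induces_imp_rho_map_eq[OF i[unfolded y one_C_group] A.H.one_AutoGroup_in A.G.one_AutoGroup_in K.H.one_AutoGroup_in K.G.one_AutoGroup_in s])
    then show "y \<in> kernel (Aut_normalizing K E) (C_group A K D) (\<rho> sH sG)"
      using shift_normalizing[OF z(1)] z(2) by (simp add: kernel_def)
  qed
  show "kernel (Aut_normalizing K E) (C_group A K D) (\<rho> sH sG) \<subseteq> shift ` cZ1"
  proof
    fix y assume y: "y \<in> kernel (Aut_normalizing K E) (C_group A K D) (\<rho> sH sG)"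
    obtain f g where y_def: "y = (f, g)" by (cases y)
    have n: "(f, g) \<in> cN" and "\<rho> sH sG (f, g) = eC"
      using y by (auto simp: y_def kernel_def)
    then have "induces (f, g) eC" using rho_map_induces(1)[OF n s] by simp
    then have i [simp]: "\<And>h. h \<in> cH \<Longrightarrow> \<p> (f h) = \<p> h" "\<And>h. h \<in> cG \<Longrightarrow> \<q> (g h) = \<q> h"
      "\<And>k. k \<in> cK \<Longrightarrow> f (\<iota> k) = \<iota> k" "\<And>l. l \<in> cL \<Longrightarrow> g (\<j> l) = \<j> l"
      unfolding induces_one_iff by blast+
    note d = Aut_normalizingD[OF n]
    note [simp] = sectionsD[OF s] d(1,2)[THEN auto_closed]
    \<comment> \<open>The displacement is read off on section values only; fixing the kernel
      pointwise makes it the same along the whole fibre, as shown next for arbitrary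
      elements.\<close>
    define \<kappa>1 where "\<kappa>1 = (\<lambda>a\<in>cA. backK K E (inv\<^sub>H (sH a) *\<^sub>H f (sH a)))"
    define \<kappa>2 where "\<kappa>2 = (\<lambda>b\<in>cB. backL K E (inv\<^sub>G (sG b) *\<^sub>G g (sG b)))"
    have k: "\<kappa>1 \<in> cA \<rightarrow>\<^sub>E cK" "\<kappa>2 \<in> cB \<rightarrow>\<^sub>E cL" by (auto simp: \<kappa>1_def \<kappa>2_def)
    then have [simp]: "a \<in> cA \<Longrightarrow> \<kappa>1 a \<in> cK" "b \<in> cB \<Longrightarrow> \<kappa>2 b \<in> cL" for a b by auto
    have fs: "f (sH a) = sH a *\<^sub>H \<iota> (\<kappa>1 a)" if "a \<in> cA" for a
      using that backK_eq_iff[of "sH a" "f (sH a)" "\<kappa>1 a"] by (simp add: \<kappa>1_def)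
    have gs: "g (sG b) = sG b *\<^sub>G \<j> (\<kappa>2 b)" if "b \<in> cB" for b
      using that backL_eq_iff[of "sG b" "g (sG b)" "\<kappa>2 b"] by (simp add: \<kappa>2_def)
    have f: "f h = h *\<^sub>H \<iota> (\<kappa>1 (\<p> h))" if "h \<in> cH" for h
      using that
    proof (rule section_cases[OF s])
      fix a k assume "a \<in> cA" "k \<in> cK" "h = sH a *\<^sub>H \<iota> k"
      \<comment> \<open>\<open>f\<close> fixes \<open>\<iota> k\<close>, and the displacement of
        \<open>sH a\<close> commutes with it, so it can be moved past \<open>\<iota> k\<close> to
        the end.\<close>
      then show ?thesis
        by (simp add: auto_mult[OF d(1)] fs mult_inc_inc KH.m_comm del: inc_simps(3))
    qed
    have g: "g h = h *\<^sub>G \<j> (\<kappa>2 (\<q> h))" if "h \<in> cG" for h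
      using that
    proof (rule section_cases2[OF s])
      fix a k assume "a \<in> cB" "k \<in> cL" "h = sG a *\<^sub>G \<j> k"
      then show ?thesis
        by (simp add: auto_mult[OF d(2)] gs mult_inc_inc KL.m_comm del: inc_simps(4))
    qed
    have "f = (\<lambda>h\<in>cH. h *\<^sub>H \<iota> (\<kappa>1 (\<p> h)))"
      using d(1) f by (intro extensionalityI[of f cH]) (auto simp: auto_iff)
    moreover have "g = (\<lambda>g\<in>cG. g *\<^sub>G \<j> (\<kappa>2 (\<q> g)))"
      using d(2) g by (intro extensionalityI[of g cG]) (auto simp: auto_iff)
    ultimately have y2: "y = shift (\<kappa>1, \<kappa>2)" by (simp add: y_def shift_def)
    then have "(\<kappa>1, \<kappa>2) \<in> cZ1"
      using shift_Z1[OF _ k] n y_def by simp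
    then show "y \<in> shift ` cZ1" using y2 by blast
  qed
qed

end

text \<open>Members of \<open>Ext\<close> are nonempty since each contains its representative, while
  \<open>ext_rel\<close> relates only abelian extensions with associated action D. A nonempty class
  of E therefore forces E to be one of them.\<close>

lemma ext_class_in_Ext:
  fixes E :: "('a, 'b, 'k, 'l, 'h, 'g) rrb_extn"
  assumes "ext_class A K D E \<in> Ext A K D"
  shows "rrb_ab_ext A K D E"
proof -
  obtain F :: "('a, 'b, 'k, 'l, 'h, 'g) rrb_extn" where F: "rrb_ab_ext A K D F"
    and eq: "ext_class A K D E = ext_class A K D F"
    using assms by (auto simp: Ext_def quotient_def ext_class_def rrb_ab_ext_iff)
  have "F \<in> ext_class A K D E"
    unfolding eq rrb_ab_ext.ext_class_eq[OF F] using F by simp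
  then show ?thesis
    unfolding rrb_ab_ext_iff[symmetric] by (auto simp: ext_class_def ext_rel_def)
qed

theorem theorem4p7:
  fixes A :: "('a, 'b) rrb"
    and K :: "('k, 'l) rrb"
    and E :: "('a, 'b, 'k, 'l, 'h, 'g) rrb_extn"
    and D :: "('a, 'b, 'k, 'l) rrb_action"
    and sH :: "'a \<Rightarrow> 'h" and sG :: "'b \<Rightarrow> 'g"
  assumes "abelian_extension A K E"
    and "ext_class A K D E \<in> Ext A K D"
    and "sections A E sH sG"
  shows "(\<exists>\<iota>. group_hom (Z1_RRB A K D) (Aut_normalizing K E) \<iota> \<and>
            inj_on \<iota> (carrier (Z1_RRB A K D)) \<and>
            \<iota> ` carrier (Z1_RRB A K D)
              = kernel (Aut_normalizing K E) (C_group A K D) (rho_map A K E sH sG)) \<and>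
         group_hom (Aut_normalizing K E) (C_group A K D) (rho_map A K E sH sG) \<and>
         group (H2_RRB A K D) \<and>
         omega_map A K D E \<in> carrier (C_group A K D) \<rightarrow> carrier (H2_RRB A K D) \<and>
         rho_map A K E sH sG ` carrier (Aut_normalizing K E)
           = {c \<in> carrier (C_group A K D). omega_map A K D E c = \<one>\<^bsub>H2_RRB A K D\<^esub>} \<and>
         (\<forall>c1 \<in> carrier (C_group A K D). \<forall>c2 \<in> carrier (C_group A K D).
            omega_map A K D E (c1 \<otimes>\<^bsub>C_group A K D\<^esub> c2)
              = H2_twist A K (omega_map A K D E c1) c2 \<otimes>\<^bsub>H2_RRB A K D\<^esub> omega_map A K D E c2)"
proof -
  interpret rrb_ab_ext A K D E
    using assms(2) by (rule ext_class_in_Ext)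
  note s = assms(3)
  show ?thesis
    using group_hom_shift inj_on_shift shift_image[OF s] group_hom_rho_map[OF s] group_H2
      omega_map_closed rho_map_image[OF s] omega_map_derivation
    by (intro conjI exI[of _ shift]) auto
qed

end
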